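(* Let $s\in L_{2,loc}(\mathbb{R}_+)$ be complex-valued and let $L_0$ be the minimal operator constructed from $s$. Suppose that for some $d>0$, some $z_0\in\mathbb{C}$ and some real $\alpha,\beta$ with $0\le\beta-\alpha<\pi$, $|\alpha|<\pi$, $|\beta|<\pi$, $$s(x)-s(t)\in\Lambda_{\alpha,\beta}(z_0)\quad\text{for all }x,t\in\mathbb{R}_+\text{ with }0\le x-t\le d.$$ Then $L_0$ is strictly sectorial. Moreover, in this case $L_0$ has extensions with compact resolvents if and only if $$\forall a>0\quad \lim_{x\to+\infty}|s(x+a)-s(x)|=+\infty .$$
   Context: $\mathbb{R}_+=[0,+\infty)$; the subscript "loc" means the property holds on every segment $[0,R]$. Minimal operator constructed from a complex-valued $s\in L_{2,loc}(\mathbb{R}_+)$: for $y\in AC_{loc}(\mathbb{R}_+)$ put $y^{[1]}=y'-sy$, and if $y^{[1]}\in AC_{loc}(\mathbb{R}_+)$ put $l(y)=-(y^{[1]})'-sy^{[1]}-s^2y$ (a regularization of $-y''+s'y$). Let $$\mathscr{D}_0=\{y\in L_2(\mathbb{R}_+): y,y^{[1]}\in AC_{loc}(\mathbb{R}_+),\ l(y)\in L_2(\mathbb{R}_+),\ y(0)=y^{[1]}(0)=0,\ \operatorname{supp}y\text{ compact}\}.$$ The minimal operator $L_0$ acts in $L_2(\mathbb{R}_+)$ by $L_0y=l(y)$ on the domain $\mathscr{D}_0$. "$L_0$ has extensions with compact resolvents" means that there is a linear operator $L$ in $L_2(\mathbb{R}_+)$ extending $L_0$ with non-empty resolvent set and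 with $(L-\lambda)^{-1}$ compact for $\lambda$ in the resolvent set. For $z_0\in\mathbb{C}$ let $\Lambda_{\alpha,\beta}(z_0)=\{z_0+z: z\in\mathbb{C},\ \arg z\in[\alpha,\beta]\}$, where $\arg z\in[\alpha,\beta]$ means $z=re^{i\varphi}$ with some $r\ge0$, $\varphi\in[\alpha,\beta]$ (so the vertex $z_0$ is included). An operator $L$ with domain $\mathscr{D}(L)$ is strictly sectorial if there are $z_0\in\mathbb{C}$ and $\alpha,\beta$ with $0\le\beta-\alpha<\pi$ such that $(Ly,y)\in\Lambda_{\alpha,\beta}(z_0)$ for all $y\in\mathscr{D}(L)$, $\|y\|=1$. *)

theory Defs
  imports "HOL-Analysis.Analysis"
begin

section \<open>The complex Hilbert space $L_2(\mathbb{R}_+)$\<close>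

abbreviation half_line :: "real measure" where
  "half_line \<equiv> lebesgue_on {0..}"

definition square_integrable :: "(real \<Rightarrow> complex) \<Rightarrow> bool" where
  "square_integrable f \<longleftrightarrow>
     f \<in> borel_measurable half_line \<and> integrable half_line (\<lambda>x. (cmod (f x))\<^sup>2)"

lemma square_integrable_zero: "square_integrable (\<lambda>_. 0)"
  by (simp add: square_integrable_def)

lemma square_integrable_add:
  assumes "square_integrable f" "square_integrable g"
  shows "square_integrable (\<lambda>x. f x + g x)"
proof -
  have [measurable]: "f \<in> borel_measurable half_line" "g \<in> borel_measurable half_line"
    using assms by (auto simp: square_integrable_def)
  have "integrable half_line (\<lambda>x. 2 * (cmod (f x))\<^sup>2 + 2 * (cmod (g x))\<^sup>2)"
    using assms by (auto simp: square_integrable_def)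
  then have "integrable half_line (\<lambda>x. (cmod (f x + g x))\<^sup>2)"
  proof (rule Bochner_Integration.integrable_bound)
    show "AE x in half_line. norm ((cmod (f x + g x))\<^sup>2)
            \<le> norm (2 * (cmod (f x))\<^sup>2 + 2 * (cmod (g x))\<^sup>2)"
    proof (rule AE_I2)
      fix x
      have "(cmod (f x + g x))\<^sup>2 \<le> (cmod (f x) + cmod (g x))\<^sup>2"
        by (simp add: norm_triangle_ineq power_mono)
      also have "\<dots> \<le> 2 * (cmod (f x))\<^sup>2 + 2 * (cmod (g x))\<^sup>2"
        using sum_squares_bound[of "cmod (f x)" "cmod (g x)"] by (simp add: power2_sum)
      finally show "norm ((cmod (f x + g x))\<^sup>2)
            \<le> norm (2 * (cmod (f x))\<^sup>2 + 2 * (cmod (g x))\<^sup>2)" by simp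
    qed
  qed measurable
  then show ?thesis by (simp add: square_integrable_def)
qed

lemma square_integrable_mult:
  assumes "square_integrable f"
  shows "square_integrable (\<lambda>x. c * f x)"
  using assms by (auto simp: square_integrable_def norm_mult power_mult_distrib)

lemma square_integrable_product:
  assumes "square_integrable f" "square_integrable g"
  shows "integrable half_line (\<lambda>x. f x * cnj (g x))"
proof -
  have [measurable]: "f \<in> borel_measurable half_line" "g \<in> borel_measurable half_line"
    using assms by (auto simp: square_integrable_def)
  have [measurable]: "(\<lambda>x. cnj (g x)) \<in> borel_measurable half_line"
    by (rule measurable_compose[OF _ borel_measurable_continuous_onI]) (auto intro: continuous_intros)
  have "integrable half_line (\<lambda>x. (cmod (f x))\<^sup>2 + (cmod (g x))\<^sup>2)"
    using assms by (auto simp: square_integrable_def)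
  then show ?thesis
  proof (rule Bochner_Integration.integrable_bound)
    show "AE x in half_line. norm (f x * cnj (g x))
            \<le> norm ((cmod (f x))\<^sup>2 + (cmod (g x))\<^sup>2)"
    proof (rule AE_I2)
      fix x
      have "2 * (cmod (f x) * cmod (g x)) \<le> (cmod (f x))\<^sup>2 + (cmod (g x))\<^sup>2"
        using sum_squares_bound[of "cmod (f x)" "cmod (g x)"] by (simp add: mult.assoc)
      moreover have "0 \<le> cmod (f x) * cmod (g x)"
        by simp
      ultimately show "norm (f x * cnj (g x)) \<le> norm ((cmod (f x))\<^sup>2 + (cmod (g x))\<^sup>2)"
        unfolding norm_mult complex_mod_cnj real_norm_def by linarith
    qed
  qed measurable
qed

quotient_type l2 = "real \<Rightarrow> complex" / partial:
  "\<lambda>f g. square_integrable f \<and> square_integrable g \<and> (AE x in half_line. f x = g x)"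
proof (rule part_equivpI)
  show "\<exists>f. square_integrable f \<and> square_integrable f \<and> (AE x in half_line. f x = f x)"
    using square_integrable_zero by auto
  show "symp (\<lambda>f g. square_integrable f \<and> square_integrable g \<and> (AE x in half_line. f x = g x))"
    by (auto intro!: sympI elim: AE_mp)
  show "transp (\<lambda>f g. square_integrable f \<and> square_integrable g \<and> (AE x in half_line. f x = g x))"
    by (auto intro!: transpI elim: eventually_elim2)
qed

lift_definition l2_scaleC :: "complex \<Rightarrow> l2 \<Rightarrow> l2" is "\<lambda>c f x. c * f x"
  by (auto intro!: square_integrable_mult)

lift_definition l2_cinner :: "l2 \<Rightarrow> l2 \<Rightarrow> complex" is
  "\<lambda>f g. LINT x|half_line. f x * cnj (g x)"
proof -
  fix f f' g g' :: "real \<Rightarrow> complex"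
  assume f: "square_integrable f \<and> square_integrable f' \<and> (AE x in half_line. f x = f' x)"
    and g: "square_integrable g \<and> square_integrable g' \<and> (AE x in half_line. g x = g' x)"
  show "(LINT x|half_line. f x * cnj (g x)) = (LINT x|half_line. f' x * cnj (g' x))"
  proof (rule integral_cong_AE)
    show "(\<lambda>x. f x * cnj (g x)) \<in> borel_measurable half_line"
      "(\<lambda>x. f' x * cnj (g' x)) \<in> borel_measurable half_line"
      using f g by (auto intro!: borel_measurable_integrable square_integrable_product)
    show "AE x in half_line. f x * cnj (g x) = f' x * cnj (g' x)"
      using f g by (auto elim: eventually_elim2)
  qed
qed

instantiation l2 :: ab_group_add
begin

lift_definition zero_l2 :: l2 is "\<lambda>_. 0"
  by (simp add: square_integrable_zero)

lift_definition plus_l2 :: "l2 \<Rightarrow> l2 \<Rightarrow> l2" is "\<lambda>f g x. f x + g x"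
  by (auto intro!: square_integrable_add elim: eventually_elim2)

lift_definition uminus_l2 :: "l2 \<Rightarrow> l2" is "\<lambda>f x. - f x"
  using square_integrable_mult[of _ "-1"] by auto

definition minus_l2 :: "l2 \<Rightarrow> l2 \<Rightarrow> l2" where
  "minus_l2 f g = f + - g"

instance
proof
  fix a b c :: l2
  show "a + b + c = a + (b + c)"
    by transfer (auto simp: add.assoc intro!: square_integrable_add)
  show "a + b = b + a"
    by transfer (auto simp: add.commute intro!: square_integrable_add)
  show "0 + a = a"
    by transfer auto
  show "- a + a = 0"
    by transfer (auto simp: square_integrable_zero)
  show "a - b = a + - b"
    by (rule minus_l2_def)
qed

end

instantiation l2 :: real_vector
begin

definition scaleR_l2 :: "real \<Rightarrow> l2 \<Rightarrow> l2" where
  "scaleR_l2 r f = l2_scaleC (complex_of_real r) f"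

instance
proof
  fix a b :: real and f g :: l2
  show "a *\<^sub>R (f + g) = a *\<^sub>R f + a *\<^sub>R g"
    unfolding scaleR_l2_def
    by transfer (auto simp: ring_distribs intro!: square_integrable_add square_integrable_mult)
  show "(a + b) *\<^sub>R f = a *\<^sub>R f + b *\<^sub>R f"
    unfolding scaleR_l2_def
    by transfer (auto simp: ring_distribs intro!: square_integrable_add square_integrable_mult)
  show "a *\<^sub>R b *\<^sub>R f = (a * b) *\<^sub>R f"
    unfolding scaleR_l2_def
    by transfer (auto simp: mult.assoc intro!: square_integrable_mult)
  show "1 *\<^sub>R f = f"
    unfolding scaleR_l2_def by transfer auto
qed

end

lemma l2_cinner_commute: "l2_cinner f g = cnj (l2_cinner g f)"
proof transfer
  fix f g :: "real \<Rightarrow> complex"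
  have "cnj (LINT x|half_line. g x * cnj (f x)) = (LINT x|half_line. cnj (g x * cnj (f x)))"
    by (rule Bochner_Integration.integral_cnj[symmetric])
  then show "(LINT x|half_line. f x * cnj (g x)) = cnj (LINT x|half_line. g x * cnj (f x))"
    by (simp add: mult.commute)
qed

lemma l2_cinner_add_left: "l2_cinner (f + g) h = l2_cinner f h + l2_cinner g h"
  by transfer (simp add: ring_distribs square_integrable_product)

lemma l2_cinner_scaleC_left: "l2_cinner (l2_scaleC c f) g = c * l2_cinner f g"
  by transfer (simp add: mult.assoc)

lemma l2_cinner_self_aux:
  "(LINT x|half_line. f x * cnj (f x)) = complex_of_real (LINT x|half_line. (cmod (f x))\<^sup>2)"
  by (simp flip: complex_norm_square integral_complex_of_real)

lemma l2_cinner_self_nonneg: "0 \<le> Re (l2_cinner f f)"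
  by transfer (simp add: l2_cinner_self_aux)

lemma l2_cinner_self_eq_0_iff: "Re (l2_cinner f f) = 0 \<longleftrightarrow> f = 0"
proof transfer
  fix f :: "real \<Rightarrow> complex"
  assume "square_integrable f \<and> square_integrable f \<and> (AE x in half_line. f x = f x)"
  then have f: "square_integrable f" "integrable half_line (\<lambda>x. (cmod (f x))\<^sup>2)"
    by (auto simp: square_integrable_def)
  have "Re (LINT x|half_line. f x * cnj (f x)) = 0 \<longleftrightarrow> (AE x in half_line. (cmod (f x))\<^sup>2 = 0)"
    unfolding l2_cinner_self_aux
    using integral_nonneg_eq_0_iff_AE[OF f(2)] by simp
  then show "(Re (LINT x|half_line. f x * cnj (f x)) = 0) \<longleftrightarrow>
      square_integrable f \<and> square_integrable (\<lambda>_. 0) \<and> (AE x in half_line. f x = 0)"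
    using f(1) square_integrable_zero by simp
qed

instantiation l2 :: real_inner
begin

definition inner_l2 :: "l2 \<Rightarrow> l2 \<Rightarrow> real" where
  "inner_l2 f g = Re (l2_cinner f g)"

definition norm_l2 :: "l2 \<Rightarrow> real" where
  "norm_l2 f = sqrt (Re (l2_cinner f f))"

definition dist_l2 :: "l2 \<Rightarrow> l2 \<Rightarrow> real" where
  "dist_l2 f g = norm (f - g)"

definition sgn_l2 :: "l2 \<Rightarrow> l2" where
  "sgn_l2 f = f /\<^sub>R norm f"

definition uniformity_l2 :: "(l2 \<times> l2) filter" where
  "uniformity_l2 = (INF e\<in>{0<..}. principal {(f, g). dist f g < e})"

definition open_l2 :: "l2 set \<Rightarrow> bool" where
  "open_l2 U \<longleftrightarrow> (\<forall>f\<in>U. \<forall>\<^sub>F (f', g) in uniformity. f' = f \<longrightarrow> g \<in> U)"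

instance
proof
  fix f g h :: l2 and r :: real and U :: "l2 set"
  show "dist f g = norm (f - g)"
    by (rule dist_l2_def)
  show "sgn f = f /\<^sub>R norm f"
    by (rule sgn_l2_def)
  show "(uniformity :: (l2 \<times> l2) filter) = (INF e\<in>{0<..}. principal {(f, g). dist f g < e})"
    by (rule uniformity_l2_def)
  show "open U \<longleftrightarrow> (\<forall>f\<in>U. \<forall>\<^sub>F (f', g) in uniformity. f' = f \<longrightarrow> g \<in> U)"
    by (rule open_l2_def)
  show "inner f g = inner g f"
    unfolding inner_l2_def by (subst l2_cinner_commute) simp
  show "inner (f + g) h = inner f h + inner g h"
    by (simp add: inner_l2_def l2_cinner_add_left)
  show "inner (r *\<^sub>R f) g = r * inner f g"
    by (simp add: inner_l2_def scaleR_l2_def l2_cinner_scaleC_left)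
  show "0 \<le> inner f f"
    by (simp add: inner_l2_def l2_cinner_self_nonneg)
  show "inner f f = 0 \<longleftrightarrow> f = 0"
    by (simp add: inner_l2_def l2_cinner_self_eq_0_iff)
  show "norm f = sqrt (inner f f)"
    by (simp add: inner_l2_def norm_l2_def)
qed

end


section \<open>Linear operators in $L_2(\mathbb{R}_+)$\<close>

text \<open>
  A (not necessarily everywhere defined) operator is represented by its graph: a pair
  \<^term>\<open>(f, g)\<close> belongs to \<^term>\<open>L\<close> iff \<^term>\<open>f\<close> lies in the domain of the operator and is mapped
  to \<^term>\<open>g\<close>. Thus the domain is \<^term>\<open>Domain L\<close>, ``extends'' is set inclusion, and the inverse
  is the converse relation.
\<close>

type_synonym l2_operator = "(l2 \<times> l2) set"

definition linear_operator :: "l2_operator \<Rightarrow> bool" where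
  "linear_operator L \<longleftrightarrow>
     single_valued L \<and> (0, 0) \<in> L \<and>
     (\<forall>f g f' g'. (f, g) \<in> L \<and> (f', g') \<in> L \<longrightarrow> (f + f', g + g') \<in> L) \<and>
     (\<forall>c f g. (f, g) \<in> L \<longrightarrow> (l2_scaleC c f, l2_scaleC c g) \<in> L)"

definition shift_operator :: "l2_operator \<Rightarrow> complex \<Rightarrow> l2_operator" where
  "shift_operator L \<mu> = {(f, g - l2_scaleC \<mu> f) | f g. (f, g) \<in> L}"

definition is_resolvent :: "l2_operator \<Rightarrow> complex \<Rightarrow> (l2 \<Rightarrow> l2) \<Rightarrow> bool" where
  "is_resolvent L \<mu> R \<longleftrightarrow> bounded_linear R \<and> (shift_operator L \<mu>)\<inverse> = {(f, R f) | f. True}"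

definition resolvent_set :: "l2_operator \<Rightarrow> complex set" where
  "resolvent_set L = {\<mu>. \<exists>R. is_resolvent L \<mu> R}"

definition compact_operator :: "(l2 \<Rightarrow> l2) \<Rightarrow> bool" where
  "compact_operator R \<longleftrightarrow> linear R \<and> (\<forall>B. bounded B \<longrightarrow> compact (closure (R ` B)))"

definition has_compact_resolvents :: "l2_operator \<Rightarrow> bool" where
  "has_compact_resolvents L \<longleftrightarrow>
     resolvent_set L \<noteq> {} \<and> (\<forall>\<mu> R. is_resolvent L \<mu> R \<longrightarrow> compact_operator R)"

definition has_extensions_with_compact_resolvents :: "l2_operator \<Rightarrow> bool" where
  "has_extensions_with_compact_resolvents L\<^sub>0 \<longleftrightarrow>
     (\<exists>L. linear_operator L \<and> L\<^sub>0 \<subseteq> L \<and> has_compact_resolvents L)"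

definition sector :: "real \<Rightarrow> real \<Rightarrow> complex \<Rightarrow> complex set" where
  "sector \<alpha> \<beta> z\<^sub>0 = {z\<^sub>0 + complex_of_real r * cis \<phi> | r \<phi>. 0 \<le> r \<and> \<alpha> \<le> \<phi> \<and> \<phi> \<le> \<beta>}"

definition strictly_sectorial :: "l2_operator \<Rightarrow> bool" where
  "strictly_sectorial L \<longleftrightarrow>
     (\<exists>z\<^sub>0 \<alpha> \<beta>. 0 \<le> \<beta> - \<alpha> \<and> \<beta> - \<alpha> < pi \<and>
        (\<forall>(f, g)\<in>L. norm f = 1 \<longrightarrow> l2_cinner g f \<in> sector \<alpha> \<beta> z\<^sub>0))"


section \<open>The minimal operator\<close>

definition L2_loc :: "(real \<Rightarrow> complex) \<Rightarrow> bool" where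
  "L2_loc s \<longleftrightarrow> s \<in> borel_measurable half_line \<and>
     (\<forall>R\<ge>0. integrable (lebesgue_on {0..R}) (\<lambda>x. (cmod (s x))\<^sup>2))"

definition absolutely_continuous_on_segment :: "real \<Rightarrow> real \<Rightarrow> (real \<Rightarrow> complex) \<Rightarrow> bool" where
  "absolutely_continuous_on_segment a b f \<longleftrightarrow>
     (\<forall>\<epsilon>>0. \<exists>\<delta>>0. \<forall>(n::nat) p q.
        (\<forall>i<n. a \<le> p i \<and> p i \<le> q i \<and> q i \<le> b) \<and>
        disjoint_family_on (\<lambda>i. {p i<..<q i}) {..<n} \<and>
        (\<Sum>i<n. q i - p i) < \<delta> \<longrightarrow>
        (\<Sum>i<n. cmod (f (q i) - f (p i))) < \<epsilon>)"

definition AC_loc :: "(real \<Rightarrow> complex) \<Rightarrow> bool" where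
  "AC_loc f \<longleftrightarrow> (\<forall>R\<ge>0. absolutely_continuous_on_segment 0 R f)"

text \<open>
  For \<^term>\<open>y\<close> locally absolutely continuous, $y^{[1]} = y' - sy$ is only defined almost everywhere;
  $y^{[1]} \in AC_{loc}$ means that it agrees almost everywhere with a (necessarily unique on the
  half-line) locally absolutely continuous function \<^term>\<open>u\<close>, and then $y^{[1]}(0)$ is \<^term>\<open>u 0\<close>.
\<close>

definition is_quasi_derivative ::
    "(real \<Rightarrow> complex) \<Rightarrow> (real \<Rightarrow> complex) \<Rightarrow> (real \<Rightarrow> complex) \<Rightarrow> bool" where
  "is_quasi_derivative s y u \<longleftrightarrow> AC_loc y \<and> AC_loc u \<and>
     (AE x in half_line. \<exists>y'. (y has_vector_derivative y') (at x within {0..}) \<and>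
        u x = y' - s x * y x)"

text \<open>
  \<^term>\<open>w\<close> is (a representative of) $l(y) = -(y^{[1]})' - s y^{[1]} - s^2 y$, where \<^term>\<open>u\<close> is
  $y^{[1]}$.
\<close>

definition is_differential_expression ::
    "(real \<Rightarrow> complex) \<Rightarrow> (real \<Rightarrow> complex) \<Rightarrow> (real \<Rightarrow> complex) \<Rightarrow> (real \<Rightarrow> complex) \<Rightarrow> bool"
  where
  "is_differential_expression s y u w \<longleftrightarrow> is_quasi_derivative s y u \<and>
     (AE x in half_line. \<exists>u'. (u has_vector_derivative u') (at x within {0..}) \<and>
        w x = - u' - s x * u x - (s x)\<^sup>2 * y x)"

definition minimal_operator :: "(real \<Rightarrow> complex) \<Rightarrow> l2_operator" where
  "minimal_operator s =
     {(abs_l2 y, abs_l2 w) | y u w.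
        square_integrable y \<and> square_integrable w \<and>
        is_differential_expression s y u w \<and>
        y 0 = 0 \<and> u 0 = 0 \<and>
        compact (closure {x \<in> {0..}. y x \<noteq> 0})}"

end

theory Submission
  imports Defs "HOL-Complex_Analysis.Great_Picard"
begin

text \<open>
  For $y$ in the domain of $L_0$ put $v = y' = y^{[1]} + sy$. Integration by parts gives
  \[ (L_0y,y) = \int |v|^2 - \int s\,(|y|^2)' . \]
  The hypothesis on the increments of $s$ says that, in suitable oblique coordinates of the plane, both
  coordinates of $s$ are increasing up to bounded errors on segments of length $d$. Hence
  \[ s(x) = m_1(x)\,e^{i\gamma} + m_2(x)\,e^{i\delta} + b(x) + \kappa x \]
  with $m_1, m_2$ increasing, $b$ bounded and $\gamma < 0 < \delta < \gamma + \pi$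
  (\<open>sectorial_increments_decomposition\<close>), and
  \[ (L_0y,y) = A + B_1e^{i\gamma} + B_2e^{i\delta} + E, \qquad
     A = \int|v|^2 \ge 0, \quad B_j = -\int m_j\,(|y|^2)' = \int|y|^2\,dm_j \ge 0, \]
  where $|E| \le \varepsilon A + C_\varepsilon\|y\|^2$ for every $\varepsilon > 0$
  (\<open>form_decomposition\<close>). The directions $0, \gamma, \delta$ lie in an open half-plane, so $L_0$ is
  strictly sectorial, and for suitable $\theta$ and $\tau$ the operator $M = e^{-i\theta}(L_0 + \tau)$
  satisfies $\mathrm{Re}\,(My,y) \ge c\,(A + B_1 + B_2 + \|y\|^2)$ (\<open>form_coercive\<close>).
  
  Since $b$ is bounded, $|s(x+a)-s(x)| \to \infty$ exactly when the increments of $m_1 + m_2$ over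
  segments of length $a$ tend to infinity.
  
  Suppose that they do. On a segment of length $a$ the function $|y|^2$ is controlled by its value at any
  point and by $a\int|v|^2$; the second mean value theorem turns $B_1 + B_2$ into a sum of values of $|y|^2$
  at points of the segments, weighted by the increments of $m_1+m_2$. So the far part of $\|y\|^2$ is at most
  a small multiple of the energy, and the near part is controlled by finitely many values of $y$
  (\<open>grid_estimate\<close>). Therefore $M^{-1}$, which is defined on the range of $M$, is compact
  there. Its domain $\mathscr{D}_0$ is dense, because it contains the functions $e^Sg$ with $S' = s$ and $g$ a
  $C^2$ bump (\<open>exponential_bump\<close>, \<open>minimal_operator_domain_dense\<close>). A densely defined coercive
  operator whose inverse is compact on its range admits an everywhere defined compact injective extension of
  the inverse (\<open>accretive_compact_injective_inverse_extension\<close>), and this extension is the inverse of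
  an extension of $M$ (\<open>extension_from_compact_inverse\<close>).
  
  Conversely, if the increments stay bounded along some $x_n \to \infty$, then $s - s(x_n)$ is bounded on
  $[x_n, x_n+a]$ uniformly in $n$. Replacing $s$ by $s - s(x_n)$ does not change $l(y)$, so the bumps
  $y_n = e^{S_n}g(\cdot - x_n)$ with $S_n' = s - s(x_n)$ belong to $\mathscr{D}_0$, have $\|y_n\|$ bounded
  below and $\|L_0y_n\|$ bounded above, and are pairwise orthogonal for a sparse choice of the $x_n$. For a
  resolvent $R$ at $\mu$ of any extension, the bounded sequence $L_0y_n - \mu y_n$ is mapped by $R$ to $y_n$,
  which has no convergent subsequence.
\<close>

section \<open>Adjoints and inverses in a real Hilbert space\<close>

text \<open>
  The variational proof of the Riesz theorem: a sequence in $N$ minimizing $\|x\|^2 - 2\varphi(x)$ is Cauchy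
  by the parallelogram law, and its limit represents $\varphi$. Allowing a subspace that is not closed makes
  adjoints, orthogonal projections and extensions by continuity available from this one statement.
\<close>

lemma riesz_on_subspace:
  fixes N :: "'a::{real_inner,complete_space} set" and \<phi> :: "'a \<Rightarrow> real"
  assumes N: "subspace N"
    and add: "\<And>x y. x \<in> N \<Longrightarrow> y \<in> N \<Longrightarrow> \<phi> (x + y) = \<phi> x + \<phi> y"
    and scale: "\<And>c x. x \<in> N \<Longrightarrow> \<phi> (c *\<^sub>R x) = c * \<phi> x"
    and bound: "\<And>x. x \<in> N \<Longrightarrow> \<bar>\<phi> x\<bar> \<le> C * norm x"
  shows "\<exists>z\<in>closure N. \<forall>x\<in>N. \<phi> x = inner x z"
proof -
  define J where "J x = (norm x)\<^sup>2 - 2 * \<phi> x" for x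
  define m where "m = Inf (J ` N)"
  have lower: "- C\<^sup>2 \<le> J x" if "x \<in> N" for x
  proof -
    have "0 \<le> (norm x - C)\<^sup>2" by simp
    then show ?thesis
      using bound[OF that] by (simp add: J_def power2_eq_square algebra_simps)
  qed
  have bdd: "bdd_below (J ` N)"
    by (rule bdd_belowI2[where m = "- C\<^sup>2"]) (rule lower)
  have mJ: "m \<le> J x" if "x \<in> N" for x
    unfolding m_def using bdd that by (auto intro: cInf_lower)
  have "\<exists>x\<in>N. J x < m + 1 / real (Suc n)" for n
  proof -
    have "J ` N \<noteq> {}" using N subspace_0 by blast
    then have "\<exists>a\<in>J ` N. a < m + 1 / real (Suc n)"
      by (intro cInf_lessD) (auto simp: m_def)
    then show ?thesis by blast
  qed
  then obtain X where X: "\<And>n. X n \<in> N" "\<And>n. J (X n) < m + 1 / real (Suc n)"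
    by metis
  have para: "(norm (x - y))\<^sup>2 = 2 * J x + 2 * J y - 4 * J ((1/2) *\<^sub>R (x + y))"
    if "x \<in> N" "y \<in> N" for x y
  proof -
    have "\<phi> ((1/2) *\<^sub>R (x + y)) = (\<phi> x + \<phi> y) / 2"
      using that N by (simp add: add scale subspace_add)
    then show ?thesis
      by (simp add: J_def power2_norm_eq_inner inner_add_left inner_add_right inner_diff_left
          inner_diff_right inner_commute field_simps)
  qed
  have dist2: "(norm (X k - X l))\<^sup>2 \<le> 2 / real (Suc k) + 2 / real (Suc l)" for k l
    using para[OF X(1)[of k] X(1)[of l]] X(2)[of k] X(2)[of l]
      mJ[of "(1/2) *\<^sub>R (X k + X l)"] N X(1)
    by (simp add: subspace_add subspace_scale)
  have "Cauchy X"
  proof (rule metric_CauchyI)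
    fix e :: real assume e: "0 < e"
    obtain M where M: "4 / e\<^sup>2 < real M"
      using reals_Archimedean2 by blast
    have "dist (X k) (X l) < e" if "k \<ge> M" "l \<ge> M" for k l
    proof -
      have p: "0 < 4 / e\<^sup>2" using e by simp
      have "2 / real (Suc n) < e\<^sup>2 / 2" if "n \<ge> M" for n
      proof -
        have "4 / e\<^sup>2 < real (Suc n)" using M that by linarith
        then show ?thesis using e by (simp add: divide_simps mult.commute)
      qed
      from this[OF that(1)] this[OF that(2)]
      have "(norm (X k - X l))\<^sup>2 < e\<^sup>2" using dist2[of k l] by linarith
      then show ?thesis using e by (simp add: dist_norm power2_less_imp_less)
    qed
    then show "\<exists>M. \<forall>m\<ge>M. \<forall>n\<ge>M. dist (X m) (X n) < e" by blast
  qed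
  then obtain z where z: "X \<longlonglongrightarrow> z"
    using Cauchy_convergent[OF \<open>Cauchy X\<close>] by (auto simp: convergent_def)
  have "\<phi> x = inner x z" if x: "x \<in> N" for x
  proof -
    define p where "p = inner x z - \<phi> x"
    define q where "q = (norm x)\<^sup>2"
    have ineq: "0 \<le> 2 * t * p + t\<^sup>2 * q" for t
    proof -
      have "- (1 / real (Suc n)) \<le> 2 * t * (inner x (X n) - \<phi> x) + t\<^sup>2 * q" for n
      proof -
        have "m \<le> J (X n + t *\<^sub>R x)"
          using N X(1) x by (intro mJ) (simp add: subspace_add subspace_scale)
        moreover have "J (X n + t *\<^sub>R x) = J (X n) + 2 * t * (inner x (X n) - \<phi> x) + t\<^sup>2 * q"
        proof -
          have "\<phi> (X n + t *\<^sub>R x) = \<phi> (X n) + t * \<phi> x"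
            using N X(1) x by (simp add: add scale subspace_scale)
          moreover have "(norm (X n + t *\<^sub>R x))\<^sup>2 = (norm (X n))\<^sup>2 + 2 * t * inner x (X n) + t\<^sup>2 * q"
            unfolding q_def power2_norm_eq_inner
            by (simp add: inner_add_left inner_add_right inner_commute power2_eq_square[of t] algebra_simps)
          ultimately show ?thesis by (simp add: J_def algebra_simps)
        qed
        ultimately show ?thesis using X(2)[of n] by linarith
      qed
      moreover have lim1: "(\<lambda>n. - (1 / real (Suc n))) \<longlonglongrightarrow> 0"
        using tendsto_minus[OF LIMSEQ_Suc[OF lim_1_over_n[where 'a = real]]] by simp
      moreover have lim2: "(\<lambda>n. 2 * t * (inner x (X n) - \<phi> x) + t\<^sup>2 * q) \<longlonglongrightarrow> 2 * t * p + t\<^sup>2 * q"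
        unfolding p_def by (intro tendsto_intros z)
      ultimately show ?thesis
        using LIMSEQ_le[OF lim1 lim2] by blast
    qed
    have q: "0 \<le> q" by (simp add: q_def)
    \<comment> \<open>any negative multiple of $p$ of size less than $2/q$ contradicts the inequality unless $p = 0$\<close>
    define t where "t = - p / (q + 1)"
    have tq: "t * (q + 1) = - p" using q by (simp add: t_def)
    have "2 * t * p + t\<^sup>2 * q = 2 * t * (- (t * (q + 1))) + t\<^sup>2 * q"
      using tq by simp
    also have "\<dots> = - (t\<^sup>2 * (q + 2))" by (simp add: power2_eq_square algebra_simps)
    finally have "t\<^sup>2 * (q + 2) \<le> 0" using ineq[of t] by simp
    then have "t = 0" using q by (simp add: mult_le_0_iff)
    then have "p = 0" using tq by simp
    then show ?thesis by (simp add: p_def)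
  qed
  moreover have "z \<in> closure N" using z X(1) closure_sequential by blast
  ultimately show ?thesis by blast
qed

lemma subspace_closure:
  fixes N :: "'a::real_normed_vector set"
  assumes "subspace N"
  shows "subspace (closure N)"
proof (rule subspaceI)
  show "0 \<in> closure N"
    using assms subspace_0 closure_subset by blast
next
  fix x y assume "x \<in> closure N" "y \<in> closure N"
  then obtain X Y where X: "\<forall>n::nat. X n \<in> N" "X \<longlonglongrightarrow> x" and Y: "\<forall>n::nat. Y n \<in> N" "Y \<longlonglongrightarrow> y"
    unfolding closure_sequential by blast
  have "(\<lambda>n. X n + Y n) \<longlonglongrightarrow> x + y" by (intro tendsto_intros X Y)
  moreover have "\<forall>n. X n + Y n \<in> N" using X Y assms by (simp add: subspace_add)
  ultimately show "x + y \<in> closure N"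
    unfolding closure_sequential by (intro exI[of _ "\<lambda>n. X n + Y n"]) simp
next
  fix c x assume "x \<in> closure N"
  then obtain X where X: "\<forall>n::nat. X n \<in> N" "X \<longlonglongrightarrow> x"
    unfolding closure_sequential by blast
  have "(\<lambda>n. c *\<^sub>R X n) \<longlonglongrightarrow> c *\<^sub>R x" by (intro tendsto_intros X)
  moreover have "\<forall>n. c *\<^sub>R X n \<in> N" using X assms by (simp add: subspace_scale)
  ultimately show "c *\<^sub>R x \<in> closure N"
    unfolding closure_sequential by (intro exI[of _ "\<lambda>n. c *\<^sub>R X n"]) simp
qed

lemma orthogonal_in_closure_eq:
  fixes N :: "'a::real_inner set"
  assumes N: "subspace N" and "a \<in> closure N" "b \<in> closure N"
    and eq: "\<And>n. n \<in> N \<Longrightarrow> inner n a = inner n b"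
  shows "a = b"
proof -
  have "subspace (closure N)" using N by (rule subspace_closure)
  then have ab: "a - b \<in> closure N" using assms(2,3) by (rule subspace_diff)
  then obtain X where X: "\<And>n::nat. X n \<in> N" "X \<longlonglongrightarrow> a - b"
    unfolding closure_sequential by blast
  have "(\<lambda>n. inner (X n) (a - b)) \<longlonglongrightarrow> inner (a - b) (a - b)"
    by (intro tendsto_intros X)
  moreover have "inner (X n) (a - b) = 0" for n
    using eq[OF X(1)] by (simp add: inner_diff_right)
  ultimately have "inner (a - b) (a - b) = 0"
    by (simp add: LIMSEQ_const_iff)
  then show ?thesis by simp
qed

text \<open>
  The bound on $X$ and its linearity come from uniqueness of the representing vector in the closure of $N$.
  The last clause is used with multiplication by $\mathrm{i}$: it is the way in which complex linearity is
  carried through an argument in a real Hilbert space.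
\<close>

lemma adjoint_on_subspace:
  fixes N :: "'a::{real_inner,complete_space} set" and T :: "'a \<Rightarrow> 'a"
  assumes N: "subspace N"
    and add: "\<And>x y. x \<in> N \<Longrightarrow> y \<in> N \<Longrightarrow> T (x + y) = T x + T y"
    and scale: "\<And>c x. x \<in> N \<Longrightarrow> T (c *\<^sub>R x) = c *\<^sub>R T x"
    and bound: "\<And>x. x \<in> N \<Longrightarrow> norm (T x) \<le> C * norm x"
  shows "\<exists>X. bounded_linear X \<and> (\<forall>h. X h \<in> closure N) \<and>
    (\<forall>n\<in>N. \<forall>h. inner n (X h) = inner (T n) h) \<and>
    (\<forall>J. bounded_linear J \<and> (\<forall>x y. inner (J x) y = - inner x (J y)) \<and>
       (\<forall>n\<in>N. J n \<in> N \<and> T (J n) = J (T n)) \<longrightarrow> (\<forall>h. X (J h) = J (X h)))"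
proof -
  have "\<exists>z\<in>closure N. \<forall>x\<in>N. inner (T x) h = inner x z" for h
  proof (rule riesz_on_subspace[OF N])
    show "\<bar>inner (T x) h\<bar> \<le> (C * norm h) * norm x" if "x \<in> N" for x
    proof -
      have "\<bar>inner (T x) h\<bar> \<le> norm (T x) * norm h" by (rule Cauchy_Schwarz_ineq2)
      also have "\<dots> \<le> (C * norm x) * norm h"
        using bound[OF that] by (rule mult_right_mono) simp
      finally show ?thesis by (simp only: mult_ac)
    qed
  qed (simp_all add: add scale inner_add_left)
  then obtain X where X: "\<And>h. X h \<in> closure N" "\<And>n h. n \<in> N \<Longrightarrow> inner n (X h) = inner (T n) h"
    by metis
  have cl: "subspace (closure N)" using N by (rule subspace_closure)
  have bl: "bounded_linear X"
  proof (rule bounded_linear_intro)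
    show "X (a + b) = X a + X b" for a b
      by (rule orthogonal_in_closure_eq[OF N])
        (simp_all add: X cl subspace_add inner_add_right)
    show "X (r *\<^sub>R a) = r *\<^sub>R X a" for r a
      by (rule orthogonal_in_closure_eq[OF N])
        (simp_all add: X cl subspace_scale)
    show "norm (X h) \<le> norm h * \<bar>C\<bar>" for h
    proof -
      obtain Y where Y: "\<forall>n::nat. Y n \<in> N" "Y \<longlonglongrightarrow> X h"
        using X(1)[of h] unfolding closure_sequential by blast
      have lim: "(\<lambda>n. inner (Y n) (X h)) \<longlonglongrightarrow> inner (X h) (X h)"
        by (intro tendsto_intros Y)
      have lim2: "(\<lambda>n. (\<bar>C\<bar> * norm (Y n)) * norm h) \<longlonglongrightarrow> (\<bar>C\<bar> * norm (X h)) * norm h"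
        by (intro tendsto_intros Y)
      have "inner (Y n) (X h) \<le> (\<bar>C\<bar> * norm (Y n)) * norm h" for n
      proof -
        have "inner (Y n) (X h) = inner (T (Y n)) h" using X(2) Y(1) by blast
        also have "\<dots> \<le> norm (T (Y n)) * norm h" by (rule norm_cauchy_schwarz)
        also have "\<dots> \<le> (\<bar>C\<bar> * norm (Y n)) * norm h"
        proof (rule mult_right_mono)
          have "C * norm (Y n) \<le> \<bar>C\<bar> * norm (Y n)" by (intro mult_right_mono) auto
          then show "norm (T (Y n)) \<le> \<bar>C\<bar> * norm (Y n)" using bound[of "Y n"] Y(1) by force
        qed simp
        finally show ?thesis .
      qed
      then have "inner (X h) (X h) \<le> (\<bar>C\<bar> * norm (X h)) * norm h"
        by (intro LIMSEQ_le[OF lim lim2]) auto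
      then have "norm (X h) * norm (X h) \<le> norm (X h) * (norm h * \<bar>C\<bar>)"
        unfolding dot_square_norm power2_eq_square by (simp only: mult_ac)
      from mult_left_le_imp_le[OF this] show ?thesis
        by (cases "X h = 0") auto
    qed
  qed
  have comm: "X (J h) = J (X h)"
    if J: "bounded_linear J" and skew: "\<And>x y. inner (J x) y = - inner x (J y)"
      and inv: "\<And>n. n \<in> N \<Longrightarrow> J n \<in> N \<and> T (J n) = J (T n)" for J h
  proof (rule orthogonal_in_closure_eq[OF N])
    show "X (J h) \<in> closure N" by (rule X)
    obtain Y where Y: "\<forall>n::nat. Y n \<in> N" "Y \<longlonglongrightarrow> X h"
      using X(1)[of h] unfolding closure_sequential by blast
    have "(\<lambda>n. J (Y n)) \<longlonglongrightarrow> J (X h)"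
      using J Y(2) by (rule bounded_linear.tendsto)
    then show "J (X h) \<in> closure N"
      using inv Y(1) unfolding closure_sequential by (intro exI[of _ "\<lambda>n. J (Y n)"]) simp
    show "inner n (X (J h)) = inner n (J (X h))" if n: "n \<in> N" for n
    proof -
      have "inner n (X (J h)) = inner (T n) (J h)" using n by (rule X)
      also have "\<dots> = - inner (T (J n)) h" using skew[of "T n" h] inv[OF n] by simp
      also have "\<dots> = - inner (J n) (X h)" using X(2) inv[OF n] by simp
      also have "\<dots> = inner n (J (X h))" using skew[of n "X h"] by simp
      finally show ?thesis .
    qed
  qed
  show ?thesis
  proof (intro exI[of _ X] conjI allI ballI impI)
    show "bounded_linear X" by (rule bl)
    show "X h \<in> closure N" for h by (rule X)
    show "inner n (X h) = inner (T n) h" if "n \<in> N" for n h using that by (rule X)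
    fix J h
    assume J: "bounded_linear J \<and> (\<forall>x y. inner (J x) y = - inner x (J y)) \<and>
       (\<forall>n\<in>N. J n \<in> N \<and> T (J n) = J (T n))"
    show "X (J h) = J (X h)"
    proof (rule comm)
      show "bounded_linear J" using J by blast
      show "inner (J x) y = - inner x (J y)" for x y using J by blast
      show "J n \<in> N \<and> T (J n) = J (T n)" if "n \<in> N" for n using J that by blast
    qed
  qed
qed

text \<open>
  Schauder's theorem for Hilbert spaces: $\|X(g-h)\|^2 = \langle AX(g-h), g-h\rangle$, so a subsequence along
  which $AXf_n$ converges makes $Xf_n$ Cauchy.
\<close>

lemma convergent_subseq_adjoint:
  fixes A X :: "'a::{real_inner,complete_space} \<Rightarrow> 'a"
  assumes A: "bounded_linear A" and X: "bounded_linear X"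
    and adj: "\<And>g h. inner g (X h) = inner (A g) h"
    and comp: "\<And>f. bounded (range f) \<Longrightarrow> \<exists>r. strict_mono r \<and> convergent (A \<circ> f \<circ> (r::nat \<Rightarrow> nat))"
    and f: "bounded (range f)"
  shows "\<exists>r. strict_mono r \<and> convergent (X \<circ> f \<circ> (r::nat \<Rightarrow> nat))"
proof -
  obtain C where C: "\<And>n. norm (f n) \<le> C" using f by (auto simp: bounded_iff)
  have "bounded (range (\<lambda>n. X (f n)))"
    using bounded_linear_image[OF f X] by (simp add: image_image)
  then obtain r where r: "strict_mono (r::nat \<Rightarrow> nat)" "convergent (A \<circ> (\<lambda>n. X (f n)) \<circ> r)"
    using comp by blast
  interpret A: bounded_linear A by fact
  interpret X: bounded_linear X by fact
  have C0: "0 \<le> C" using C[of 0] norm_ge_zero[of "f 0"] by linarith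
  have key: "(norm (X g - X h))\<^sup>2 \<le> norm (A (X g) - A (X h)) * (2 * C)"
    if "norm g \<le> C" "norm h \<le> C" for g h
  proof -
    have "(norm (X g - X h))\<^sup>2 = inner (A (X g) - A (X h)) (g - h)"
      by (simp add: power2_norm_eq_inner adj flip: X.diff A.diff)
    also have "\<dots> \<le> norm (A (X g) - A (X h)) * norm (g - h)" by (rule norm_cauchy_schwarz)
    also have "\<dots> \<le> norm (A (X g) - A (X h)) * (2 * C)"
      using that norm_triangle_ineq4[of g h] by (intro mult_left_mono) auto
    finally show ?thesis .
  qed
  have "Cauchy (X \<circ> f \<circ> r)"
  proof (rule metric_CauchyI)
    fix e :: real assume e: "0 < e"
    define \<eta> where "\<eta> = e\<^sup>2 / (2 * C + 1)"
    have "\<eta> > 0" using e C0 by (simp add: \<eta>_def)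
    then obtain M where M: "\<And>m n. m \<ge> M \<Longrightarrow> n \<ge> M \<Longrightarrow> norm (A (X (f (r m))) - A (X (f (r n)))) < \<eta>"
      using CauchyD[OF convergent_Cauchy[OF r(2)]] by (fastforce simp: o_def)
    have "dist (X (f (r m))) (X (f (r n))) < e" if "m \<ge> M" "n \<ge> M" for m n
    proof -
      have "(norm (X (f (r m)) - X (f (r n))))\<^sup>2 \<le> \<eta> * (2 * C)"
        using key[OF C C, of "r m" "r n"] M[OF that] C0
        by (meson less_imp_le mult_right_mono order_trans zero_le_mult_iff zero_le_numeral)
      also have "\<dots> < \<eta> * (2 * C + 1)" using \<open>\<eta> > 0\<close> by simp
      also have "\<dots> = e\<^sup>2" using C0 by (simp add: \<eta>_def)
      finally show ?thesis using e by (simp add: dist_norm power2_less_imp_less)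
    qed
    then show "\<exists>M. \<forall>m\<ge>M. \<forall>n\<ge>M. dist ((X \<circ> f \<circ> r) m) ((X \<circ> f \<circ> r) n) < e" by auto
  qed
  then show ?thesis using r(1) Cauchy_convergent_iff by blast
qed

text \<open>
  Let $T$ be the inverse of $G$ on its range $N$, let $B$ be its extension by continuity to the closure of $N$
  followed by the orthogonal projection $P$, let $X = B^*$ and $Q = 1 - P$. Put
  \[ R = B - XQ + QBXQ . \]
  The last two terms vanish on $N$ and are compact with $B$. In $\langle Rh,h\rangle$ the two mixed terms cancel,
  which leaves $\langle Bh,Ph\rangle + \|XQh\|^2$, and the first summand is at least $c\|Bh\|^2$. So $Rh = 0$
  forces $Bh = 0$ and $XQh = 0$. The latter means that $Qh$ is orthogonal to the dense domain of $G$; the former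
  gives $Ph = 0$, since a densely defined accretive operator is closable.
\<close>

lemma accretive_compact_injective_inverse_extension:
  fixes G :: "('a::{real_inner,complete_space} \<times> 'a) set"
  assumes G: "subspace G"
    and J: "bounded_linear J" "\<And>x y. inner (J x) y = - inner x (J y)"
      "\<And>y g. (y, g) \<in> G \<Longrightarrow> (J y, J g) \<in> G"
    and c: "0 < c" and coercive: "\<And>y g. (y, g) \<in> G \<Longrightarrow> c * (norm y)\<^sup>2 \<le> inner g y"
    and dense: "\<And>f. (\<And>y g. (y, g) \<in> G \<Longrightarrow> inner f y = 0) \<Longrightarrow> f = 0"
    and comp: "\<And>Z. range Z \<subseteq> G \<Longrightarrow> bounded (range (snd \<circ> Z)) \<Longrightarrow>
       \<exists>r. strict_mono r \<and> convergent (fst \<circ> Z \<circ> (r::nat \<Rightarrow> nat))"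
  obtains R where "bounded_linear R" "inj R" "\<And>h. R (J h) = J (R h)"
    "\<And>y g. (y, g) \<in> G \<Longrightarrow> R g = y"
    "\<And>f. bounded (range f) \<Longrightarrow> \<exists>r. strict_mono r \<and> convergent (R \<circ> f \<circ> (r::nat \<Rightarrow> nat))"
proof -
  have bnd: "norm y \<le> (1 / c) * norm g" if "(y, g) \<in> G" for y g
  proof -
    have "norm y * (c * norm y) \<le> norm y * norm g"
      using order_trans[OF coercive[OF that] norm_cauchy_schwarz[of g y]]
      unfolding power2_eq_square by (simp only: mult_ac)
    from mult_left_le_imp_le[OF this] have "c * norm y \<le> norm g"
      by (cases "y = 0") auto
    then show ?thesis using c by (simp add: field_simps)
  qed
  have uniq: "y = y'" if "(y, g) \<in> G" "(y', g) \<in> G" for y y' g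
    using bnd[of "y - y'" "g - g"] subspace_diff[OF G that] by simp
  define N where "N = snd ` G"
  define T where "T g = (THE y. (y, g) \<in> G)" for g
  have TG: "T g = y" if "(y, g) \<in> G" for y g
    unfolding T_def using that uniq by blast
  have T: "(T g, g) \<in> G" if "g \<in> N" for g
    using that TG by (auto simp: N_def)
  have N: "subspace N"
    unfolding N_def by (rule linear_subspace_image[OF _ G]) (rule linear_snd)
  have Tadd: "T (x + y) = T x + T y" if "x \<in> N" "y \<in> N" for x y
    using subspace_add[OF G T[OF that(1)] T[OF that(2)]] by (intro TG) simp
  have Tscale: "T (k *\<^sub>R x) = k *\<^sub>R T x" if "x \<in> N" for x k
    using subspace_scale[OF G T[OF that], of k] by (intro TG) simp
  have Tbnd: "norm (T x) \<le> (1 / c) * norm x" if "x \<in> N" for x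
    using bnd[OF T[OF that]] .
  have TJ: "J n \<in> N \<and> T (J n) = J (T n)" if "n \<in> N" for n
    using J(3)[OF T[OF that]] TG by (force simp: N_def)
  have JN: "bounded_linear J \<and> (\<forall>x y. inner (J x) y = - inner x (J y)) \<and>
      (\<forall>n\<in>N. J n \<in> N \<and> T (J n) = J (T n))"
    using J(1,2) TJ by blast
  have "\<exists>X. bounded_linear X \<and> (\<forall>h. X h \<in> closure N) \<and>
      (\<forall>n\<in>N. \<forall>h. inner n (X h) = inner (T n) h) \<and>
      (\<forall>J. bounded_linear J \<and> (\<forall>x y. inner (J x) y = - inner x (J y)) \<and>
         (\<forall>n\<in>N. J n \<in> N \<and> T (J n) = J (T n)) \<longrightarrow> (\<forall>h. X (J h) = J (X h)))"
    by (rule adjoint_on_subspace[OF N Tadd Tscale Tbnd])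
  then obtain X where X: "bounded_linear X" "\<forall>h. X h \<in> closure N"
      "\<forall>n\<in>N. \<forall>h. inner n (X h) = inner (T n) h" and XJ: "\<forall>h. X (J h) = J (X h)"
    using JN by (elim exE conjE) (drule spec[of _ J], blast)
  note X = X(1) X(2,3)[rule_format] and XJ = XJ[rule_format]
  interpret X: bounded_linear X by fact
  interpret J: bounded_linear J by fact
  obtain K where K: "\<And>x. norm (X x) \<le> norm x * K" using X.bounded by blast
  have K': "norm (X x) \<le> K * norm x" for x using K[of x] by (simp add: mult.commute)
  have JU: "bounded_linear J \<and> (\<forall>x y. inner (J x) y = - inner x (J y)) \<and>
      (\<forall>n\<in>UNIV. J n \<in> UNIV \<and> X (J n) = J (X n))"
    using J(1,2) XJ by simp
  obtain B where B: "bounded_linear B" and B_adj: "\<forall>n h. inner n (B h) = inner (X n) h"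
      and BJ: "\<forall>h. B (J h) = J (B h)"
    using adjoint_on_subspace[OF subspace_UNIV X.add X.scale K'] JU by (elim exE conjE) (drule spec[of _ J], blast)
  note B_adj = B_adj[rule_format] and BJ = BJ[rule_format]
  interpret B: bounded_linear B by fact
  have "\<exists>P. bounded_linear P \<and> (\<forall>h. P h \<in> closure N) \<and>
      (\<forall>n\<in>N. \<forall>h. inner n (P h) = inner n h) \<and>
      (\<forall>J. bounded_linear J \<and> (\<forall>x y. inner (J x) y = - inner x (J y)) \<and>
         (\<forall>n\<in>N. J n \<in> N \<and> J n = J n) \<longrightarrow> (\<forall>h. P (J h) = J (P h)))"
    by (rule adjoint_on_subspace[OF N, of "\<lambda>x. x" 1]) simp_all
  then obtain P where P: "bounded_linear P" "\<forall>h. P h \<in> closure N"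
      "\<forall>n\<in>N. \<forall>h. inner n (P h) = inner n h" and PJ: "\<forall>h. P (J h) = J (P h)"
    using JN by (elim exE conjE) (drule spec[of _ J], blast)
  note P = P(1) P(2,3)[rule_format] and PJ = PJ[rule_format]
  interpret P: bounded_linear P by fact
  define Q where "Q h = h - P h" for h
  have Q: "bounded_linear Q"
    unfolding Q_def by (intro bounded_linear_sub bounded_linear_ident P)
  interpret Q: bounded_linear Q by fact
  have QJ: "Q (J h) = J (Q h)" for h by (simp add: Q_def PJ J.diff)
  have P_id: "P h = h" if "h \<in> closure N" for h
    by (rule orthogonal_in_closure_eq[OF N]) (simp_all add: P that)
  have BT: "B n = T n" if "n \<in> N" for n
  proof -
    have "inner h (B n) = inner h (T n)" for h
      unfolding B_adj[of h n] using X(3)[OF that, of h] by (simp add: inner_commute)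
    then have "inner (B n - T n) (B n - T n) = 0" by (simp add: inner_diff_right)
    then show ?thesis by simp
  qed
  have orth: "inner x (Q h) = 0" if x: "x \<in> closure N" for x h
  proof -
    obtain Y where Y: "\<forall>n::nat. Y n \<in> N" "Y \<longlonglongrightarrow> x"
      using x unfolding closure_sequential by blast
    have "(\<lambda>n. inner (Y n) (Q h)) \<longlonglongrightarrow> inner x (Q h)" by (intro tendsto_intros Y)
    moreover have "inner (Y n) (Q h) = 0" for n
      using P(3)[of "Y n" h] Y(1) by (simp add: Q_def inner_diff_right)
    ultimately show ?thesis by (simp add: LIMSEQ_const_iff)
  qed
  have BQ: "B (Q h) = 0" for h
  proof -
    have "inner (B (Q h)) (B (Q h)) = inner (X (B (Q h))) (Q h)" by (rule B_adj)
    also have "\<dots> = 0" by (rule orth[OF X(2)])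
    finally show ?thesis by simp
  qed
  have BP: "B (P h) = B h" for h
    using BQ[of h] by (simp add: Q_def B.diff)
  have acc: "c * (norm (B h))\<^sup>2 \<le> inner (B h) (P h)" for h
  proof -
    obtain Y where Y: "\<forall>n::nat. Y n \<in> N" "Y \<longlonglongrightarrow> P h"
      using P(2) unfolding closure_sequential by blast
    have BY: "(\<lambda>n. B (Y n)) \<longlonglongrightarrow> B h" using B.tendsto[OF Y(2)] by (simp add: BP)
    have "(\<lambda>n. c * (norm (B (Y n)))\<^sup>2) \<longlonglongrightarrow> c * (norm (B h))\<^sup>2"
      "(\<lambda>n. inner (B (Y n)) (Y n)) \<longlonglongrightarrow> inner (B h) (P h)"
      by (intro tendsto_intros BY Y(2))+
    moreover have "c * (norm (B (Y n)))\<^sup>2 \<le> inner (B (Y n)) (Y n)" for n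
      using coercive[OF T] Y(1) BT by (simp add: inner_commute)
    ultimately show ?thesis using LIMSEQ_le by blast
  qed
  have injB: "h = 0" if h: "h \<in> closure N" "B h = 0" for h
  proof (rule dense)
    obtain Y where Y: "\<forall>n::nat. Y n \<in> N" "Y \<longlonglongrightarrow> h"
      using h(1) unfolding closure_sequential by blast
    have BY: "(\<lambda>n. B (Y n)) \<longlonglongrightarrow> 0" using B.tendsto[OF Y(2)] h(2) by simp
    have nonneg: "0 \<le> inner h y + t * inner g y" if yg: "(y, g) \<in> G" and t: "0 < t" for y g t
    proof -
      have "0 \<le> inner (Y n + t *\<^sub>R g) (B (Y n) + t *\<^sub>R y)" for n
      proof -
        have "(B (Y n) + t *\<^sub>R y, Y n + t *\<^sub>R g) \<in> G"
          using subspace_add[OF G T subspace_scale[OF G yg]] Y(1) BT by force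
        from coercive[OF this] show ?thesis using c
          by (meson less_imp_le mult_nonneg_nonneg order_trans zero_le_power2)
      qed
      moreover have "(\<lambda>n. inner (Y n + t *\<^sub>R g) (B (Y n) + t *\<^sub>R y)) \<longlonglongrightarrow> inner (h + t *\<^sub>R g) (0 + t *\<^sub>R y)"
        by (intro tendsto_intros Y(2) BY)
      ultimately have "0 \<le> inner (h + t *\<^sub>R g) (0 + t *\<^sub>R y)"
        using LIMSEQ_le_const by blast
      then have "0 \<le> t * (inner h y + t * inner g y)" by (simp add: inner_add_left algebra_simps)
      then show ?thesis using t by (simp add: zero_le_mult_iff)
    qed
    have ge: "0 \<le> inner h y" if yg: "(y, g) \<in> G" for y g
    proof (rule ccontr)
      assume "\<not> 0 \<le> inner h y"
      then have neg: "inner h y < 0" by simp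
      define t where "t = - inner h y / (2 * (\<bar>inner g y\<bar> + 1))"
      have t: "0 < t" unfolding t_def using neg by (intro divide_pos_pos) auto
      have "t * inner g y \<le> t * (\<bar>inner g y\<bar> + 1)" using t by (intro mult_left_mono) auto
      also have "\<dots> = - inner h y / 2" by (simp add: t_def field_simps)
      finally show False using nonneg[OF yg t] neg by linarith
    qed
    show "inner h y = 0" if yg: "(y, g) \<in> G" for y g
      using ge[OF yg] ge[of "- y" "- g"] subspace_neg[OF G yg] by simp
  qed
  have injX: "q = 0" if "X q = 0" for q
  proof (rule dense)
    show "inner q y = 0" if yg: "(y, g) \<in> G" for y g
    proof -
      have "g \<in> N" using yg by (force simp: N_def)
      then show ?thesis using X(3)[of g q] \<open>X q = 0\<close> TG[OF yg] by (simp add: inner_commute)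
    qed
  qed
  define R where "R h = B h - X (Q h) + Q (B (X (Q h)))" for h
  have R: "bounded_linear R"
    unfolding R_def
    by (intro bounded_linear_add bounded_linear_sub B bounded_linear_compose[OF X(1) Q]
        bounded_linear_compose[OF Q bounded_linear_compose[OF B bounded_linear_compose[OF X(1) Q]]])
  interpret R: bounded_linear R by fact
  have "h = 0" if "R h = 0" for h
  proof -
    have sym: "inner (Q a) b = inner (Q a) (Q b)" for a b
      using orth[OF P(2), of b a] by (simp add: Q_def[of b] inner_diff_right inner_commute)
    have "inner (R h) h = inner (B h) h - inner (X (Q h)) h + inner (Q (B (X (Q h)))) h"
      by (simp add: R_def inner_add_left inner_diff_left)
    also have "inner (B h) h = inner (B h) (P h) + inner (B h) (Q h)"
      by (simp add: Q_def inner_diff_right)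
    also have "inner (X (Q h)) h = inner (Q h) (B h)" by (simp add: B_adj)
    also have "inner (Q (B (X (Q h)))) h = inner (B (X (Q h))) (Q h)"
      using sym[of "B (X (Q h))" h] sym[of h "B (X (Q h))"] by (simp add: inner_commute)
    also have "inner (B (X (Q h))) (Q h) = (norm (X (Q h)))\<^sup>2"
      using B_adj[of "Q h" "X (Q h)"] by (simp add: inner_commute power2_norm_eq_inner)
    finally have "inner (B h) (P h) + (norm (X (Q h)))\<^sup>2 = 0"
      using that by (simp add: inner_commute)
    then have "c * (norm (B h))\<^sup>2 + (norm (X (Q h)))\<^sup>2 \<le> 0" using acc[of h] by linarith
    moreover have "0 \<le> c * (norm (B h))\<^sup>2" using c by simp
    ultimately have "c * (norm (B h))\<^sup>2 = 0" "(norm (X (Q h)))\<^sup>2 = 0"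
      using zero_le_power2[of "norm (X (Q h))"] by linarith+
    then have "B h = 0" "X (Q h) = 0" using c by auto
    then have "Q h = 0" using injX by blast
    then have "P h = h" by (simp add: Q_def)
    then show "h = 0" using injB[of h] P(2)[of h] \<open>B h = 0\<close> by simp
  qed
  then have injR: "inj R" using linear_injective_0[OF R.linear] by blast
  have RJ: "R (J h) = J (R h)" for h
    by (simp add: R_def BJ QJ XJ J.add J.diff)
  have RG: "R g = y" if "(y, g) \<in> G" for y g
  proof -
    have g: "g \<in> N" using that by (force simp: N_def)
    then have "Q g = 0" using P_id closure_subset by (force simp: Q_def)
    then show ?thesis using BT[OF g] TG[OF that] by (simp add: R_def)
  qed
  have compB: "\<exists>r. strict_mono r \<and> convergent (B \<circ> f \<circ> (r::nat \<Rightarrow> nat))" if f: "bounded (range f)" for f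
  proof -
    have "\<exists>n\<in>N. norm (n - P (f k)) < 1 / real (Suc k)" for k
      using P(2) unfolding closure_approachable by (auto simp: dist_norm)
    then obtain n where n: "\<And>k. n k \<in> N" "\<And>k. norm (n k - P (f k)) < 1 / real (Suc k)"
      by metis
    have lim0: "(\<lambda>k. n k - P (f k)) \<longlonglongrightarrow> 0"
      by (rule Lim_null_comparison[where g = "\<lambda>k. 1 / real (Suc k)"])
        (use n(2) LIMSEQ_Suc[OF lim_1_over_n[where 'a = real]] in \<open>auto intro!: always_eventually less_imp_le\<close>)
    have "bounded (range (\<lambda>k. P (f k)))"
      using bounded_linear_image[OF f P(1)] by (simp add: image_image)
    moreover have "bounded (range (\<lambda>k. n k - P (f k)))"
      using lim0 by (rule convergent_imp_bounded)
    ultimately have "bounded (range (\<lambda>k. (n k - P (f k)) + P (f k)))"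
      by (rule bounded_plus_comp[rotated])
    then have "bounded (range n)" by simp
    then obtain r where r: "strict_mono (r::nat \<Rightarrow> nat)" "convergent (\<lambda>k. T (n (r k)))"
      using comp[of "\<lambda>k. (T (n k), n k)"] T n(1) by (auto simp: o_def)
    have "(\<lambda>k. B (n (r k) - P (f (r k)))) \<longlonglongrightarrow> B 0"
      using LIMSEQ_subseq_LIMSEQ[OF lim0 r(1)] by (intro B.tendsto) (simp add: o_def)
    then have "convergent (\<lambda>k. T (n (r k)) - B (n (r k) - P (f (r k))))"
      by (intro convergent_diff r) (auto simp: convergent_def)
    moreover have "T (n (r k)) - B (n (r k) - P (f (r k))) = B (f (r k))" for k
      by (simp add: B.diff BP BT[OF n(1), symmetric])
    ultimately show ?thesis using r(1) by (auto simp: o_def)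
  qed
  have adj: "inner g (X h) = inner (B g) h" for g h
    using B_adj[of h g] by (simp add: inner_commute)
  have compR: "\<exists>r. strict_mono r \<and> convergent (R \<circ> f \<circ> (r::nat \<Rightarrow> nat))" if f: "bounded (range f)" for f
  proof -
    obtain r1 where r1: "strict_mono (r1::nat \<Rightarrow> nat)" "convergent (B \<circ> f \<circ> r1)" using compB[OF f] by blast
    have "bounded (range (\<lambda>k. Q (f (r1 k))))"
      by (rule bounded_subset[OF bounded_linear_image[OF f Q]]) auto
    then obtain r2 where r2: "strict_mono (r2::nat \<Rightarrow> nat)" "convergent (X \<circ> (\<lambda>k. Q (f (r1 k))) \<circ> r2)"
      using convergent_subseq_adjoint[OF B X(1) adj compB] by blast
    then obtain l where l: "(\<lambda>k. X (Q (f (r1 (r2 k))))) \<longlonglongrightarrow> l" by (auto simp: convergent_def o_def)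
    obtain l1 where l1: "(\<lambda>k. B (f (r1 k))) \<longlonglongrightarrow> l1" using r1(2) by (auto simp: convergent_def o_def)
    have "(\<lambda>k. R (f (r1 (r2 k)))) \<longlonglongrightarrow> l1 - l + Q (B l)"
      unfolding R_def
      using LIMSEQ_subseq_LIMSEQ[OF l1 r2(1)]
      by (intro tendsto_intros Q.tendsto B.tendsto l) (simp add: o_def)
    then have "convergent (R \<circ> f \<circ> (r1 \<circ> r2))" by (auto simp: convergent_def o_def)
    then show ?thesis using strict_mono_o[OF r1(1) r2(1)] by blast
  qed
  show thesis by (rule that[OF R injR RJ RG compR])
qed

section \<open>Absolutely continuous functions and indefinite integrals\<close>

text \<open>
  The definition of absolute continuity speaks of families indexed by an initial segment of the natural
  numbers; a tagged division is a family indexed by itself.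
\<close>

lemma absolutely_continuous_small_variation:
  assumes ac: "absolutely_continuous_on_segment a b f" and e: "0 < e"
  shows "\<exists>d>0. \<forall>(D :: 'i set) p q. finite D \<longrightarrow> (\<forall>i\<in>D. a \<le> p i \<and> p i \<le> q i \<and> q i \<le> b) \<longrightarrow>
       disjoint_family_on (\<lambda>i. {p i<..<q i}) D \<longrightarrow> (\<Sum>i\<in>D. q i - p i) < d \<longrightarrow>
       (\<Sum>i\<in>D. cmod (f (q i) - f (p i))) < e"
proof -
  from ac e obtain d where d: "0 < d" and dd: "\<forall>(n::nat) p q.
        (\<forall>i<n. a \<le> p i \<and> p i \<le> q i \<and> q i \<le> b) \<and>
        disjoint_family_on (\<lambda>i. {p i<..<q i}) {..<n} \<and> (\<Sum>i<n. q i - p i) < d \<longrightarrow>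
        (\<Sum>i<n. cmod (f (q i) - f (p i))) < e"
    unfolding absolutely_continuous_on_segment_def by (elim allE[of _ e] impE exE conjE)
  show ?thesis
  proof (intro exI[of _ d] conjI allI impI)
    show "0 < d" by (rule d)
    fix D :: "'i set" and p q
    assume D: "finite D" "\<forall>i\<in>D. a \<le> p i \<and> p i \<le> q i \<and> q i \<le> b"
      "disjoint_family_on (\<lambda>i. {p i<..<q i}) D" "(\<Sum>i\<in>D. q i - p i) < d"
    obtain h where h: "bij_betw h {..<card D} D"
      using D(1) ex_bij_betw_nat_finite[of D] by (auto simp: atLeast0LessThan)
    have sums: "(\<Sum>i\<in>D. g i) = (\<Sum>i<card D. g (h i))" for g :: "'i \<Rightarrow> real"
      using sum.reindex_bij_betw[OF h, of g] by simp
    have "(\<Sum>i<card D. cmod (f (q (h i)) - f (p (h i)))) < e"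
    proof (rule dd[rule_format], intro conjI allI impI)
      show "a \<le> p (h i)" "p (h i) \<le> q (h i)" "q (h i) \<le> b" if "i < card D" for i
        using D(2) bij_betwE[OF h] that by blast+
      show "disjoint_family_on (\<lambda>i. {p (h i)<..<q (h i)}) {..<card D}"
        using D(3) bij_betw_imp_inj_on[OF h] bij_betwE[OF h]
        unfolding disjoint_family_on_def inj_on_def by blast
    qed (use D(4) sums in simp)
    then show "(\<Sum>i\<in>D. cmod (f (q i) - f (p i))) < e"
      by (simp add: sums)
  qed
qed

text \<open>
  The usual gauge proof of the fundamental theorem of calculus estimates the parts of a fine division with tags
  outside $N$. For tags in $N$ the gauge confines the parts to an open set of small measure around $N$, and
  absolute continuity bounds the sum of the increments over them.
\<close>

lemma absolutely_continuous_has_integral: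
  assumes ac: "absolutely_continuous_on_segment a b f" and "a \<le> b" and N: "negligible N"
    and vecd: "\<And>x. x \<in> {a..b} - N \<Longrightarrow> (f has_vector_derivative f' x) (at x within {a..b})"
  shows "(f' has_integral (f b - f a)) {a..b}"
proof (rule has_integral_spike[OF N])
  define g where "g x = (if x \<in> N then 0 else f' x)" for x
  show "f' x = g x" if "x \<in> {a..b} - N" for x using that by (simp add: g_def)
  show "(g has_integral (f b - f a)) {a..b}"
    unfolding has_integral[of g "f b - f a" a b, unfolded box_real]
  proof (intro allI impI)
    fix e :: real
    assume "e > 0"
    define e1 where "e1 = e / (2 * (b - a + 1))"
    have e1: "0 < e1" using \<open>e > 0\<close> \<open>a \<le> b\<close> by (simp add: e1_def)
    have "\<exists>d>0. x \<in> {a..b} - N \<longrightarrow>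
           (\<forall>y\<in>{a..b}. norm (y-x) < d \<longrightarrow> norm (f y - f x - (y-x) *\<^sub>R f' x) \<le> e1 * norm (y-x))" for x
      using vecd[unfolded has_vector_derivative_def has_derivative_within_alt] e1
      by (cases "x \<in> {a..b} - N") (blast, use zero_less_one in blast)
    then have "\<exists>d. \<forall>x. 0 < d x \<and> (x \<in> {a..b} - N \<longrightarrow>
           (\<forall>y\<in>{a..b}. norm (y-x) < d x \<longrightarrow> norm (f y - f x - (y-x) *\<^sub>R f' x) \<le> e1 * norm (y-x)))"
      by (intro choice) blast
    then obtain d where d: "\<And>x. 0 < d x"
                   "\<And>x y. \<lbrakk>x \<in> {a..b} - N; y \<in> {a..b}; norm (y-x) < d x\<rbrakk>
                          \<Longrightarrow> norm (f y - f x - (y-x) *\<^sub>R f' x) \<le> e1 * norm (y-x)"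
      by blast
    obtain \<delta> where \<delta>: "0 < \<delta>" "\<forall>(D :: (real \<times> real set) set) p q. finite D \<longrightarrow>
         (\<forall>i\<in>D. a \<le> p i \<and> p i \<le> q i \<and> q i \<le> b) \<longrightarrow>
         disjoint_family_on (\<lambda>i. {p i<..<q i}) D \<longrightarrow> (\<Sum>i\<in>D. q i - p i) < \<delta> \<longrightarrow>
         (\<Sum>i\<in>D. cmod (f (q i) - f (p i))) < e / 2"
      using absolutely_continuous_small_variation[OF ac, of "e / 2", where 'i = "real \<times> real set"] \<open>e > 0\<close>
      by (meson half_gt_zero)
    have Ns: "N \<in> null_sets lebesgue" using N by (simp add: negligible_iff_null_sets)
    then obtain U where U: "open U" "N \<subseteq> U" "U - N \<in> lmeasurable" "emeasure lebesgue (U - N) < ennreal \<delta>"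
      using sets_lebesgue_outer_open[of N \<delta>] \<delta>(1) by (auto simp: null_sets_def)
    have "emeasure lebesgue U \<le> emeasure lebesgue (U - N) + emeasure lebesgue N"
      using U Ns by (intro order_trans[OF emeasure_mono emeasure_subadditive]) (auto simp: null_sets_def)
    then have emU: "emeasure lebesgue U < ennreal \<delta>"
      using U(4) Ns by (simp add: null_sets_def order.strict_trans1)
    have finU: "emeasure lebesgue U < \<infinity>"
      using emU by (rule order.strict_trans) simp
    then have "emeasure lebesgue U = ennreal (measure lebesgue U)"
      by (intro emeasure_eq_ennreal_measure) simp
    with emU have mU: "measure lebesgue U < \<delta>"
      by (simp add: ennreal_less_iff)
    define \<gamma> where "\<gamma> x = (if x \<in> N then U else ball x (d x))" for x
    have gauge: "gauge \<gamma>"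
      using U d(1) by (auto simp: gauge_def \<gamma>_def)
    have main: "norm ((\<Sum>(x, k)\<in>p. measure lborel k *\<^sub>R g x) - (f b - f a)) < e"
      if ptag: "p tagged_division_of {a..b}" and fine: "\<gamma> fine p" for p
    proof -
      have fin: "finite p" using ptag by blast
      have ba: "b - a = (\<Sum>(x,K)\<in>p. Sup K - Inf K)" "f b - f a = (\<Sum>(x,K)\<in>p. f(Sup K) - f(Inf K))"
        using additive_tagged_division_1[where f= "\<lambda>x. x"] additive_tagged_division_1[where f= f]
              \<open>a \<le> b\<close> ptag by auto
      have form: "\<exists>u v. K = {u..v} \<and> u \<le> v \<and> x \<in> K \<and> a \<le> u \<and> v \<le> b \<and> Sup K = v \<and> Inf K = u \<and> measure lborel K = v - u"
        if xKp: "(x, K) \<in> p" for x K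
      proof -
        have xK: "x \<in> K" and Kab: "K \<subseteq> {a..b}"
          using tagged_division_ofD(2,3)[OF ptag xKp] by auto
        obtain u v where K: "K = {u..v}"
          using tagged_division_ofD(4)[OF ptag xKp] by auto
        have "u \<le> v" using xK K by simp
        with K Kab xK show ?thesis
          by (intro exI[of _ u] exI[of _ v]) simp
      qed
      define p1 where "p1 = {xK \<in> p. fst xK \<notin> N}"
      define p2 where "p2 = {xK \<in> p. fst xK \<in> N}"
      have p12: "p = p1 \<union> p2" "p1 \<inter> p2 = {}" "finite p1" "finite p2"
        using fin by (auto simp: p1_def p2_def)
      have "(\<Sum>(x, K)\<in>p. measure lborel K *\<^sub>R g x) - (f b - f a)
          = (\<Sum>(x, K)\<in>p. (measure lborel K *\<^sub>R g x) - (f (Sup K) - f (Inf K)))"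
        unfolding ba by (simp add: sum_subtractf case_prod_unfold)
      also have "\<dots> = (\<Sum>(x, K)\<in>p1. (measure lborel K *\<^sub>R g x) - (f (Sup K) - f (Inf K)))
            + (\<Sum>(x, K)\<in>p2. (measure lborel K *\<^sub>R g x) - (f (Sup K) - f (Inf K)))"
        using p12 by (simp add: sum.union_disjoint)
      finally have "(\<Sum>(x, K)\<in>p. measure lborel K *\<^sub>R g x) - (f b - f a)
          = (\<Sum>(x, K)\<in>p1. (measure lborel K *\<^sub>R g x) - (f (Sup K) - f (Inf K)))
            + (\<Sum>(x, K)\<in>p2. (measure lborel K *\<^sub>R g x) - (f (Sup K) - f (Inf K)))" .
      also have "norm \<dots> \<le> norm (\<Sum>(x, K)\<in>p1. (measure lborel K *\<^sub>R g x) - (f (Sup K) - f (Inf K)))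
            + norm (\<Sum>(x, K)\<in>p2. (measure lborel K *\<^sub>R g x) - (f (Sup K) - f (Inf K)))"
        by (rule norm_triangle_ineq)
      finally have split: "norm ((\<Sum>(x, K)\<in>p. measure lborel K *\<^sub>R g x) - (f b - f a))
          \<le> norm (\<Sum>(x, K)\<in>p1. (measure lborel K *\<^sub>R g x) - (f (Sup K) - f (Inf K)))
            + norm (\<Sum>(x, K)\<in>p2. (measure lborel K *\<^sub>R g x) - (f (Sup K) - f (Inf K)))" .
      have "norm (\<Sum>(x, K)\<in>p1. (measure lborel K *\<^sub>R g x) - (f (Sup K) - f (Inf K)))
            \<le> (\<Sum>(x, K)\<in>p1. e1 * (Sup K - Inf K))"
      proof (rule sum_norm_le, safe)
        fix x K assume xK: "(x, K) \<in> p1"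
        then have "(x, K) \<in> p" and xN: "x \<notin> N" by (auto simp: p1_def)
        then obtain u v where uv: "K = {u..v}" "u \<le> v" "x \<in> K" "a \<le> u" "v \<le> b" "Sup K = v" "Inf K = u"
            "measure lborel K = v - u"
          using form by blast
        have "K \<subseteq> ball x (d x)" using fineD[OF fine \<open>(x, K) \<in> p\<close>] xN by (simp add: \<gamma>_def)
        moreover have "u \<in> K" "v \<in> K" using uv by auto
        ultimately have "u \<in> ball x (d x)" "v \<in> ball x (d x)" by blast+
        then have "norm (u - x) < d x" "norm (v - x) < d x" by (auto simp: dist_real_def)
        moreover have "x \<in> {a..b} - N" using uv xN by auto
        ultimately have du: "norm (f u - f x - (u-x) *\<^sub>R f' x) \<le> e1 * norm (u-x)"
          and dv: "norm (f v - f x - (v-x) *\<^sub>R f' x) \<le> e1 * norm (v-x)"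
          using d(2)[of x u] d(2)[of x v] uv by auto
        have eq: "measure lborel K *\<^sub>R g x - (f (Sup K) - f (Inf K))
            = (f u - f x - (u - x) *\<^sub>R f' x) - (f v - f x - (v - x) *\<^sub>R f' x)"
          using xN uv by (simp add: g_def algebra_simps)
        have "norm (measure lborel K *\<^sub>R g x - (f (Sup K) - f (Inf K))) \<le> e1 * norm (u-x) + e1 * norm (v-x)"
          unfolding eq by (rule order_trans[OF norm_triangle_ineq4 add_mono[OF du dv]])
        also have "\<dots> = e1 * (Sup K - Inf K)"
          using uv by (simp add: algebra_simps)
        finally show "norm (measure lborel K *\<^sub>R g x - (f (Sup K) - f (Inf K))) \<le> e1 * (Sup K - Inf K)" .
      qed
      also have "(\<Sum>(x, K)\<in>p1. e1 * (Sup K - Inf K)) \<le> (\<Sum>(x, K)\<in>p. e1 * (Sup K - Inf K))"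
      proof (rule sum_mono2)
        show "finite p" "p1 \<subseteq> p" using fin by (auto simp: p1_def)
        show "0 \<le> (case xK of (x, K) \<Rightarrow> e1 * (Sup K - Inf K))" if "xK \<in> p - p1" for xK
          using form[of "fst xK" "snd xK"] e1 that by (auto simp: case_prod_unfold)
      qed
      also have "\<dots> = e1 * (b - a)"
        by (simp add: ba sum_distrib_left case_prod_unfold)
      also have "\<dots> \<le> e / 2"
        using \<open>a \<le> b\<close> \<open>e > 0\<close> by (simp add: e1_def field_simps)
      finally have S1: "norm (\<Sum>(x, K)\<in>p1. (measure lborel K *\<^sub>R g x) - (f (Sup K) - f (Inf K))) \<le> e / 2" .
      have "norm (\<Sum>(x, K)\<in>p2. (measure lborel K *\<^sub>R g x) - (f (Sup K) - f (Inf K)))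
          \<le> (\<Sum>i\<in>p2. cmod (f (Sup (snd i)) - f (Inf (snd i))))"
        by (rule sum_norm_le) (auto simp: p2_def g_def norm_minus_commute)
      also have "\<dots> < e / 2"
      proof (rule \<delta>(2)[rule_format])
        show "finite p2" by fact
        show "a \<le> Inf (snd i) \<and> Inf (snd i) \<le> Sup (snd i) \<and> Sup (snd i) \<le> b" if "i \<in> p2" for i
          using form[of "fst i" "snd i"] that by (auto simp: p2_def)
        have int: "{Inf (snd i)<..<Sup (snd i)} = interior (snd i)" if ip: "i \<in> p2" for i
        proof -
          have "(fst i, snd i) \<in> p" using ip by (auto simp: p2_def)
          from form[OF this] obtain u v where uv: "snd i = {u..v}" "Sup (snd i) = v" "Inf (snd i) = u"
            by blast
          show ?thesis unfolding uv(2,3) unfolding uv(1) by simp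
        qed
        show disj: "disjoint_family_on (\<lambda>i. {Inf (snd i)<..<Sup (snd i)}) p2"
          unfolding disjoint_family_on_def
        proof (intro ballI impI)
          fix i j assume ij: "i \<in> p2" "j \<in> p2" "i \<noteq> j"
          have "interior (snd i) \<inter> interior (snd j) = {}"
            using tagged_division_ofD(5)[OF ptag, of "fst i" "snd i" "fst j" "snd j"] ij
            by (auto simp: p2_def prod_eq_iff)
          then show "{Inf (snd i)<..<Sup (snd i)} \<inter> {Inf (snd j)<..<Sup (snd j)} = {}"
            by (simp add: int ij)
        qed
        have "(\<Sum>i\<in>p2. Sup (snd i) - Inf (snd i))
            = (\<Sum>i\<in>p2. measure lebesgue {Inf (snd i)<..<Sup (snd i)})"
        proof (intro sum.cong refl)
          fix i assume "i \<in> p2"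
          then show "Sup (snd i) - Inf (snd i) = measure lebesgue {Inf (snd i)<..<Sup (snd i)}"
            using form[of "fst i" "snd i"] by (auto simp: p2_def)
        qed
        also have "\<dots> = measure lebesgue (\<Union>i\<in>p2. {Inf (snd i)<..<Sup (snd i)})"
          using fmeasurableD2[OF lmeasurable_box[where 'a = real, unfolded box_real]]
          by (intro measure_finite_Union[symmetric] disj p12(4)) auto
        also have "\<dots> \<le> measure lebesgue U"
        proof (rule measure_mono_fmeasurable)
          show "(\<Union>i\<in>p2. {Inf (snd i)<..<Sup (snd i)}) \<subseteq> U"
          proof (rule UN_least)
            fix i assume i: "i \<in> p2"
            then have "snd i \<subseteq> U" using fineD[OF fine, of "fst i" "snd i"] by (auto simp: \<gamma>_def p2_def)
            then show "{Inf (snd i)<..<Sup (snd i)} \<subseteq> U"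
              unfolding int[OF i] using interior_subset[of "snd i"] by (rule order_trans[rotated])
          qed
          show "(\<Union>i\<in>p2. {Inf (snd i)<..<Sup (snd i)}) \<in> sets lebesgue"
            using p12(4) by (intro sets.finite_UN) auto
          show "U \<in> lmeasurable"
            using finU U(1) by (intro fmeasurableI) simp_all
        qed
        also have "measure lebesgue U < \<delta>"
          by (rule mU)
        finally show "(\<Sum>i\<in>p2. Sup (snd i) - Inf (snd i)) < \<delta>" .
      qed
      finally have S2: "norm (\<Sum>(x, K)\<in>p2. (measure lborel K *\<^sub>R g x) - (f (Sup K) - f (Inf K))) < e / 2" .
      show ?thesis using split S1 S2 by linarith
    qed
    show "\<exists>\<gamma>. gauge \<gamma> \<and> (\<forall>\<D>. \<D> tagged_division_of {a..b} \<and> \<gamma> fine \<D> \<longrightarrow>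
        norm ((\<Sum>(x, k)\<in>\<D>. measure lborel k *\<^sub>R g x) - (f b - f a)) < e)"
      by (intro exI[of _ \<gamma>] conjI gauge allI impI) (elim conjE, rule main)
  qed
qed

text \<open>
  The one-dimensional case of the differentiation property of averages over small cubes.
\<close>

lemma lebesgue_right_differentiation:
  fixes f :: "real \<Rightarrow> 'b::euclidean_space"
  assumes f: "\<And>a b. f integrable_on {a..b}"
  shows "\<exists>N. negligible N \<and> (\<forall>x e. x \<notin> N \<longrightarrow> 0 < e \<longrightarrow>
      (\<exists>d>0. \<forall>h. 0 < h \<and> h < d \<longrightarrow> norm (integral {x..x+h} f /\<^sub>R h - f x) < e))"
proof (rule integrable_ccontinuous_explicit[of f])
  show "f integrable_on cbox a b" for a b using f by simp
  fix N assume N: "negligible N" "\<And>x e. \<lbrakk>x \<notin> N; 0 < e\<rbrakk> \<Longrightarrow> \<exists>d>0. \<forall>h. 0 < h \<and> h < d \<longrightarrow>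
      norm (integral (cbox x (x + h *\<^sub>R One)) f /\<^sub>R h ^ DIM(real) - f x) < e"
  show ?thesis
  proof (intro exI[of _ N] conjI allI impI)
    show "\<exists>d>0. \<forall>h. 0 < h \<and> h < d \<longrightarrow> norm (integral {x..x+h} f /\<^sub>R h - f x) < e"
      if "x \<notin> N" "0 < e" for x e
      using N(2)[OF that] by simp
  qed (rule N)
qed

text \<open>
  The left derivative is the right derivative of the reflected function.
\<close>

lemma lebesgue_differentiation:
  fixes f :: "real \<Rightarrow> 'b::euclidean_space"
  assumes f: "\<And>a b. f integrable_on {a..b}"
  shows "\<exists>N. negligible N \<and> (\<forall>a x. x \<notin> N \<longrightarrow> a < x \<longrightarrow>
    ((\<lambda>x. integral {a..x} f) has_vector_derivative f x) (at x))"
proof -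
  obtain N1 where N1: "negligible N1" "\<forall>x e. x \<notin> N1 \<longrightarrow> 0 < e \<longrightarrow>
      (\<exists>d>0. \<forall>h. 0 < h \<and> h < d \<longrightarrow> norm (integral {x..x+h} f /\<^sub>R h - f x) < e)"
    using lebesgue_right_differentiation[OF f] by blast
  have fr: "(\<lambda>x. f (- x)) integrable_on {a..b}" for a b
    using f[of "-b" "-a"] Henstock_Kurzweil_Integration.integrable_reflect_real[where f = f and a = "-b" and b = "-a"] by simp
  obtain N2 where N2: "negligible N2" "\<forall>x e. x \<notin> N2 \<longrightarrow> 0 < e \<longrightarrow>
      (\<exists>d>0. \<forall>h. 0 < h \<and> h < d \<longrightarrow> norm (integral {x..x+h} (\<lambda>x. f (- x)) /\<^sub>R h - f (- x)) < e)"
    using lebesgue_right_differentiation[OF fr] by blast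
  show ?thesis
  proof (intro exI[of _ "N1 \<union> uminus ` N2"] conjI allI impI)
    show "negligible (N1 \<union> uminus ` N2)"
    proof (rule negligible_Un[OF N1(1)])
      show "negligible (uminus ` N2)"
        by (rule negligible_differentiable_image_negligible[OF _ N2(1)])
          (auto intro!: derivative_intros)
    qed
    fix a x :: real assume x: "x \<notin> N1 \<union> uminus ` N2" and "a < x"
    show "((\<lambda>x. integral {a..x} f) has_vector_derivative f x) (at x)"
      unfolding has_vector_derivative_def has_derivative_at_alt
    proof (intro conjI allI impI)
      show "bounded_linear (\<lambda>h. h *\<^sub>R f x)" by (rule bounded_linear_scaleR_left)
      fix e :: real assume e: "0 < e"
      obtain d1 where d1: "0 < d1" "\<And>h. 0 < h \<Longrightarrow> h < d1 \<Longrightarrow> norm (integral {x..x+h} f /\<^sub>R h - f x) < e"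
        using N1(2)[rule_format, of x e] x e by auto
      have "- x \<notin> N2" using x by force
      then obtain d2 where d2: "0 < d2"
          "\<And>h. 0 < h \<Longrightarrow> h < d2 \<Longrightarrow> norm (integral {-x..-x+h} (\<lambda>x. f (- x)) /\<^sub>R h - f x) < e"
        using N2(2)[rule_format, of "-x" e] e by auto
      have main: "norm (integral {a..y} f - integral {a..x} f - (y - x) *\<^sub>R f x) \<le> e * norm (y - x)"
        if y: "norm (y - x) < min (min d1 d2) (x - a)" for y
      proof -
        have scale: "norm (I - h *\<^sub>R f x) \<le> e * h" if "norm (I /\<^sub>R h - f x) < e" "0 < h" for I and h :: real
        proof -
          have "I - h *\<^sub>R f x = h *\<^sub>R (I /\<^sub>R h - f x)" using that(2) by (simp add: algebra_simps)
          then have "norm (I - h *\<^sub>R f x) = h * norm (I /\<^sub>R h - f x)" using that(2) by simp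
          then show ?thesis using that by (simp add: mult.commute mult_right_mono less_imp_le)
        qed
        consider "y = x" | "x < y" | "y < x" by linarith
        then show ?thesis
        proof cases
          case 2
          have "integral {a..x} f + integral {x..y} f = integral {a..y} f"
            using 2 \<open>a < x\<close> f by (intro Henstock_Kurzweil_Integration.integral_combine) auto
          moreover have "norm (integral {x..y} f - (y - x) *\<^sub>R f x) \<le> e * (y - x)"
            using d1(2)[of "y - x"] y 2 by (intro scale) auto
          ultimately show ?thesis using 2 by (simp add: algebra_simps flip: \<open>_ = integral {a..y} f\<close>)
        next
          case 3
          have comb: "integral {a..y} f + integral {y..x} f = integral {a..x} f"
            using 3 y f by (intro Henstock_Kurzweil_Integration.integral_combine) auto
          have "integral {-x..-x+(x-y)} (\<lambda>x. f (- x)) = integral {y..x} f"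
            using Henstock_Kurzweil_Integration.integral_reflect_real[of x y f] by simp
          then have "norm (integral {y..x} f - (x - y) *\<^sub>R f x) \<le> e * (x - y)"
            using d2(2)[of "x - y"] y 3 by (intro scale) auto
          moreover have "integral {a..y} f - integral {a..x} f - (y - x) *\<^sub>R f x
              = - (integral {y..x} f - (x - y) *\<^sub>R f x)"
            by (simp add: algebra_simps flip: comb)
          ultimately show ?thesis using 3 by (simp only: norm_minus_cancel) simp
        qed simp
      qed
      show "\<exists>d>0. \<forall>y. norm (y - x) < d \<longrightarrow>
          norm (integral {a..y} f - integral {a..x} f - (y - x) *\<^sub>R f x) \<le> e * norm (y - x)"
        using main d1(1) d2(1) \<open>a < x\<close> by (intro exI[of _ "min (min d1 d2) (x - a)"]) auto
    qed
  qed
qed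

lemma AE_half_line_iff_negligible:
  "(AE x in half_line. P x) \<longleftrightarrow> negligible {x. 0 \<le> x \<and> \<not> P x}"
proof -
  have "(AE x in half_line. P x) \<longleftrightarrow> (AE x in lebesgue. x \<in> {0..} \<longrightarrow> P x)"
    by (rule AE_restrict_space_iff) simp
  also have "\<dots> \<longleftrightarrow> (\<exists>N\<in>null_sets lebesgue. {x \<in> space lebesgue. \<not> (x \<in> {0..} \<longrightarrow> P x)} \<subseteq> N)"
    by (rule eventually_ae_filter)
  also have "{x \<in> space lebesgue. \<not> (x \<in> {0..} \<longrightarrow> P x)} = {x. 0 \<le> x \<and> \<not> P x}" by auto
  also have "(\<exists>N\<in>null_sets lebesgue. {x. 0 \<le> x \<and> \<not> P x} \<subseteq> N) \<longleftrightarrow> negligible {x. 0 \<le> x \<and> \<not> P x}"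
  proof
    assume "\<exists>N\<in>null_sets lebesgue. {x. 0 \<le> x \<and> \<not> P x} \<subseteq> N"
    then show "negligible {x. 0 \<le> x \<and> \<not> P x}"
    proof (rule bexE)
      fix N assume N: "N \<in> null_sets lebesgue" and sub: "{x. 0 \<le> x \<and> \<not> P x} \<subseteq> N"
      show "negligible {x. 0 \<le> x \<and> \<not> P x}"
        by (rule negligible_subset[OF N[folded negligible_iff_null_sets] sub])
    qed
  next
    assume "negligible {x. 0 \<le> x \<and> \<not> P x}"
    then show "\<exists>N\<in>null_sets lebesgue. {x. 0 \<le> x \<and> \<not> P x} \<subseteq> N"
      unfolding negligible_iff_null_sets by (rule bexI[rotated]) (rule order_refl)
  qed
  finally show ?thesis .
qed

lemma absolutely_continuous_on_subsegment:
  assumes "absolutely_continuous_on_segment a b f" "a \<le> a'" "b' \<le> b"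
  shows "absolutely_continuous_on_segment a' b' f"
  unfolding absolutely_continuous_on_segment_def
proof (intro allI impI)
  fix e :: real assume "0 < e"
  with assms(1) obtain d where d: "0 < d" and dd: "\<forall>(n::nat) p q.
        (\<forall>i<n. a \<le> p i \<and> p i \<le> q i \<and> q i \<le> b) \<and>
        disjoint_family_on (\<lambda>i. {p i<..<q i}) {..<n} \<and> (\<Sum>i<n. q i - p i) < d \<longrightarrow>
        (\<Sum>i<n. cmod (f (q i) - f (p i))) < e"
    unfolding absolutely_continuous_on_segment_def by (elim allE[of _ e] impE exE conjE)
  show "\<exists>d>0. \<forall>(n::nat) p q.
        (\<forall>i<n. a' \<le> p i \<and> p i \<le> q i \<and> q i \<le> b') \<and>
        disjoint_family_on (\<lambda>i. {p i<..<q i}) {..<n} \<and> (\<Sum>i<n. q i - p i) < d \<longrightarrow>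
        (\<Sum>i<n. cmod (f (q i) - f (p i))) < e"
  proof (intro exI[of _ d] conjI d allI impI, elim conjE)
    fix n :: nat and p q
    assume 1: "\<forall>i<n. a' \<le> p i \<and> p i \<le> q i \<and> q i \<le> b'"
      and 2: "disjoint_family_on (\<lambda>i. {p i<..<q i}) {..<n}" "(\<Sum>i<n. q i - p i) < d"
    have "\<forall>i<n. a \<le> p i \<and> p i \<le> q i \<and> q i \<le> b" using 1 assms(2,3) by fastforce
    with 2 dd show "(\<Sum>i<n. cmod (f (q i) - f (p i))) < e" by simp
  qed
qed

lemma AC_loc_continuous_on:
  assumes "AC_loc f"
  shows "continuous_on {0..} f"
  unfolding continuous_on_iff
proof (intro ballI allI impI)
  fix x e :: real assume x: "x \<in> {0..}" and e: "0 < e"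
  have "absolutely_continuous_on_segment 0 (x + 1) f"
    using assms x by (simp add: AC_loc_def)
  with e obtain d where d: "0 < d" and dd: "\<forall>(n::nat) p q.
        (\<forall>i<n. 0 \<le> p i \<and> p i \<le> q i \<and> q i \<le> x + 1) \<and>
        disjoint_family_on (\<lambda>i. {p i<..<q i}) {..<n} \<and> (\<Sum>i<n. q i - p i) < d \<longrightarrow>
        (\<Sum>i<n. cmod (f (q i) - f (p i))) < e"
    unfolding absolutely_continuous_on_segment_def by (elim allE[of _ e] impE exE conjE)
  have one: "cmod (f q - f p) < e" if "0 \<le> p" "p \<le> q" "q \<le> x + 1" "q - p < d" for p q
    using dd[rule_format, of 1 "\<lambda>_. p" "\<lambda>_. q"] that by (simp add: disjoint_family_on_def)
  show "\<exists>d>0. \<forall>x'\<in>{0..}. dist x' x < d \<longrightarrow> dist (f x') (f x) < e"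
  proof (intro exI[of _ "min d 1"] conjI ballI impI)
    show "0 < min d 1" using d by simp
    fix x' assume x': "x' \<in> {0..}" "dist x' x < min d 1"
    then have "\<bar>x' - x\<bar> < d" "\<bar>x' - x\<bar> < 1" by (simp_all add: dist_real_def)
    then have "cmod (f x' - f x) < e \<or> cmod (f x - f x') < e"
      using one[of x x'] one[of x' x] x x'(1) by (cases "x \<le> x'") auto
    then show "dist (f x') (f x) < e"
      by (metis dist_commute dist_norm)
  qed
qed

text \<open>
  A common source of sums and products of locally absolutely continuous functions.
\<close>

lemma AC_loc_dominated:
  assumes f: "AC_loc f" and g: "AC_loc g"
    and h: "\<And>R. 0 \<le> R \<Longrightarrow> \<exists>K>0. \<forall>p\<in>{0..R}. \<forall>q\<in>{0..R}.
      cmod (h q - h p) \<le> K * cmod (f q - f p) + K * cmod (g q - g p)"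
  shows "AC_loc h"
  unfolding AC_loc_def absolutely_continuous_on_segment_def
proof (intro allI impI)
  fix R e :: real assume R: "0 \<le> R" and e: "0 < e"
  obtain K where K: "0 < K" and hK: "\<forall>p\<in>{0..R}. \<forall>q\<in>{0..R}.
      cmod (h q - h p) \<le> K * cmod (f q - f p) + K * cmod (g q - g p)"
    using h[OF R] by (elim exE conjE)
  have e2: "0 < e / (2 * K)" using e K by simp
  have ex: "\<exists>d>0. \<forall>(n::nat) p q. (\<forall>i<n. 0 \<le> p i \<and> p i \<le> q i \<and> q i \<le> R) \<and>
        disjoint_family_on (\<lambda>i. {p i<..<q i}) {..<n} \<and> (\<Sum>i<n. q i - p i) < d \<longrightarrow>
        (\<Sum>i<n. cmod (j (q i) - j (p i))) < e / (2 * K)" if "AC_loc j" for j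
    using that R e2 unfolding AC_loc_def absolutely_continuous_on_segment_def by simp
  obtain d1 where d1: "0 < d1" "\<forall>(n::nat) p q. (\<forall>i<n. 0 \<le> p i \<and> p i \<le> q i \<and> q i \<le> R) \<and>
        disjoint_family_on (\<lambda>i. {p i<..<q i}) {..<n} \<and> (\<Sum>i<n. q i - p i) < d1 \<longrightarrow>
        (\<Sum>i<n. cmod (f (q i) - f (p i))) < e / (2 * K)" using ex[OF f] by (elim exE conjE)
  obtain d2 where d2: "0 < d2" "\<forall>(n::nat) p q. (\<forall>i<n. 0 \<le> p i \<and> p i \<le> q i \<and> q i \<le> R) \<and>
        disjoint_family_on (\<lambda>i. {p i<..<q i}) {..<n} \<and> (\<Sum>i<n. q i - p i) < d2 \<longrightarrow>
        (\<Sum>i<n. cmod (g (q i) - g (p i))) < e / (2 * K)" using ex[OF g] by (elim exE conjE)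
  show "\<exists>d>0. \<forall>(n::nat) p q. (\<forall>i<n. 0 \<le> p i \<and> p i \<le> q i \<and> q i \<le> R) \<and>
        disjoint_family_on (\<lambda>i. {p i<..<q i}) {..<n} \<and> (\<Sum>i<n. q i - p i) < d \<longrightarrow>
        (\<Sum>i<n. cmod (h (q i) - h (p i))) < e"
  proof (intro exI[of _ "min d1 d2"] conjI allI impI, goal_cases)
    case 1
    show ?case using d1 d2 by simp
  next
    case (2 n p q)
    then have pq: "\<And>i. i < n \<Longrightarrow> 0 \<le> p i \<and> p i \<le> q i \<and> q i \<le> R" by simp
    have "(\<Sum>i<n. cmod (h (q i) - h (p i)))
        \<le> (\<Sum>i<n. K * cmod (f (q i) - f (p i)) + K * cmod (g (q i) - g (p i)))"
    proof (rule sum_mono)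
      fix i assume "i \<in> {..<n}"
      then have "q i \<in> {0..R}" "p i \<in> {0..R}" using pq[of i] by auto
      then show "cmod (h (q i) - h (p i)) \<le> K * cmod (f (q i) - f (p i)) + K * cmod (g (q i) - g (p i))"
        using hK by simp
    qed
    also have "\<dots> = K * (\<Sum>i<n. cmod (f (q i) - f (p i))) + K * (\<Sum>i<n. cmod (g (q i) - g (p i)))"
      by (simp add: sum.distrib sum_distrib_left)
    also have "\<dots> < K * (e / (2 * K)) + K * (e / (2 * K))"
      using 2 d1(2)[rule_format, of n p q] d2(2)[rule_format, of n p q] K
      by (intro add_strict_mono mult_strict_left_mono) simp_all
    also have "\<dots> = e" using K by simp
    finally show ?case .
  qed
qed

lemma AC_loc_bounded:
  assumes "AC_loc h"
  shows "\<exists>K>0. \<forall>x\<in>{0..R}. cmod (h x) \<le> K"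
proof -
  have "continuous_on {0..R} h"
    using AC_loc_continuous_on[OF assms] by (rule continuous_on_subset) simp
  then have "bounded (h ` {0..R})"
    by (intro compact_imp_bounded compact_continuous_image compact_Icc)
  then obtain K where K: "0 < K" "\<forall>y\<in>h ` {0..R}. norm y \<le> K"
    unfolding bounded_pos by (elim exE conjE)
  show ?thesis
  proof (intro exI[of _ K] conjI ballI)
    show "cmod (h x) \<le> K" if "x \<in> {0..R}" for x
      using K(2) that by (rule bspec[OF _ imageI])
  qed (rule K)
qed

lemma AC_loc_mult:
  assumes f: "AC_loc f" and g: "AC_loc g"
  shows "AC_loc (\<lambda>x. f x * g x)"
proof (rule AC_loc_dominated[OF f g])
  fix R :: real assume "0 \<le> R"
  obtain K1 where K1: "0 < K1" "\<forall>x\<in>{0..R}. cmod (f x) \<le> K1" using AC_loc_bounded[OF f, of R] by (elim exE conjE)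
  obtain K2 where K2: "0 < K2" "\<forall>x\<in>{0..R}. cmod (g x) \<le> K2" using AC_loc_bounded[OF g, of R] by (elim exE conjE)
  define K where "K = K1 + K2"
  have K: "0 < K" "K1 \<le> K" "K2 \<le> K" using K1 K2 by (simp_all add: K_def)
  show "\<exists>K>0. \<forall>p\<in>{0..R}. \<forall>q\<in>{0..R}.
      cmod (f q * g q - f p * g p) \<le> K * cmod (f q - f p) + K * cmod (g q - g p)"
  proof (intro exI[of _ K] conjI ballI K)
    fix p q assume p: "p \<in> {0..R}" and q: "q \<in> {0..R}"
    have gq: "cmod (g q) \<le> K" using K2(2)[rule_format, OF q] K(3) by simp
    have fp: "cmod (f p) \<le> K" using K1(2)[rule_format, OF p] K(2) by simp
    have "f q * g q - f p * g p = g q * (f q - f p) + f p * (g q - g p)"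
      by (simp add: algebra_simps)
    also have "cmod \<dots> \<le> cmod (g q) * cmod (f q - f p) + cmod (f p) * cmod (g q - g p)"
      by (rule order_trans[OF norm_triangle_ineq]) (simp add: norm_mult)
    also have "\<dots> \<le> K * cmod (f q - f p) + K * cmod (g q - g p)"
      by (intro add_mono mult_right_mono gq fp) simp_all
    finally show "cmod (f q * g q - f p * g p) \<le> K * cmod (f q - f p) + K * cmod (g q - g p)" .
  qed
qed

lemma AC_loc_add:
  assumes f: "AC_loc f" and g: "AC_loc g"
  shows "AC_loc (\<lambda>x. f x + g x)"
proof (rule AC_loc_dominated[OF f g], intro exI[of _ 1] conjI ballI)
  show "cmod (f q + g q - (f p + g p)) \<le> 1 * cmod (f q - f p) + 1 * cmod (g q - g p)" for p q
    using norm_triangle_ineq[of "f q - f p" "g q - g p"] by (simp add: algebra_simps)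
qed simp

lemma AC_loc_lipschitz:
  assumes "\<And>R. 0 \<le> R \<Longrightarrow> \<exists>K. \<forall>x y. 0 \<le> x \<longrightarrow> x \<le> y \<longrightarrow> y \<le> R \<longrightarrow> cmod (f y - f x) \<le> K * (y - x)"
  shows "AC_loc f"
  unfolding AC_loc_def absolutely_continuous_on_segment_def
proof (intro allI impI)
  fix R e :: real assume R: "0 \<le> R" and e: "0 < e"
  obtain K' where K': "\<forall>x y. 0 \<le> x \<longrightarrow> x \<le> y \<longrightarrow> y \<le> R \<longrightarrow> cmod (f y - f x) \<le> K' * (y - x)"
    using assms[OF R] by (elim exE)
  define K where "K = \<bar>K'\<bar> + 1"
  have K: "0 < K" by (simp add: K_def add_nonneg_pos)
  have lip: "cmod (f y - f x) \<le> K * (y - x)" if "0 \<le> x" "x \<le> y" "y \<le> R" for x y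
  proof -
    have "K' * (y - x) \<le> K * (y - x)" using that by (intro mult_right_mono) (auto simp: K_def)
    then show ?thesis using K' that by (meson order_trans)
  qed
  show "\<exists>d>0. \<forall>(n::nat) p q. (\<forall>i<n. 0 \<le> p i \<and> p i \<le> q i \<and> q i \<le> R) \<and>
        disjoint_family_on (\<lambda>i. {p i<..<q i}) {..<n} \<and> (\<Sum>i<n. q i - p i) < d \<longrightarrow>
        (\<Sum>i<n. cmod (f (q i) - f (p i))) < e"
  proof (intro exI[of _ "e / K"] conjI allI impI, goal_cases)
    case 1
    show ?case using e K by simp
  next
    case (2 n p q)
    have "(\<Sum>i<n. cmod (f (q i) - f (p i))) \<le> (\<Sum>i<n. K * (q i - p i))"
      using 2 by (intro sum_mono lip) simp_all
    also have "\<dots> = K * (\<Sum>i<n. q i - p i)" by (simp add: sum_distrib_left)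
    also have "\<dots> < K * (e / K)" using 2 K by (intro mult_strict_left_mono) simp_all
    also have "\<dots> = e" using K by simp
    finally show ?case .
  qed
qed

lemma AC_loc_cnj: "AC_loc f \<Longrightarrow> AC_loc (\<lambda>x. cnj (f x))"
  unfolding AC_loc_def absolutely_continuous_on_segment_def
  by (simp flip: complex_cnj_diff)

lemma AC_loc_of_real: "AC_loc (\<lambda>x. complex_of_real x)"
  by (rule AC_loc_lipschitz) (auto intro!: exI[of _ 1] simp flip: of_real_diff)

lemma AC_loc_has_integral:
  assumes f: "AC_loc f"
    and f': "AE x in half_line. (f has_vector_derivative f' x) (at x within {0..})"
    and ab: "0 \<le> a" "a \<le> b"
  shows "(f' has_integral (f b - f a)) {a..b}"
proof (rule absolutely_continuous_has_integral)
  have "absolutely_continuous_on_segment 0 b f" using f ab by (simp add: AC_loc_def)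
  then show "absolutely_continuous_on_segment a b f"
    by (rule absolutely_continuous_on_subsegment) (use ab in simp_all)
  show "negligible {x. 0 \<le> x \<and> \<not> (f has_vector_derivative f' x) (at x within {0..})}"
    using f' unfolding AE_half_line_iff_negligible .
  fix x assume x: "x \<in> {a..b} - {x. 0 \<le> x \<and> \<not> (f has_vector_derivative f' x) (at x within {0..})}"
  then have "(f has_vector_derivative f' x) (at x within {0..})" using ab by simp
  then show "(f has_vector_derivative f' x) (at x within {a..b})"
    by (rule has_vector_derivative_within_subset) (use ab in auto)
qed (use ab in simp)

lemma bounded_measurable_integrable:
  fixes f :: "real \<Rightarrow> 'b::euclidean_space"
  assumes "f \<in> borel_measurable (lebesgue_on {a..b})" "\<And>x. x \<in> {a..b} \<Longrightarrow> norm (f x) \<le> K"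
  shows "f integrable_on {a..b}"
  by (rule measurable_bounded_by_integrable_imp_integrable[OF assms(1), of "\<lambda>_. K"])
    (use assms(2) in \<open>simp_all add: integrable_const_ivl\<close>)

section \<open>Completeness of the space of square integrable functions\<close>

lemma abs_l2_eq_iff:
  assumes "square_integrable f" "square_integrable g"
  shows "abs_l2 f = abs_l2 g \<longleftrightarrow> (AE x in half_line. f x = g x)"
  using Quotient_rel[OF Quotient_l2, of f g] assms by simp

lemma abs_l2_cases:
  obtains f where "square_integrable f" "F = abs_l2 f"
proof (rule that[of "rep_l2 F"])
  show "square_integrable (rep_l2 F)"
    using Quotient_rep_reflp[OF Quotient_l2, of F] by simp
  show "F = abs_l2 (rep_l2 F)"
    using Quotient_abs_rep[OF Quotient_l2, of F] by simp
qed

lemma abs_l2_add: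
  assumes "square_integrable f" "square_integrable g"
  shows "abs_l2 f + abs_l2 g = abs_l2 (\<lambda>x. f x + g x)"
  using assms by (simp add: plus_l2.abs_eq)

lemma abs_l2_scaleC:
  assumes "square_integrable f"
  shows "l2_scaleC c (abs_l2 f) = abs_l2 (\<lambda>x. c * f x)"
  using assms by (simp add: l2_scaleC.abs_eq)

lemma abs_l2_diff:
  assumes "square_integrable f" "square_integrable g"
  shows "abs_l2 f - abs_l2 g = abs_l2 (\<lambda>x. f x - g x)"
proof -
  have "- abs_l2 g = abs_l2 (\<lambda>x. - g x)" using assms by (simp add: uminus_l2.abs_eq)
  moreover have "square_integrable (\<lambda>x. - g x)"
    using square_integrable_mult[OF assms(2), of "-1"] by simp
  ultimately show ?thesis using assms by (simp add: minus_l2_def abs_l2_add)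
qed

lemma square_integrable_diff:
  assumes "square_integrable f" "square_integrable g"
  shows "square_integrable (\<lambda>x. f x - g x)"
  using square_integrable_add[OF assms(1) square_integrable_mult[OF assms(2), of "-1"]] by simp

lemma l2_cinner_abs:
  assumes "square_integrable f" "square_integrable g"
  shows "l2_cinner (abs_l2 f) (abs_l2 g) = (LINT x|half_line. f x * cnj (g x))"
  using assms by (simp add: l2_cinner.abs_eq)

lemma norm_abs_l2:
  assumes "square_integrable f"
  shows "(norm (abs_l2 f))\<^sup>2 = (LINT x|half_line. (cmod (f x))\<^sup>2)"
proof -
  have "0 \<le> (LINT x|half_line. (cmod (f x))\<^sup>2)" by simp
  then show ?thesis
    using assms by (simp add: norm_l2_def l2_cinner_abs l2_cinner_self_aux)
qed

lemma nn_integral_abs_l2: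
  assumes "square_integrable f"
  shows "(\<integral>\<^sup>+x. ennreal ((cmod (f x))\<^sup>2) \<partial>half_line) = ennreal ((norm (abs_l2 f))\<^sup>2)"
  using assms by (simp add: norm_abs_l2 nn_integral_eq_integral square_integrable_def)

text \<open>
  Turns a bound in $L_2$ with geometric weights into absolute summability at almost every point.
\<close>

lemma summable_of_weighted_squares:
  fixes u :: "nat \<Rightarrow> real"
  assumes "\<And>k. 2 ^ k * (u k)\<^sup>2 \<le> S"
  shows "summable (\<lambda>k. \<bar>u k\<bar>)"
proof (rule summable_comparison_test')
  define q where "q = 1 / sqrt 2"
  have q: "0 < q" "q < 1" by (simp_all add: q_def)
  show "summable (\<lambda>k. sqrt S * q ^ k)"
    using q by (intro summable_mult summable_geometric) simp
  show "norm \<bar>u k\<bar> \<le> sqrt S * q ^ k" if "0 \<le> k" for k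
  proof -
    have "(u k)\<^sup>2 \<le> S * (1 / 2) ^ k" using assms[of k] by (simp add: field_simps)
    then have "sqrt ((u k)\<^sup>2) \<le> sqrt (S * (1 / 2) ^ k)" by (rule real_sqrt_le_mono)
    also have "\<dots> = sqrt S * q ^ k"
      by (simp add: real_sqrt_mult real_sqrt_power real_sqrt_divide q_def)
    finally show ?thesis by simp
  qed
qed

text \<open>
  Riesz--Fischer. Along a rapidly Cauchy subsequence $\sum_k 2^k|f_{r(k+1)} - f_{r(k)}|^2$ has a finite integral,
  hence is finite almost everywhere, and the subsequence converges almost everywhere; Fatou's lemma identifies
  the limit in norm.
\<close>

instance l2 :: complete_space
proof
  fix X :: "nat \<Rightarrow> l2"
  assume X: "Cauchy X"
  have "\<exists>f. square_integrable f \<and> X n = abs_l2 f" for n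
    by (rule abs_l2_cases[of "X n"]) (rule exI, rule conjI)
  then have "\<exists>f. \<forall>n. square_integrable (f n) \<and> X n = abs_l2 (f n)"
    by (intro choice allI)
  then obtain f where fXf: "\<forall>n. square_integrable (f n) \<and> X n = abs_l2 (f n)" by blast
  have f: "square_integrable (f n)" and Xf: "X n = abs_l2 (f n)" for n
    using fXf by blast+
  have f_meas[measurable]: "f n \<in> borel_measurable half_line" for n
    using f[of n] by (simp add: square_integrable_def)
  have normdiff: "(\<integral>\<^sup>+x. ennreal ((cmod (f m x - f n x))\<^sup>2) \<partial>half_line) = ennreal ((norm (X m - X n))\<^sup>2)"
    for m n
    using nn_integral_abs_l2[OF square_integrable_diff[OF f[of m] f[of n]]]
    by (simp add: Xf abs_l2_diff f)
  have "\<exists>N. \<forall>m\<ge>N. \<forall>n\<ge>N. norm (X m - X n) < (1/2) ^ k" for k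
    using CauchyD[OF X, of "(1/2) ^ k"] by simp
  then have "\<exists>N. \<forall>k. \<forall>m\<ge>N k. \<forall>n\<ge>N k. norm (X m - X n) < (1/2) ^ k"
    by (intro choice allI)
  then obtain N where NN: "\<forall>k. \<forall>m\<ge>N k. \<forall>n\<ge>N k. norm (X m - X n) < (1/2) ^ k" by blast
  have N: "norm (X m - X n) < (1/2) ^ k" if "m \<ge> N k" "n \<ge> N k" for k m n
    using NN that by blast
  \<comment> \<open>the subsequence may repeat indices; it need only be late enough at every stage\<close>
  define r where "r k = Max (N ` {..k})" for k
  have r: "N j \<le> r k" if "j \<le> k" for j k
    unfolding r_def using that by (intro Max_ge) auto
  define \<Delta> where "\<Delta> k x = cmod (f (r (Suc k)) x - f (r k) x)" for k x
  have \<Delta>_meas[measurable]: "\<Delta> k \<in> borel_measurable half_line" for k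
    unfolding \<Delta>_def by measurable
  have "(\<integral>\<^sup>+x. (\<Sum>k. ennreal (2 ^ k * (\<Delta> k x)\<^sup>2)) \<partial>half_line)
      = (\<Sum>k. \<integral>\<^sup>+x. ennreal (2 ^ k * (\<Delta> k x)\<^sup>2) \<partial>half_line)"
    by (rule nn_integral_suminf) measurable
  also have "\<dots> \<le> (\<Sum>k. ennreal ((1/2) ^ k))"
  proof (intro suminf_le summableI)
    fix k
    have "(\<integral>\<^sup>+x. ennreal (2 ^ k * (\<Delta> k x)\<^sup>2) \<partial>half_line)
        = ennreal (2 ^ k) * (\<integral>\<^sup>+x. ennreal ((\<Delta> k x)\<^sup>2) \<partial>half_line)"
      by (simp add: ennreal_mult nn_integral_cmult)
    also have "\<dots> = ennreal (2 ^ k * (norm (X (r (Suc k)) - X (r k)))\<^sup>2)"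
      unfolding \<Delta>_def normdiff by (simp add: ennreal_mult)
    also have "\<dots> \<le> ennreal ((1/2) ^ k)"
    proof (rule ennreal_leI)
      have "norm (X (r (Suc k)) - X (r k)) \<le> (1/2) ^ k"
        using N[OF r[of k "Suc k"] r[of k k]] by simp
      then have "(norm (X (r (Suc k)) - X (r k)))\<^sup>2 \<le> ((1/2) ^ k)\<^sup>2"
        by (rule power_mono) simp
      then have "2 ^ k * (norm (X (r (Suc k)) - X (r k)))\<^sup>2 \<le> 2 ^ k * ((1/2) ^ k)\<^sup>2"
        by (rule mult_left_mono) simp
      also have "\<dots> = (1/2) ^ k"
        by (simp add: power2_eq_square power_divide)
      finally show "2 ^ k * (norm (X (r (Suc k)) - X (r k)))\<^sup>2 \<le> (1/2) ^ k" .
    qed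
    finally show "(\<integral>\<^sup>+x. ennreal (2 ^ k * (\<Delta> k x)\<^sup>2) \<partial>half_line) \<le> ennreal ((1/2) ^ k)" .
  qed
  also have "\<dots> = ennreal (\<Sum>k. (1/2) ^ k)"
    by (intro suminf_ennreal2 summable_geometric) simp_all
  also have "\<dots> < \<infinity>" by simp
  finally have fin: "(\<integral>\<^sup>+x. (\<Sum>k. ennreal (2 ^ k * (\<Delta> k x)\<^sup>2)) \<partial>half_line) \<noteq> \<infinity>" by simp
  have "AE x in half_line. (\<Sum>k. ennreal (2 ^ k * (\<Delta> k x)\<^sup>2)) \<noteq> \<infinity>"
    by (rule nn_integral_PInf_AE[OF _ fin]) measurable
  then have conv: "AE x in half_line. convergent (\<lambda>k. f (r k) x)"
  proof (rule eventually_mono)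
    fix x assume fx: "(\<Sum>k. ennreal (2 ^ k * (\<Delta> k x)\<^sup>2)) \<noteq> \<infinity>"
    obtain S where S0: "0 \<le> S" and S: "(\<Sum>k. ennreal (2 ^ k * (\<Delta> k x)\<^sup>2)) = ennreal S"
    proof (cases "\<Sum>k. ennreal (2 ^ k * (\<Delta> k x)\<^sup>2)" rule: ennreal_cases)
      case (real q)
      then show ?thesis by (rule that)
    next
      case top
      with fx show ?thesis unfolding infinity_ennreal_def by (rule notE)
    qed
    have "2 ^ k * (\<Delta> k x)\<^sup>2 \<le> S" for k
    proof -
      have "ennreal (2 ^ k * (\<Delta> k x)\<^sup>2) \<le> ennreal S"
        unfolding S[symmetric]
      proof (rule order_trans[OF _ sum_le_suminf[of _ "{k}"]])
        show "ennreal (2 ^ k * (\<Delta> k x)\<^sup>2) \<le> (\<Sum>k\<in>{k}. ennreal (2 ^ k * (\<Delta> k x)\<^sup>2))"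
          by simp
      qed (simp_all add: summableI)
      then show ?thesis using S0 by (simp only: ennreal_le_iff)
    qed
    then have "summable (\<lambda>k. \<bar>\<Delta> k x\<bar>)" by (rule summable_of_weighted_squares)
    then have "summable (\<lambda>k. norm (f (r (Suc k)) x - f (r k) x))" by (simp add: \<Delta>_def)
    then have "summable (\<lambda>k. f (r (Suc k)) x - f (r k) x)" by (rule summable_norm_cancel)
    then have "convergent (\<lambda>n. \<Sum>k<n. f (r (Suc k)) x - f (r k) x)"
      by (simp add: summable_iff_convergent)
    then have "convergent (\<lambda>n. f (r n) x - f (r 0) x)"
      by (simp only: sum_lessThan_telescope[of "\<lambda>k. f (r k) x"])
    from convergent_add[OF this convergent_const[of "f (r 0) x"]]
    show "convergent (\<lambda>k. f (r k) x)" by simp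
  qed
  define g where "g x = lim (\<lambda>k. f (r k) x)" for x
  have g_meas[measurable]: "g \<in> borel_measurable half_line"
    unfolding g_def by (rule borel_measurable_lim_metric) measurable
  have bound: "(\<integral>\<^sup>+x. ennreal ((cmod (g x - f n x))\<^sup>2) \<partial>half_line) \<le> ennreal (((1/2) ^ k)\<^sup>2)"
    if n: "n \<ge> N k" for n k
  proof -
    have "(\<integral>\<^sup>+x. ennreal ((cmod (g x - f n x))\<^sup>2) \<partial>half_line)
        = (\<integral>\<^sup>+x. liminf (\<lambda>j. ennreal ((cmod (f (r j) x - f n x))\<^sup>2)) \<partial>half_line)"
    proof (rule nn_integral_cong_AE, use conv in \<open>rule eventually_mono\<close>)
      fix x assume "convergent (\<lambda>k. f (r k) x)"
      then have "(\<lambda>j. f (r j) x) \<longlonglongrightarrow> g x" by (simp add: g_def convergent_LIMSEQ_iff)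
      then have "(\<lambda>j. ennreal ((cmod (f (r j) x - f n x))\<^sup>2)) \<longlonglongrightarrow> ennreal ((cmod (g x - f n x))\<^sup>2)"
        by (intro tendsto_ennrealI tendsto_intros)
      then show "ennreal ((cmod (g x - f n x))\<^sup>2) = liminf (\<lambda>j. ennreal ((cmod (f (r j) x - f n x))\<^sup>2))"
        by (intro lim_imp_Liminf[symmetric]) simp_all
    qed
    also have "\<dots> \<le> liminf (\<lambda>j. \<integral>\<^sup>+x. ennreal ((cmod (f (r j) x - f n x))\<^sup>2) \<partial>half_line)"
      by (rule nn_integral_liminf) measurable
    also have "\<dots> \<le> liminf (\<lambda>j::nat. ennreal (((1/2) ^ k)\<^sup>2))"
    proof (rule Liminf_mono, rule eventually_sequentiallyI[of k])
      fix j assume "k \<le> j"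
      then have "norm (X (r j) - X n) \<le> (1/2) ^ k"
        using N[OF r n, of j] by simp
      then show "(\<integral>\<^sup>+x. ennreal ((cmod (f (r j) x - f n x))\<^sup>2) \<partial>half_line) \<le> ennreal (((1/2) ^ k)\<^sup>2)"
        unfolding normdiff by (intro ennreal_leI power_mono) simp_all
    qed
    also have "\<dots> = ennreal (((1/2) ^ k)\<^sup>2)" by (rule Liminf_const) simp
    finally show ?thesis .
  qed
  have sqi_diff: "square_integrable (\<lambda>x. g x - f n x)" if n: "n \<ge> N k" for n k
    unfolding square_integrable_def
  proof
    show "integrable half_line (\<lambda>x. (cmod (g x - f n x))\<^sup>2)"
    proof (rule integrableI_bounded)
      show "(\<integral>\<^sup>+x. ennreal (norm ((cmod (g x - f n x))\<^sup>2)) \<partial>half_line) < \<infinity>"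
        using le_less_trans[OF bound[OF n] ennreal_less_top] by simp
    qed measurable
  qed measurable
  have g: "square_integrable g"
    using square_integrable_add[OF sqi_diff[of 0 "N 0"] f[of "N 0"]] by simp
  have close: "norm (abs_l2 g - X n) \<le> (1/2) ^ k" if n: "n \<ge> N k" for n k
  proof -
    have "ennreal ((norm (abs_l2 g - X n))\<^sup>2) \<le> ennreal (((1/2) ^ k)\<^sup>2)"
      using bound[OF n] nn_integral_abs_l2[OF sqi_diff[OF n]] by (simp add: Xf abs_l2_diff g f)
    then have "(norm (abs_l2 g - X n))\<^sup>2 \<le> ((1/2) ^ k)\<^sup>2" by (simp add: ennreal_le_iff)
    then show ?thesis by (rule power2_le_imp_le) simp
  qed
  have "X \<longlonglongrightarrow> abs_l2 g"
  proof (rule LIMSEQ_I)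
    fix e :: real assume "0 < e"
    then obtain k where k: "(1/2) ^ k < e" using real_arch_pow_inv[of e "1/2"] by auto
    show "\<exists>no. \<forall>n\<ge>no. norm (X n - abs_l2 g) < e"
      using le_less_trans[OF close k] by (auto simp: norm_minus_commute)
  qed
  then show "convergent X" by (auto simp: convergent_def)
qed

section \<open>Decomposition of functions with sectorial increments\<close>

text \<open>
  Adding $(c/d)x$ makes the defect $c$ independent of the distance of the two points: each further step of
  length $d$ is paid for by the linear term. The running supremum is then within $c$ of the function.
\<close>

lemma almost_increasing_decomposition:
  fixes r :: "real \<Rightarrow> real"
  assumes c: "0 \<le> c" and d: "0 < d"
    and incr: "\<And>x t. 0 \<le> t \<Longrightarrow> t \<le> x \<Longrightarrow> x \<le> t + d \<Longrightarrow> - c \<le> r x - r t"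
  shows "\<exists>m. mono_on {0..} m \<and> (\<forall>x\<ge>0. m x - c \<le> r x + (c / d) * x \<and> r x + (c / d) * x \<le> m x)"
proof -
  define k where "k = c / d"
  have k: "0 \<le> k" "k * d = c" using c d by (simp_all add: k_def)
  define q where "q x = r x + k * x" for x
  have step: "- c \<le> q x - q t" if "0 \<le> t" "t \<le> x" "x \<le> t + real n * d" for n t x
    using that
  proof (induction n arbitrary: t)
    case 0
    then have "x = t" by simp
    then show ?case using c by simp
  next
    case (Suc n)
    show ?case
    proof (cases "x \<le> t + d")
      case True
      have "k * t \<le> k * x" using k Suc.prems by (intro mult_left_mono) auto
      then show ?thesis
        using incr[of t x] Suc.prems True unfolding q_def by linarith
    next
      case False
      have "- c \<le> q x - q (t + d)"
        using False Suc.prems d by (intro Suc.IH) (auto simp: algebra_simps)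
      moreover have "- c \<le> r (t + d) - r t" using d Suc.prems by (intro incr) auto
      moreover have "k * (t + d) = k * t + c" using k by (simp add: distrib_left)
      ultimately show ?thesis unfolding q_def by linarith
    qed
  qed
  have incr_q: "- c \<le> q x - q t" if "0 \<le> t" "t \<le> x" for t x
  proof -
    obtain n where "(x - t) / d < real n" using reals_Archimedean2 by blast
    then have "x \<le> t + real n * d" using d by (simp add: field_simps)
    then show ?thesis using that step by blast
  qed
  define m where "m x = Sup (q ` {0..x})" for x
  have bdd: "bdd_above (q ` {0..x})" for x
  proof (rule bdd_aboveI2)
    show "q t \<le> q x + c" if "t \<in> {0..x}" for t
      using incr_q[of t x] that by simp
  qed
  have "mono_on {0..} m"
  proof (rule mono_onI)
    fix x y :: real assume "x \<in> {0..}" "y \<in> {0..}" "x \<le> y"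
    then show "m x \<le> m y"
      unfolding m_def by (intro cSup_subset_mono bdd image_mono) auto
  qed
  moreover have "m x - c \<le> q x" if "0 \<le> x" for x
  proof -
    have "m x \<le> q x + c"
      unfolding m_def
    proof (rule cSup_least)
      show "q ` {0..x} \<noteq> {}" using that by simp
      fix y assume "y \<in> q ` {0..x}"
      then obtain t where "t \<in> {0..x}" "y = q t" by blast
      then show "y \<le> q x + c" using incr_q[of t x] by simp
    qed
    then show ?thesis by simp
  qed
  moreover have "q x \<le> m x" if "0 \<le> x" for x
    unfolding m_def using that by (intro cSup_upper bdd) auto
  ultimately show ?thesis by (intro exI[of _ m]) (simp add: q_def k_def)
qed

text \<open>
  Coordinates of a complex number in the oblique basis $e^{i\gamma}, e^{i\delta}$, by Cramer's rule.
\<close>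

definition cone_coord1 :: "real \<Rightarrow> real \<Rightarrow> complex \<Rightarrow> real" where
  "cone_coord1 \<gamma> \<delta> z = (Re z * sin \<delta> - Im z * cos \<delta>) / sin (\<delta> - \<gamma>)"

definition cone_coord2 :: "real \<Rightarrow> real \<Rightarrow> complex \<Rightarrow> real" where
  "cone_coord2 \<gamma> \<delta> z = (Im z * cos \<gamma> - Re z * sin \<gamma>) / sin (\<delta> - \<gamma>)"

lemma cone_coords:
  assumes "\<gamma> < \<delta>" "\<delta> - \<gamma> < pi"
  shows "z = of_real (cone_coord1 \<gamma> \<delta> z) * cis \<gamma> + of_real (cone_coord2 \<gamma> \<delta> z) * cis \<delta>"
proof -
  have S: "sin (\<delta> - \<gamma>) \<noteq> 0" using assms sin_gt_zero[of "\<delta> - \<gamma>"] by auto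
  have "(Re z * sin \<delta> - Im z * cos \<delta>) * cos \<gamma> + (Im z * cos \<gamma> - Re z * sin \<gamma>) * cos \<delta>
      = Re z * sin (\<delta> - \<gamma>)"
    "(Re z * sin \<delta> - Im z * cos \<delta>) * sin \<gamma> + (Im z * cos \<gamma> - Re z * sin \<gamma>) * sin \<delta>
      = Im z * sin (\<delta> - \<gamma>)"
    by (simp_all add: sin_diff algebra_simps)
  then show ?thesis
    using S by (simp add: complex_eq_iff cone_coord1_def cone_coord2_def flip: add_divide_distrib)
qed

lemma cone_coord_diff:
  "cone_coord1 \<gamma> \<delta> (z - w) = cone_coord1 \<gamma> \<delta> z - cone_coord1 \<gamma> \<delta> w"
  "cone_coord2 \<gamma> \<delta> (z - w) = cone_coord2 \<gamma> \<delta> z - cone_coord2 \<gamma> \<delta> w"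
  by (simp_all add: cone_coord1_def cone_coord2_def algebra_simps flip: diff_divide_distrib)

lemma cone_coord_nonneg:
  assumes "0 \<le> r" "\<gamma> \<le> \<phi>" "\<phi> \<le> \<delta>" "\<gamma> < \<delta>" "\<delta> - \<gamma> < pi"
  shows "0 \<le> cone_coord1 \<gamma> \<delta> (of_real r * cis \<phi>)" "0 \<le> cone_coord2 \<gamma> \<delta> (of_real r * cis \<phi>)"
proof -
  have S: "0 < sin (\<delta> - \<gamma>)" using assms by (intro sin_gt_zero) auto
  have "0 \<le> sin (\<delta> - \<phi>)" "0 \<le> sin (\<phi> - \<gamma>)" using assms by (intro sin_ge_zero; simp)+
  moreover have "cone_coord1 \<gamma> \<delta> (of_real r * cis \<phi>) = r * sin (\<delta> - \<phi>) / sin (\<delta> - \<gamma>)"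
    "cone_coord2 \<gamma> \<delta> (of_real r * cis \<phi>) = r * sin (\<phi> - \<gamma>) / sin (\<delta> - \<gamma>)"
    by (simp_all add: cone_coord1_def cone_coord2_def sin_diff[of \<delta> \<phi>] sin_diff[of \<phi> \<gamma>] algebra_simps)
  ultimately show "0 \<le> cone_coord1 \<gamma> \<delta> (of_real r * cis \<phi>)" "0 \<le> cone_coord2 \<gamma> \<delta> (of_real r * cis \<phi>)"
    using S assms(1) by simp_all
qed

text \<open>
  After rotation by the bisector the point has positive real part, and the arctangent of its slope is its
  argument.
\<close>

lemma cone_subset_sector:
  assumes a: "0 \<le> a1" "0 \<le> a2" and "\<gamma> < \<delta>" "\<delta> - \<gamma> < pi"
  shows "z + of_real a1 * cis \<gamma> + of_real a2 * cis \<delta> \<in> sector \<gamma> \<delta> z"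
proof (cases "a1 + a2 = 0")
  case True
  then have "a1 = 0" "a2 = 0" using a by simp_all
  then show ?thesis
    using assms by (auto simp: sector_def intro!: exI[of _ 0] exI[of _ \<gamma>])
next
  case False
  define h where "h = (\<delta> - \<gamma>) / 2"
  define \<theta> where "\<theta> = (\<gamma> + \<delta>) / 2"
  have h: "0 < h" "h < pi / 2" using assms by (simp_all add: h_def)
  have cosh: "0 < cos h" and sinh: "0 < sin h" using h by (auto intro: cos_gt_zero sin_gt_zero2)
  define R where "R = (a1 + a2) * cos h"
  define t where "t = (a2 - a1) * sin h / R"
  define \<psi> where "\<psi> = arctan t"
  have a12: "0 < a1 + a2" using False a by simp
  then have R: "0 < R" using cosh by (simp add: R_def)
  have tan: "tan h = sin h / cos h" by (simp add: tan_def)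
  have "t \<le> tan h"
    using a a12 cosh sinh by (simp add: t_def R_def tan divide_simps)
  moreover have "tan (- h) \<le> t"
  proof -
    have "(- (a1 + a2)) * sin h \<le> (a2 - a1) * sin h"
      using a sinh by (intro mult_right_mono) auto
    then have "- (sin h * (a1 + a2)) \<le> (a2 - a1) * sin h"
      by (simp add: algebra_simps)
    then show ?thesis using a12 cosh by (simp add: t_def R_def tan divide_simps)
  qed
  ultimately have "arctan (tan (- h)) \<le> \<psi>" "\<psi> \<le> arctan (tan h)"
    by (simp_all add: \<psi>_def arctan_le_iff)
  then have \<psi>: "- h \<le> \<psi>" "\<psi> \<le> h" using h by (simp_all add: arctan_tan arctan_minus)
  define r where "r = R * sqrt (1 + t\<^sup>2)"
  have sq: "0 < sqrt (1 + t\<^sup>2)" by (simp add: add_pos_nonneg)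
  have "r * cos \<psi> = R" "r * sin \<psi> = R * t"
    using sq by (simp_all add: r_def \<psi>_def cos_arctan sin_arctan)
  moreover have "R * t = (a2 - a1) * sin h" using R by (simp add: t_def)
  ultimately have polar: "of_real r * cis \<psi> = of_real a1 * cis (- h) + of_real a2 * cis h"
    by (simp add: complex_eq_iff R_def algebra_simps)
  have "of_real r * cis (\<theta> + \<psi>) = cis \<theta> * (of_real r * cis \<psi>)"
    by (simp add: cis_mult[symmetric] mult_ac)
  also have "\<dots> = of_real a1 * (cis \<theta> * cis (- h)) + of_real a2 * (cis \<theta> * cis h)"
    unfolding polar by (simp add: ring_distribs mult_ac)
  also have "\<dots> = of_real a1 * cis \<gamma> + of_real a2 * cis \<delta>"
    unfolding cis_mult by (simp add: \<theta>_def h_def field_simps)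
  finally have "of_real r * cis (\<theta> + \<psi>) = of_real a1 * cis \<gamma> + of_real a2 * cis \<delta>" .
  moreover have "0 \<le> r" using R sq by (simp add: r_def)
  moreover have "\<gamma> \<le> \<theta> + \<psi>" "\<theta> + \<psi> \<le> \<delta>" using \<psi> by (simp_all add: \<theta>_def h_def field_simps)
  ultimately show ?thesis
    unfolding sector_def by (intro CollectI exI[of _ r] exI[of _ "\<theta> + \<psi>"]) (simp add: add.assoc)
qed

text \<open>
  The sector is first enlarged to a convex one containing the positive axis in its interior; this is possible
  because $|\alpha|, |\beta| < \pi$. Then both oblique coordinates of $s$ are almost increasing.
\<close>

lemma sectorial_increments_decomposition:
  fixes s :: "real \<Rightarrow> complex"
  assumes d: "0 < d" and ang: "0 \<le> \<beta> - \<alpha>" "\<beta> - \<alpha> < pi" "\<bar>\<alpha>\<bar> < pi" "\<bar>\<beta>\<bar> < pi"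
    and incr: "\<forall>x\<ge>0. \<forall>t\<ge>0. 0 \<le> x - t \<and> x - t \<le> d \<longrightarrow> s x - s t \<in> sector \<alpha> \<beta> z0"
  shows "\<exists>\<gamma> \<delta> m1 m2 b \<kappa> C. \<gamma> < 0 \<and> 0 < \<delta> \<and> \<delta> - \<gamma> < pi \<and> mono_on {0..} m1 \<and> mono_on {0..} m2 \<and>
    (\<forall>x\<ge>0. cmod (b x) \<le> C) \<and>
    (\<forall>x\<ge>0. s x = of_real (m1 x) * cis \<gamma> + of_real (m2 x) * cis \<delta> + b x + of_real x * \<kappa>)"
proof -
  \<comment> \<open>a quarter of the defect to \<open>\<pi>\<close> on either side leaves the opening below \<open>\<pi>\<close>\<close>
  define \<eta> where "\<eta> = (pi - (max \<beta> 0 - min \<alpha> 0)) / 4"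
  define \<gamma> where "\<gamma> = min \<alpha> 0 - \<eta>"
  define \<delta> where "\<delta> = max \<beta> 0 + \<eta>"
  have "max \<beta> 0 - min \<alpha> 0 < pi" using ang by (auto simp: max_def min_def)
  then have eta: "0 < \<eta>" "4 * \<eta> = pi - (max \<beta> 0 - min \<alpha> 0)" by (simp_all add: \<eta>_def)
  have g: "\<gamma> < 0" "\<gamma> \<le> \<alpha>" and de: "0 < \<delta>" "\<beta> \<le> \<delta>" and gd: "\<gamma> < \<delta>" "\<delta> - \<gamma> < pi"
    using eta by (simp_all add: \<gamma>_def \<delta>_def)
  define p1 where "p1 = cone_coord1 \<gamma> \<delta>"
  define p2 where "p2 = cone_coord2 \<gamma> \<delta>"
  define c where "c = \<bar>p1 z0\<bar> + \<bar>p2 z0\<bar>"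
  have c: "0 \<le> c" by (simp add: c_def)
  have p: "- c \<le> p1 (s x) - p1 (s t) \<and> - c \<le> p2 (s x) - p2 (s t)"
    if "0 \<le> t" "t \<le> x" "x \<le> t + d" for x t
  proof -
    have "s x - s t \<in> sector \<alpha> \<beta> z0" using incr that by simp
    then obtain r \<phi> where r: "0 \<le> r" "\<alpha> \<le> \<phi>" "\<phi> \<le> \<beta>" and st: "s x - s t = z0 + of_real r * cis \<phi>"
      by (auto simp: sector_def)
    have "0 \<le> p1 (of_real r * cis \<phi>)" "0 \<le> p2 (of_real r * cis \<phi>)"
      unfolding p1_def p2_def using r g de gd by (auto intro!: cone_coord_nonneg)
    moreover have "of_real r * cis \<phi> = (s x - s t) - z0" using st by simp
    ultimately have "0 \<le> p1 ((s x - s t) - z0)" "0 \<le> p2 ((s x - s t) - z0)" by simp_all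
    then have "0 \<le> p1 (s x) - p1 (s t) - p1 z0" "0 \<le> p2 (s x) - p2 (s t) - p2 z0"
      by (simp_all add: p1_def p2_def cone_coord_diff)
    then show ?thesis unfolding c_def by linarith
  qed
  obtain m1 where m1: "mono_on {0..} m1"
      "\<forall>x\<ge>0. m1 x - c \<le> p1 (s x) + (c / d) * x \<and> p1 (s x) + (c / d) * x \<le> m1 x"
    using almost_increasing_decomposition[OF c d, of "\<lambda>x. p1 (s x)"] p by auto
  obtain m2 where m2: "mono_on {0..} m2"
      "\<forall>x\<ge>0. m2 x - c \<le> p2 (s x) + (c / d) * x \<and> p2 (s x) + (c / d) * x \<le> m2 x"
    using almost_increasing_decomposition[OF c d, of "\<lambda>x. p2 (s x)"] p by auto
  define b1 where "b1 x = p1 (s x) + (c / d) * x - m1 x" for x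
  define b2 where "b2 x = p2 (s x) + (c / d) * x - m2 x" for x
  define b where "b x = of_real (b1 x) * cis \<gamma> + of_real (b2 x) * cis \<delta>" for x
  define \<kappa> where "\<kappa> = - of_real (c / d) * (cis \<gamma> + cis \<delta>)"
  have "cmod (b x) \<le> 2 * c" if x: "0 \<le> x" for x
  proof -
    have "\<bar>b1 x\<bar> \<le> c" "\<bar>b2 x\<bar> \<le> c"
      using m1(2)[rule_format, OF x] m2(2)[rule_format, OF x] by (auto simp: b1_def b2_def)
    moreover have "cmod (b x) \<le> \<bar>b1 x\<bar> + \<bar>b2 x\<bar>"
      unfolding b_def by (rule order_trans[OF norm_triangle_ineq]) (simp add: norm_mult)
    ultimately show ?thesis by simp
  qed
  moreover have "s x = of_real (m1 x) * cis \<gamma> + of_real (m2 x) * cis \<delta> + b x + of_real x * \<kappa>" for x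
  proof -
    have "s x = of_real (p1 (s x)) * cis \<gamma> + of_real (p2 (s x)) * cis \<delta>"
      unfolding p1_def p2_def by (rule cone_coords[OF gd])
    also have "\<dots> = of_real (m1 x) * cis \<gamma> + of_real (m2 x) * cis \<delta> + b x + of_real x * \<kappa>"
      by (simp add: b_def b1_def b2_def \<kappa>_def algebra_simps add_divide_distrib)
    finally show ?thesis .
  qed
  ultimately show ?thesis
    using g(1) de(1) gd(2) m1(1) m2(1)
    by (intro exI[of _ \<gamma>] exI[of _ \<delta>] exI[of _ m1] exI[of _ m2] exI[of _ b] exI[of _ \<kappa>]
        exI[of _ "2 * c"] conjI allI impI)
qed

section \<open>The quadratic form of the minimal operator\<close>

text \<open>
  The second mean value theorem for $\int m\,F'$, rewritten as a summation by parts with the Stieltjes integral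
  $\int F\,dm$ replaced by $(m(q)-m(p))F(c)$.
\<close>

lemma mono_segment_mean_value:
  fixes F F' m :: "real \<Rightarrow> real"
  assumes m: "mono_on {0..} m" and a: "0 \<le> p" "p \<le> q"
    and F: "\<And>a b. 0 \<le> a \<Longrightarrow> a \<le> b \<Longrightarrow> (F' has_integral (F b - F a)) {a..b}"
  shows "\<exists>c\<in>{p..q}. ((\<lambda>x. m x * F' x) has_integral (m q * F q - m p * F p - (m q - m p) * F c)) {p..q}"
proof (rule second_mean_value_theorem_full[of F' p q m])
  show "F' integrable_on {p..q}" using F[OF a] by (rule has_integral_integrable)
  show "p \<le> q" by (rule a)
  show "m x \<le> m y" if "p \<le> x" "x \<le> y" "y \<le> q" for x y
    using m that a by (auto intro: mono_onD)
  fix c assume c: "c \<in> {p..q}"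
    and int: "((\<lambda>x. m x * F' x) has_integral (m p * integral {p..c} F' + m q * integral {c..q} F')) {p..q}"
  have "integral {p..c} F' = F c - F p" "integral {c..q} F' = F q - F c"
    using F[of p c] F[of c q] c a by (auto intro: integral_unique)
  then have "m p * integral {p..c} F' + m q * integral {c..q} F' = m q * F q - m p * F p - (m q - m p) * F c"
    by (simp only:) (simp add: algebra_simps)
  with int have "((\<lambda>x. m x * F' x) has_integral (m q * F q - m p * F p - (m q - m p) * F c)) {p..q}"
    by (simp only:)
  then show ?thesis using c by (rule bexI)
qed

lemma mono_grid_mean_value:
  fixes F F' m :: "real \<Rightarrow> real"
  assumes m: "mono_on {0..} m" and a: "0 < a"
    and F: "\<And>a b. 0 \<le> a \<Longrightarrow> a \<le> b \<Longrightarrow> (F' has_integral (F b - F a)) {a..b}"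
  shows "\<exists>c. (\<forall>k. c k \<in> {real k * a..real (Suc k) * a}) \<and>
    (\<forall>N. ((\<lambda>x. m x * F' x) has_integral (m (real N * a) * F (real N * a) - m 0 * F 0
        - (\<Sum>k<N. (m (real (Suc k) * a) - m (real k * a)) * F (c k)))) {0..real N * a})"
proof -
  have "\<exists>c. c \<in> {real k * a..real (Suc k) * a} \<and> ((\<lambda>x. m x * F' x) has_integral
      (m (real (Suc k) * a) * F (real (Suc k) * a) - m (real k * a) * F (real k * a)
        - (m (real (Suc k) * a) - m (real k * a)) * F c)) {real k * a..real (Suc k) * a}" for k
    using mono_segment_mean_value[OF m _ _ F, of "real k * a" "real (Suc k) * a"] a
    by (simp add: Bex_def)
  then have "\<exists>c. \<forall>k. c k \<in> {real k * a..real (Suc k) * a} \<and> ((\<lambda>x. m x * F' x) has_integral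
      (m (real (Suc k) * a) * F (real (Suc k) * a) - m (real k * a) * F (real k * a)
        - (m (real (Suc k) * a) - m (real k * a)) * F (c k))) {real k * a..real (Suc k) * a}"
    by (intro choice allI)
  then obtain c where c: "\<forall>k. c k \<in> {real k * a..real (Suc k) * a} \<and> ((\<lambda>x. m x * F' x) has_integral
      (m (real (Suc k) * a) * F (real (Suc k) * a) - m (real k * a) * F (real k * a)
        - (m (real (Suc k) * a) - m (real k * a)) * F (c k))) {real k * a..real (Suc k) * a}"
    by (elim exE)
  have "((\<lambda>x. m x * F' x) has_integral (m (real N * a) * F (real N * a) - m 0 * F 0
        - (\<Sum>k<N. (m (real (Suc k) * a) - m (real k * a)) * F (c k)))) {0..real N * a}" for N
  proof (induction N)
    case 0
    show ?case using has_integral_refl(2)[of "\<lambda>x. m x * F' x" "0::real"] by simp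
  next
    case (Suc N)
    from has_integral_combine[OF _ _ Suc.IH c[rule_format, THEN conjunct2, of N]]
    show ?case using a by (simp add: algebra_simps)
  qed
  then show ?thesis using c by (intro exI[of _ c]) simp
qed

definition minimal_triple ::
  "(real \<Rightarrow> complex) \<Rightarrow> (real \<Rightarrow> complex) \<Rightarrow> (real \<Rightarrow> complex) \<Rightarrow> (real \<Rightarrow> complex) \<Rightarrow> bool" where
  "minimal_triple s y u w \<longleftrightarrow> square_integrable y \<and> square_integrable w \<and>
     is_differential_expression s y u w \<and> y 0 = 0 \<and> u 0 = 0 \<and>
     compact (closure {x \<in> {0..}. y x \<noteq> 0})"

lemma minimal_operator_iff:
  "(f, g) \<in> minimal_operator s \<longleftrightarrow> (\<exists>y u w. f = abs_l2 y \<and> g = abs_l2 w \<and> minimal_triple s y u w)"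
  unfolding minimal_operator_def minimal_triple_def by simp

locale sectorial_potential =
  fixes s :: "real \<Rightarrow> complex" and \<gamma> \<delta> :: real and m1 m2 :: "real \<Rightarrow> real"
    and b :: "real \<Rightarrow> complex" and \<kappa> :: complex and C :: real
  assumes s_meas: "s \<in> borel_measurable half_line"
    and angles: "\<gamma> < 0" "0 < \<delta>" "\<delta> - \<gamma> < pi"
    and mono: "mono_on {0..} m1" "mono_on {0..} m2"
    and b_bound: "\<And>x. 0 \<le> x \<Longrightarrow> cmod (b x) \<le> C"
    and s_eq: "\<And>x. 0 \<le> x \<Longrightarrow> s x = of_real (m1 x) * cis \<gamma> + of_real (m2 x) * cis \<delta> + b x + of_real x * \<kappa>"
begin

lemma s_locally_bounded:
  assumes "0 \<le> R"
  shows "\<exists>K. \<forall>x\<in>{0..R}. cmod (s x) \<le> K"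
proof (intro exI ballI)
  fix x assume x: "x \<in> {0..R}"
  have m: "\<bar>m x\<bar> \<le> \<bar>m 0\<bar> + \<bar>m R\<bar>" if "mono_on {0..} m" for m :: "real \<Rightarrow> real"
    using mono_onD[OF that, of 0 x] mono_onD[OF that, of x R] x by simp
  have "cmod (s x) \<le> \<bar>m1 x\<bar> + \<bar>m2 x\<bar> + cmod (b x) + x * cmod \<kappa>"
    unfolding s_eq[of x, simplified, OF conjunct1[OF x[simplified]]]
    by (intro norm_triangle_le add_mono) (use x in \<open>simp_all add: norm_mult\<close>)
  also have "\<dots> \<le> (\<bar>m1 0\<bar> + \<bar>m1 R\<bar>) + (\<bar>m2 0\<bar> + \<bar>m2 R\<bar>) + C + R * cmod \<kappa>"
    using x by (intro add_mono m mono b_bound mult_right_mono) auto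
  finally show "cmod (s x) \<le> (\<bar>m1 0\<bar> + \<bar>m1 R\<bar>) + (\<bar>m2 0\<bar> + \<bar>m2 R\<bar>) + C + R * cmod \<kappa>" .
qed

end

text \<open>
  An element $y$ of the domain of $L_0$ with a fixed choice of $u = y^{[1]}$ and $w = l(y)$. In this context $v$
  represents $y'$, and $F = |y|^2$ has the derivative $F'$.
\<close>

locale minimal_element = sectorial_potential +
  fixes y u w :: "real \<Rightarrow> complex"
  assumes triple: "minimal_triple s y u w"
begin

definition v :: "real \<Rightarrow> complex" where "v x = u x + s x * y x"
definition F :: "real \<Rightarrow> real" where "F x = (cmod (y x))\<^sup>2"
definition F' :: "real \<Rightarrow> real" where "F' x = 2 * Re (v x * cnj (y x))"

lemma y0: "y 0 = 0" and sqi: "square_integrable y" "square_integrable w"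
  using triple by (simp_all add: minimal_triple_def)

lemma AC: "AC_loc y" "AC_loc u"
  using triple by (simp_all add: minimal_triple_def is_differential_expression_def is_quasi_derivative_def)

lemma y_deriv: "AE x in half_line. (y has_vector_derivative v x) (at x within {0..})"
proof -
  have "AE x in half_line. \<exists>y'. (y has_vector_derivative y') (at x within {0..}) \<and> u x = y' - s x * y x"
    using triple by (simp add: minimal_triple_def is_differential_expression_def is_quasi_derivative_def)
  then show ?thesis
  proof (rule eventually_mono)
    fix x assume "\<exists>y'. (y has_vector_derivative y') (at x within {0..}) \<and> u x = y' - s x * y x"
    then obtain y' where d: "(y has_vector_derivative y') (at x within {0..})"
        and e: "u x = y' - s x * y x"
      by (elim exE conjE)
    have y': "v x = y'" unfolding v_def e by simp
    show "(y has_vector_derivative v x) (at x within {0..})"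
      unfolding y' by (rule d)
  qed
qed

lemma u_deriv: "AE x in half_line. (u has_vector_derivative (- w x - s x * u x - (s x)\<^sup>2 * y x)) (at x within {0..})"
proof -
  have "AE x in half_line. \<exists>u'. (u has_vector_derivative u') (at x within {0..}) \<and>
        w x = - u' - s x * u x - (s x)\<^sup>2 * y x"
    using triple by (simp add: minimal_triple_def is_differential_expression_def)
  then show ?thesis
  proof (rule eventually_mono)
    fix x assume "\<exists>u'. (u has_vector_derivative u') (at x within {0..}) \<and>
        w x = - u' - s x * u x - (s x)\<^sup>2 * y x"
    then obtain u' where d: "(u has_vector_derivative u') (at x within {0..})"
        and e: "w x = - u' - s x * u x - (s x)\<^sup>2 * y x"
      by (elim exE conjE)
    have u': "- w x - s x * u x - (s x)\<^sup>2 * y x = u'" unfolding e by simp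
    show "(u has_vector_derivative (- w x - s x * u x - (s x)\<^sup>2 * y x)) (at x within {0..})"
      unfolding u' by (rule d)
  qed
qed

lemma F0: "F 0 = 0" by (simp add: F_def y0)

lemma F_nonneg: "0 \<le> F x" by (simp add: F_def)

lemma support: "\<exists>X. \<forall>x\<ge>X. y x = 0"
proof -
  have "bounded (closure {x \<in> {0..}. y x \<noteq> 0})"
    using triple by (simp add: minimal_triple_def compact_imp_bounded)
  then obtain X where X: "\<forall>x\<in>closure {x \<in> {0..}. y x \<noteq> 0}. norm x \<le> X"
    unfolding bounded_iff by (elim exE)
  show ?thesis
  proof (intro exI[of _ "\<bar>X\<bar> + 1"] allI impI, rule ccontr)
    fix x assume x: "\<bar>X\<bar> + 1 \<le> x" "y x \<noteq> 0"
    then have "x \<in> {x \<in> {0..}. y x \<noteq> 0}" by simp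
    then have "norm x \<le> X" using X closure_subset[of "{x \<in> {0..}. y x \<noteq> 0}"] by (meson subsetD)
    then show False using x by simp
  qed
qed

lemma yy_has_integral:
  assumes "0 \<le> p" "p \<le> q"
  shows "(F' has_integral (F q - F p)) {p..q}"
proof -
  have "AE x in half_line. ((\<lambda>x. y x * cnj (y x)) has_vector_derivative (of_real (F' x))) (at x within {0..})"
    using y_deriv
  proof (rule eventually_mono)
    fix x assume d: "(y has_vector_derivative v x) (at x within {0..})"
    have "((\<lambda>x. y x * cnj (y x)) has_vector_derivative (y x * cnj (v x) + v x * cnj (y x))) (at x within {0..})"
      by (intro has_vector_derivative_mult d bounded_linear.has_vector_derivative[OF bounded_linear_cnj d])
    moreover have "y x * cnj (v x) + v x * cnj (y x) = of_real (F' x)"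
      by (simp add: F'_def complex_eq_iff algebra_simps)
    ultimately show "((\<lambda>x. y x * cnj (y x)) has_vector_derivative (of_real (F' x))) (at x within {0..})" by simp
  qed
  from AC_loc_has_integral[OF AC_loc_mult[OF AC(1) AC_loc_cnj[OF AC(1)]] this assms]
  have "((\<lambda>x. complex_of_real (F' x)) has_integral (y q * cnj (y q) - y p * cnj (y p))) {p..q}" .
  from has_integral_linear[OF this bounded_linear_Re]
  have "(F' has_integral Re (y q * cnj (y q) - y p * cnj (y p))) {p..q}" by (simp add: o_def)
  then show ?thesis
    by (simp add: F_def complex_mult_cnj cmod_power2)
qed

lemma xF_has_integral:
  assumes "0 \<le> R" "y R = 0"
  shows "((\<lambda>x. x * F' x + F x) has_integral 0) {0..R}"
proof -
  have "AE x in half_line. ((\<lambda>x. of_real x * (y x * cnj (y x))) has_vector_derivative (of_real (x * F' x + F x))) (at x within {0..})"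
    using y_deriv
  proof (rule eventually_mono)
    fix x assume d: "(y has_vector_derivative v x) (at x within {0..})"
    have "((\<lambda>x. of_real x * (y x * cnj (y x))) has_vector_derivative
        (of_real x * (y x * cnj (v x) + v x * cnj (y x)) + of_real 1 * (y x * cnj (y x)))) (at x within {0..})"
      by (intro has_vector_derivative_mult d bounded_linear.has_vector_derivative[OF bounded_linear_cnj d]
          has_vector_derivative_of_real DERIV_ident)
    moreover have "of_real x * (y x * cnj (v x) + v x * cnj (y x)) + of_real 1 * (y x * cnj (y x)) = of_real (x * F' x + F x)"
    proof -
      have "y x * cnj (y x) = of_real (F x)" unfolding F_def complex_norm_square by (rule refl)
      moreover have "y x * cnj (v x) + v x * cnj (y x) = of_real (F' x)"
        by (simp add: F'_def complex_eq_iff algebra_simps)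
      ultimately show ?thesis by (simp only:) simp
    qed
    ultimately show "((\<lambda>x. of_real x * (y x * cnj (y x))) has_vector_derivative (of_real (x * F' x + F x))) (at x within {0..})"
      by simp
  qed
  from AC_loc_has_integral[OF AC_loc_mult[OF AC_loc_of_real AC_loc_mult[OF AC(1) AC_loc_cnj[OF AC(1)]]] this order_refl assms(1)]
  have "((\<lambda>x. complex_of_real (x * F' x + F x)) has_integral 0) {0..R}" using assms by simp
  from has_integral_linear[OF this bounded_linear_Re] show ?thesis by (simp add: o_def)
qed

text \<open>
  The integral of $(y^{[1]}\bar y)'$ vanishes; substituting $y^{[1]} = v - sy$ makes all terms with $s^2$ cancel.
\<close>

lemma wy_has_integral:
  assumes "0 \<le> R" "y R = 0"
  shows "((\<lambda>x. w x * cnj (y x) - (of_real ((cmod (v x))\<^sup>2) - s x * of_real (F' x))) has_integral 0) {0..R}"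
proof -
  have "AE x in half_line. ((\<lambda>x. u x * cnj (y x)) has_vector_derivative
      - (w x * cnj (y x) - (of_real ((cmod (v x))\<^sup>2) - s x * of_real (F' x)))) (at x within {0..})"
    using eventually_conj[OF y_deriv u_deriv]
  proof (rule eventually_mono, elim conjE)
    fix x assume d: "(y has_vector_derivative v x) (at x within {0..})"
      and du: "(u has_vector_derivative (- w x - s x * u x - (s x)\<^sup>2 * y x)) (at x within {0..})"
    have "((\<lambda>x. u x * cnj (y x)) has_vector_derivative
        (u x * cnj (v x) + (- w x - s x * u x - (s x)\<^sup>2 * y x) * cnj (y x))) (at x within {0..})"
      by (intro has_vector_derivative_mult du bounded_linear.has_vector_derivative[OF bounded_linear_cnj d])
    moreover have "u x * cnj (v x) + (- w x - s x * u x - (s x)\<^sup>2 * y x) * cnj (y x)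
        = - (w x * cnj (y x) - (of_real ((cmod (v x))\<^sup>2) - s x * of_real (F' x)))"
    proof -
      have ux: "u x = v x - s x * y x" by (simp add: v_def)
      have "of_real (F' x) = y x * cnj (v x) + v x * cnj (y x)"
        by (simp add: F'_def complex_eq_iff algebra_simps)
      then show ?thesis
        unfolding ux complex_norm_square by (simp add: power2_eq_square algebra_simps)
    qed
    ultimately show "((\<lambda>x. u x * cnj (y x)) has_vector_derivative
      - (w x * cnj (y x) - (of_real ((cmod (v x))\<^sup>2) - s x * of_real (F' x)))) (at x within {0..})" by simp
  qed
  from AC_loc_has_integral[OF AC_loc_mult[OF AC(2) AC_loc_cnj[OF AC(1)]] this order_refl assms(1)]
  have "((\<lambda>x. - (w x * cnj (y x) - (of_real ((cmod (v x))\<^sup>2) - s x * of_real (F' x)))) has_integral 0) {0..R}"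
    using assms y0 by simp
  from has_integral_neg[OF this] show ?thesis by simp
qed

end

lemma half_line_integral_on_support:
  fixes f :: "real \<Rightarrow> 'b::euclidean_space"
  assumes f: "integrable half_line f" and R: "\<And>x. R < x \<Longrightarrow> f x = 0"
  shows "(f has_integral (LINT x|half_line. f x)) {0..R}"
proof -
  have "(f has_integral (LINT x|half_line. f x)) {0..}"
    using f by (rule has_integral_integral_lebesgue_on) simp
  then have "((\<lambda>x. if x \<in> {0..R} then f x else 0) has_integral (LINT x|half_line. f x)) {0..}"
    by (rule has_integral_eq[rotated]) (use R in auto)
  then show ?thesis by (subst (asm) has_integral_restrict) auto
qed

context minimal_element
begin

text \<open>
  The three parts of the form: $A$ is the kinetic energy, \<open>B m\<close> is the Stieltjes integral of $|y|^2$ against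
  the increasing function $m$, written after integration by parts so that only $(|y|^2)'$ occurs, and $n$ is the
  square of the norm.
\<close>

definition A :: "real \<Rightarrow> real" where "A R = integral {0..R} (\<lambda>x. (cmod (v x))\<^sup>2)"
definition B :: "(real \<Rightarrow> real) \<Rightarrow> real \<Rightarrow> real" where "B m R = - integral {0..R} (\<lambda>x. m x * F' x)"
definition n :: real where "n = (norm (abs_l2 y))\<^sup>2"

lemma measurable_on_segment:
  "y \<in> borel_measurable (lebesgue_on {0..R})" "s \<in> borel_measurable (lebesgue_on {0..R})"
  "v \<in> borel_measurable (lebesgue_on {0..R})" "F' \<in> borel_measurable (lebesgue_on {0..R})"
proof -
  have cont: "h \<in> borel_measurable (lebesgue_on {0..R})" if "AC_loc h" for h
    by (rule continuous_imp_measurable_on_sets_lebesgue)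
      (auto intro: continuous_on_subset[OF AC_loc_continuous_on[OF that]])
  show y[measurable]: "y \<in> borel_measurable (lebesgue_on {0..R})" by (rule cont[OF AC(1)])
  have u[measurable]: "u \<in> borel_measurable (lebesgue_on {0..R})" by (rule cont[OF AC(2)])
  show s[measurable]: "s \<in> borel_measurable (lebesgue_on {0..R})"
    by (rule measurable_restrict_mono[OF s_meas]) auto
  show v[measurable]: "v \<in> borel_measurable (lebesgue_on {0..R})"
    unfolding v_def by measurable
  have "F' x = (cmod (v x + y x))\<^sup>2 - (cmod (v x))\<^sup>2 - (cmod (y x))\<^sup>2" for x
    unfolding F'_def cmod_power2 by (simp add: power2_eq_square algebra_simps)
  then have "F' = (\<lambda>x. (cmod (v x + y x))\<^sup>2 - (cmod (v x))\<^sup>2 - (cmod (y x))\<^sup>2)" by (rule ext)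
  then show "F' \<in> borel_measurable (lebesgue_on {0..R})" by (simp only:) measurable
qed

lemma F'_bound: "\<bar>F' x\<bar> \<le> 2 * (cmod (v x) * cmod (y x))"
  using abs_Re_le_cmod[of "v x * cnj (y x)"] by (simp add: F'_def norm_mult abs_mult)

lemma bounds_on_segment:
  assumes "0 \<le> R"
  shows "\<exists>K\<ge>0. \<forall>x\<in>{0..R}. cmod (s x) \<le> K \<and> cmod (v x) \<le> K \<and> \<bar>F' x\<bar> \<le> K"
proof -
  obtain K1 where K1: "\<forall>x\<in>{0..R}. cmod (y x) \<le> K1" using AC_loc_bounded[OF AC(1), of R] by (elim exE conjE)
  obtain K2 where K2: "\<forall>x\<in>{0..R}. cmod (u x) \<le> K2" using AC_loc_bounded[OF AC(2), of R] by (elim exE conjE)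
  obtain K3 where K3: "\<forall>x\<in>{0..R}. cmod (s x) \<le> K3" using s_locally_bounded[OF assms] by (elim exE)
  have K0: "0 \<le> K1" "0 \<le> K2" "0 \<le> K3"
    using K1[rule_format, of 0] K2[rule_format, of 0] K3[rule_format, of 0] assms
    by (auto intro: order_trans[OF norm_ge_zero])
  define K4 where "K4 = K2 + K3 * K1"
  have K4: "cmod (v x) \<le> K4" if "x \<in> {0..R}" for x
    unfolding v_def K4_def
    by (rule order_trans[OF norm_triangle_ineq])
      (use K1 K2 K3 K0 that in \<open>auto simp: norm_mult intro!: add_mono mult_mono\<close>)
  have "0 \<le> K4" using K0 by (simp add: K4_def)
  have K5: "\<bar>F' x\<bar> \<le> 2 * (K4 * K1)" if "x \<in> {0..R}" for x
    by (rule order_trans[OF F'_bound])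
      (use K4[OF that] K1 K0 \<open>0 \<le> K4\<close> that in \<open>auto intro!: mult_mono\<close>)
  define K where "K = K3 + K4 + 2 * (K4 * K1)"
  have "K3 \<le> K" "K4 \<le> K" "2 * (K4 * K1) \<le> K" "0 \<le> K"
    using K0 \<open>0 \<le> K4\<close> by (simp_all add: K_def)
  then show ?thesis
    using K3 K4 K5 by (intro exI[of _ K] conjI ballI) (auto intro: order_trans)
qed

lemma sq_v_integrable: "(\<lambda>x. (cmod (v x))\<^sup>2) integrable_on {0..R}"
proof (cases "0 \<le> R")
  case True
  obtain K where K: "0 \<le> K" "\<forall>x\<in>{0..R}. cmod (s x) \<le> K \<and> cmod (v x) \<le> K \<and> \<bar>F' x\<bar> \<le> K"
    using bounds_on_segment[OF True] by (elim exE conjE)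
  note [measurable] = measurable_on_segment
  show ?thesis
  proof (rule bounded_measurable_integrable)
    show "(\<lambda>x. (cmod (v x))\<^sup>2) \<in> borel_measurable (lebesgue_on {0..R})" by measurable
    show "norm ((cmod (v x))\<^sup>2) \<le> K\<^sup>2" if "x \<in> {0..R}" for x
      using K that by (simp add: power_mono)
  qed
qed (simp add: integrable_on_empty)

lemma sF'_integrable:
  assumes "0 \<le> R"
  shows "(\<lambda>x. s x * of_real (F' x)) integrable_on {0..R}"
proof -
  obtain K where K: "0 \<le> K" "\<forall>x\<in>{0..R}. cmod (s x) \<le> K \<and> cmod (v x) \<le> K \<and> \<bar>F' x\<bar> \<le> K"
    using bounds_on_segment[OF assms] by (elim exE conjE)
  note [measurable] = measurable_on_segment
  show ?thesis
  proof (rule bounded_measurable_integrable)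
    show "(\<lambda>x. s x * of_real (F' x)) \<in> borel_measurable (lebesgue_on {0..R})" by measurable
    show "norm (s x * of_real (F' x)) \<le> K * K" if "x \<in> {0..R}" for x
      using K that by (simp add: norm_mult mult_mono)
  qed
qed

lemma A_nonneg: "0 \<le> A R"
  unfolding A_def by (rule integral_nonneg[OF sq_v_integrable]) simp

lemma F_has_integral:
  assumes "\<forall>x\<ge>R. y x = 0"
  shows "(F has_integral n) {0..R}"
proof -
  have "((\<lambda>x. (cmod (y x))\<^sup>2) has_integral (LINT x|half_line. (cmod (y x))\<^sup>2)) {0..R}"
    by (rule half_line_integral_on_support) (use sqi assms in \<open>simp_all add: square_integrable_def\<close>)
  then show ?thesis
    by (simp add: F_def[abs_def] n_def norm_abs_l2 sqi)
qed

lemma wy_has_integral_cinner: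
  assumes "\<forall>x\<ge>R. y x = 0"
  shows "((\<lambda>x. w x * cnj (y x)) has_integral l2_cinner (abs_l2 w) (abs_l2 y)) {0..R}"
  unfolding l2_cinner_abs[OF sqi(2,1)]
  by (rule half_line_integral_on_support[OF square_integrable_product[OF sqi(2,1)]]) (use assms in simp)

lemma mF'_has_integral:
  assumes m: "mono_on {0..} m" and R: "0 \<le> R"
  shows "((\<lambda>x. m x * F' x) has_integral - B m R) {0..R}"
proof -
  have "\<exists>c\<in>{0..R}. ((\<lambda>x. m x * F' x) has_integral (m R * F R - m 0 * F 0 - (m R - m 0) * F c)) {0..R}"
    by (rule mono_segment_mean_value[OF m order_refl R yy_has_integral])
  then obtain c where i: "((\<lambda>x. m x * F' x) has_integral (m R * F R - m 0 * F 0 - (m R - m 0) * F c)) {0..R}"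
    by (elim bexE)
  show ?thesis unfolding B_def
    using integrable_integral[OF has_integral_integrable[OF i]] by simp
qed

lemma B_nonneg:
  assumes m: "mono_on {0..} m" and R: "0 \<le> R" "y R = 0"
  shows "0 \<le> B m R"
proof -
  have "\<exists>c\<in>{0..R}. ((\<lambda>x. m x * F' x) has_integral (m R * F R - m 0 * F 0 - (m R - m 0) * F c)) {0..R}"
    by (rule mono_segment_mean_value[OF m order_refl R(1) yy_has_integral])
  then obtain c where i: "((\<lambda>x. m x * F' x) has_integral (m R * F R - m 0 * F 0 - (m R - m 0) * F c)) {0..R}"
    by (elim bexE)
  have "- B m R = m R * F R - m 0 * F 0 - (m R - m 0) * F c"
    by (rule has_integral_unique[OF mF'_has_integral[OF m R(1)] i])
  moreover have "F R = 0" using R by (simp add: F_def)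
  moreover have "0 \<le> (m R - m 0) * F c"
    using mono_onD[OF m, of 0 R] R F_nonneg by simp
  ultimately show ?thesis using F0 by simp
qed

text \<open>
  Inserting the decomposition of $s$ into $A - \int s\,F'$, the linear part contributes $\kappa\|y\|^2$ and the
  bounded part is estimated by $2C|v||y| \le \varepsilon|v|^2 + (C^2/\varepsilon)|y|^2$.
\<close>

lemma form_decomposition:
  assumes R: "0 \<le> R" "\<forall>x\<ge>R. y x = 0"
  shows "\<exists>E. l2_cinner (abs_l2 w) (abs_l2 y)
        = of_real (A R) + of_real (B m1 R) * cis \<gamma> + of_real (B m2 R) * cis \<delta> + E \<and>
      (\<forall>\<epsilon>>0. cmod E \<le> \<epsilon> * A R + (C\<^sup>2 / \<epsilon> + cmod \<kappa>) * n)"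
proof -
  have yR: "y R = 0" using R by simp
  define q where "q = l2_cinner (abs_l2 w) (abs_l2 y)"
  have re: "((\<lambda>x. complex_of_real (f x) * z) has_integral complex_of_real i * z) S"
    if "(f has_integral i) S" for f :: "real \<Rightarrow> real" and i z S
    using has_integral_linear[OF has_integral_linear[OF that bounded_linear_of_real] bounded_linear_mult_left[of z]]
    by (simp add: o_def)
  have iA: "((\<lambda>x. (cmod (v x))\<^sup>2) has_integral A R) {0..R}"
    unfolding A_def by (rule integrable_integral[OF sq_v_integrable])
  have iF: "(F has_integral n) {0..R}" using R(2) by (rule F_has_integral)
  have ixF: "((\<lambda>x. x * F' x) has_integral - n) {0..R}"
    using has_integral_diff[OF xF_has_integral[OF R(1) yR] iF] by simp
  define IS where "IS = integral {0..R} (\<lambda>x. s x * of_real (F' x))"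
  have iS: "((\<lambda>x. s x * of_real (F' x)) has_integral IS) {0..R}"
    unfolding IS_def by (rule integrable_integral[OF sF'_integrable[OF R(1)]])
  have "((\<lambda>x. w x * cnj (y x) - (w x * cnj (y x) - (of_real ((cmod (v x))\<^sup>2) - s x * of_real (F' x))))
      has_integral (q - 0)) {0..R}"
    unfolding q_def
    by (rule has_integral_diff[OF wy_has_integral_cinner[OF R(2)] wy_has_integral[OF R(1) yR]])
  then have "((\<lambda>x. of_real ((cmod (v x))\<^sup>2) - s x * of_real (F' x)) has_integral q) {0..R}" by simp
  moreover have "((\<lambda>x. of_real ((cmod (v x))\<^sup>2) - s x * of_real (F' x)) has_integral (of_real (A R) - IS)) {0..R}"
    using has_integral_diff[OF re[OF iA, of 1] iS] by simp
  ultimately have q: "q = of_real (A R) - IS" by (rule has_integral_unique)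
  define IB where "IB = IS - (of_real (- B m1 R) * cis \<gamma> + of_real (- B m2 R) * cis \<delta> + of_real (- n) * \<kappa>)"
  have "((\<lambda>x. s x * of_real (F' x) - (of_real (m1 x * F' x) * cis \<gamma> + of_real (m2 x * F' x) * cis \<delta>
        + of_real (x * F' x) * \<kappa>)) has_integral IB) {0..R}"
    unfolding IB_def
    by (intro has_integral_diff has_integral_add iS re ixF mF'_has_integral mono R(1))
  then have iB: "((\<lambda>x. b x * of_real (F' x)) has_integral IB) {0..R}"
  proof (rule has_integral_eq[rotated])
    fix x assume "x \<in> {0..R}"
    then have x: "0 \<le> x" by simp
    show "s x * of_real (F' x) - (of_real (m1 x * F' x) * cis \<gamma> + of_real (m2 x * F' x) * cis \<delta>
        + of_real (x * F' x) * \<kappa>) = b x * of_real (F' x)"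
      unfolding s_eq[OF x] by (simp add: algebra_simps)
  qed
  have n0: "0 \<le> n" by (simp add: n_def)
  have C0: "0 \<le> C" using b_bound[of 0] by (rule order_trans[OF norm_ge_zero]) simp
  have bound: "cmod IB \<le> \<epsilon> * A R + C\<^sup>2 / \<epsilon> * n" if eps: "0 < \<epsilon>" for \<epsilon>
  proof -
    have i2: "((\<lambda>x. \<epsilon> * (cmod (v x))\<^sup>2 + C\<^sup>2 / \<epsilon> * F x) has_integral (\<epsilon> * A R + C\<^sup>2 / \<epsilon> * n)) {0..R}"
      by (intro has_integral_add has_integral_mult_right iA iF)
    have "norm (integral {0..R} (\<lambda>x. b x * of_real (F' x))) \<le> integral {0..R} (\<lambda>x. \<epsilon> * (cmod (v x))\<^sup>2 + C\<^sup>2 / \<epsilon> * F x)"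
    proof (rule integral_norm_bound_integral)
      show "(\<lambda>x. b x * of_real (F' x)) integrable_on {0..R}" using iB by (rule has_integral_integrable)
      show "(\<lambda>x. \<epsilon> * (cmod (v x))\<^sup>2 + C\<^sup>2 / \<epsilon> * F x) integrable_on {0..R}" using i2 by (rule has_integral_integrable)
      fix x assume "x \<in> {0..R}"
      then have x: "0 \<le> x" by simp
      define p where "p = cmod (v x)"
      define r where "r = cmod (y x)"
      have "norm (b x * of_real (F' x)) \<le> C * (2 * (p * r))"
        unfolding norm_mult p_def r_def using b_bound[OF x] F'_bound[of x] C0
        by (intro mult_mono) simp_all
      also have "\<dots> \<le> \<epsilon> * p\<^sup>2 + C\<^sup>2 / \<epsilon> * r\<^sup>2"
      proof -
        have "0 \<le> (\<epsilon> * p - C * r)\<^sup>2" by simp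
        then have "\<epsilon> * (C * (2 * (p * r))) \<le> \<epsilon> * (\<epsilon> * p\<^sup>2 + C\<^sup>2 / \<epsilon> * r\<^sup>2)"
          using eps by (simp add: power2_eq_square algebra_simps)
        then show ?thesis using eps by (rule mult_left_le_imp_le)
      qed
      finally show "norm (b x * of_real (F' x)) \<le> \<epsilon> * (cmod (v x))\<^sup>2 + C\<^sup>2 / \<epsilon> * F x"
        by (simp add: p_def r_def F_def)
    qed
    then show ?thesis using integral_unique[OF iB] integral_unique[OF i2] by simp
  qed
  define E where "E = of_real n * \<kappa> - IB"
  have "q = of_real (A R) + of_real (B m1 R) * cis \<gamma> + of_real (B m2 R) * cis \<delta> + E"
    unfolding q E_def IB_def by simp
  moreover have "cmod E \<le> \<epsilon> * A R + (C\<^sup>2 / \<epsilon> + cmod \<kappa>) * n" if eps: "0 < \<epsilon>" for \<epsilon>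
  proof -
    have "cmod E \<le> cmod (of_real n * \<kappa>) + cmod IB" unfolding E_def by (rule norm_triangle_ineq4)
    also have "cmod (of_real n * \<kappa>) = n * cmod \<kappa>" using n0 by (simp add: norm_mult)
    finally show ?thesis using bound[OF eps] by (simp add: algebra_simps)
  qed
  ultimately show ?thesis unfolding q_def by (intro exI[of _ E]) simp
qed

text \<open>
  The Cauchy--Schwarz inequality for $y(t) - y(c) = \int_c^t v$.
\<close>

lemma v_difference_bound:
  assumes "0 \<le> p" "t \<in> {p..q}" "c \<in> {p..q}"
  shows "(cmod (y t - y c))\<^sup>2 \<le> (q - p) * integral {p..q} (\<lambda>x. (cmod (v x))\<^sup>2)"
proof -
  define I where "I = integral {p..q} (\<lambda>x. (cmod (v x))\<^sup>2)"
  have pq: "p \<le> q" using assms by simp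
  have intv: "(\<lambda>x. (cmod (v x))\<^sup>2) integrable_on {p'..q'}" if "0 \<le> p'" "q' \<le> q" for p' q'
    using sq_v_integrable[of q] by (rule integrable_on_subinterval) (use that in auto)
  have ordered: "(cmod (y t - y c))\<^sup>2 \<le> (q - p) * I" if tc: "p \<le> c" "c \<le> t" "t \<le> q" for t c
  proof -
    define h where "h = t - c"
    define z where "z = y t - y c"
    have h0: "0 \<le> h" "h \<le> q - p" using tc by (simp_all add: h_def)
    define J where "J = integral {c..t} (\<lambda>x. (cmod (v x))\<^sup>2)"
    have iJ: "((\<lambda>x. (cmod (v x))\<^sup>2) has_integral J) {c..t}"
      unfolding J_def by (rule integrable_integral) (use intv assms tc in auto)
    have JI: "J \<le> I"
      unfolding J_def I_def by (rule integral_subset_le) (use intv assms tc in auto)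
    have "(v has_integral z) {c..t}"
      unfolding z_def by (rule AC_loc_has_integral[OF AC(1) y_deriv]) (use assms tc in auto)
    from has_integral_linear[OF has_integral_linear[OF this bounded_linear_mult_right[of "cnj z"]] bounded_linear_Re]
    have iz: "((\<lambda>x. Re (cnj z * v x)) has_integral (cmod z)\<^sup>2) {c..t}"
      unfolding o_def cmod_power2 by (simp add: power2_eq_square)
    \<comment> \<open>Cauchy--Schwarz in the form \<open>0 \<le> |h v - z|\<^sup>2\<close>, integrated over the segment\<close>
    have I1: "((\<lambda>x. h\<^sup>2 * (cmod (v x))\<^sup>2 - 2 * h * Re (cnj z * v x) + (cmod z)\<^sup>2) has_integral
        (h\<^sup>2 * J - 2 * h * (cmod z)\<^sup>2 + (t - c) *\<^sub>R (cmod z)\<^sup>2)) {c..t}"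
      by (intro has_integral_add has_integral_diff has_integral_mult_right iJ iz)
        (use has_integral_const_real[of "(cmod z)\<^sup>2" c t] tc in simp)
    have I2: "h\<^sup>2 * (cmod (v x))\<^sup>2 - 2 * h * Re (cnj z * v x) + (cmod z)\<^sup>2 = (cmod (of_real h * v x - z))\<^sup>2" for x
      unfolding cmod_power2 by (simp add: power2_eq_square algebra_simps)
    have I3: "h\<^sup>2 * J - 2 * h * (cmod z)\<^sup>2 + (t - c) *\<^sub>R (cmod z)\<^sup>2 = h\<^sup>2 * J - h * (cmod z)\<^sup>2"
      by (simp add: h_def algebra_simps)
    from I1 have "((\<lambda>x. (cmod (of_real h * v x - z))\<^sup>2) has_integral (h\<^sup>2 * J - h * (cmod z)\<^sup>2)) {c..t}"
      by (simp only: I2 I3)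
    then have "0 \<le> h\<^sup>2 * J - h * (cmod z)\<^sup>2" by (rule has_integral_nonneg) simp
    then have "h * (cmod z)\<^sup>2 \<le> h * (h * J)" by (simp add: power2_eq_square algebra_simps)
    have J0: "0 \<le> J" using iJ by (rule has_integral_nonneg) simp
    have "(cmod z)\<^sup>2 \<le> h * J"
    proof (cases "h = 0")
      case True
      then have "t = c" by (simp add: h_def)
      then show ?thesis using True by (simp add: z_def)
    next
      case False
      then have "0 < h" using h0 by simp
      then show ?thesis using \<open>h * (cmod z)\<^sup>2 \<le> h * (h * J)\<close> by simp
    qed
    also have "\<dots> \<le> (q - p) * I" using h0 J0 JI by (intro mult_mono) auto
    finally show ?thesis by (simp add: z_def)
  qed
  show ?thesis
  proof (cases "c \<le> t")
    case True
    then show ?thesis using ordered[of c t] assms by (simp add: I_def)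
  next
    case False
    then show ?thesis using ordered[of t c] assms by (simp add: I_def norm_minus_commute)
  qed
qed

end

lemma integral_grid_sum:
  fixes f :: "real \<Rightarrow> real"
  assumes a: "0 < a" and f: "\<And>R. f integrable_on {0..R}"
  shows "integral {0..real N * a} f = (\<Sum>k<N. integral {real k * a..real (Suc k) * a} f)"
proof (induction N)
  case (Suc N)
  have "integral {0..real N * a} f + integral {real N * a..real (Suc N) * a} f = integral {0..real (Suc N) * a} f"
    by (rule Henstock_Kurzweil_Integration.integral_combine) (use a f in \<open>auto intro: mult_right_mono\<close>)
  then show ?case using Suc.IH by simp
qed simp

context sectorial_potential
begin

text \<open>
  The constants of the two estimates of the form: \<open>aperture\<close> is the largest $\varepsilon$ for which an error of
  size $\varepsilon A$ keeps $A$ in the sector, and \<open>vertex\<close> absorbs the remaining multiple of $\|y\|^2$;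
  \<open>axis\<close> is the direction $\theta$ of the bisector, and \<open>shift\<close> is the $\tau$ that makes the rotated
  form coercive.
\<close>

definition aperture :: real where "aperture = min (sin \<delta>) (- sin \<gamma>)"
definition vertex :: complex where
  "vertex = - of_real ((C\<^sup>2 / aperture + cmod \<kappa>) / aperture)"

definition axis :: real where "axis = (\<gamma> + \<delta>) / 2"
definition axis_cos :: real where "axis_cos = min (cos axis) (cos ((\<delta> - \<gamma>) / 2))"
definition shift :: real where
  "shift = (C\<^sup>2 / (axis_cos / 2) + cmod \<kappa> + 1) / cos axis"
definition coercivity :: real where "coercivity = min (axis_cos / 2) 1"

lemma aperture_pos: "0 < aperture"
proof -
  have "0 < sin \<delta>" using angles by (intro sin_gt_zero) auto
  moreover have "0 < sin (- \<gamma>)" using angles by (intro sin_gt_zero) auto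
  ultimately show ?thesis by (simp add: aperture_def)
qed

lemma axis_cos_pos: "0 < axis_cos" "0 < cos axis"
proof -
  show "0 < cos axis" using angles by (intro cos_gt_zero_pi) (simp_all add: axis_def field_simps)
  moreover have "0 < cos ((\<delta> - \<gamma>) / 2)" using angles by (intro cos_gt_zero_pi) simp_all
  ultimately show "0 < axis_cos" by (simp add: axis_cos_def)
qed

lemma coercivity_pos: "0 < coercivity"
  using axis_cos_pos by (simp add: coercivity_def)

end

context minimal_element
begin

lemma n_nonneg: "0 \<le> n" by (simp add: n_def)

lemma support_nonneg: "\<exists>R\<ge>0. \<forall>x\<ge>R. y x = 0"
proof -
  obtain X where X: "\<forall>x\<ge>X. y x = 0" using support by (elim exE)
  show ?thesis by (rule exI[of _ "\<bar>X\<bar>"]) (use X in simp)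
qed

text \<open>
  Both oblique coordinates of the value of the form relative to the vertex are nonnegative: those of $A$
  outweigh the error, and $B_1, B_2$ are themselves the coordinates of their terms.
\<close>

lemma cinner_in_sector:
  assumes n1: "n = 1"
  shows "l2_cinner (abs_l2 w) (abs_l2 y) \<in> sector \<gamma> \<delta> vertex"
proof -
  obtain R where R0: "0 \<le> R" and R: "\<forall>x\<ge>R. y x = 0" using support_nonneg by (elim exE conjE)
  obtain E where q: "l2_cinner (abs_l2 w) (abs_l2 y)
        = of_real (A R) + of_real (B m1 R) * cis \<gamma> + of_real (B m2 R) * cis \<delta> + E"
    and E: "\<forall>\<epsilon>>0. cmod E \<le> \<epsilon> * A R + (C\<^sup>2 / \<epsilon> + cmod \<kappa>) * n"
    using form_decomposition[OF R0 R] by (elim exE conjE)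
  define K where "K = C\<^sup>2 / aperture + cmod \<kappa>"
  define t where "t = K / aperture"
  have K0: "0 \<le> K" using aperture_pos by (simp add: K_def)
  have t: "0 \<le> t" "t * aperture = K" using aperture_pos K0 by (simp_all add: t_def)
  have vert: "vertex = - of_real t" by (simp add: vertex_def t_def K_def)
  have Eb: "cmod E \<le> aperture * A R + K"
    using E aperture_pos n1 by (simp add: K_def)
  define D where "D = of_real (A R) + E + of_real t"
  have gd: "\<gamma> < \<delta>" "\<delta> - \<gamma> < pi" using angles by simp_all
  have S: "0 < sin (\<delta> - \<gamma>)" using gd by (intro sin_gt_zero) auto
  have At: "0 \<le> A R + t" using A_nonneg t by simp
  have "0 \<le> cone_coord1 \<gamma> \<delta> D"
  proof -
    have "Re E * sin \<delta> - Im E * cos \<delta> = - Im (E * cis (- \<delta>))" by (simp add: algebra_simps)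
    also have "\<dots> \<ge> - cmod E"
      using abs_Im_le_cmod[of "E * cis (- \<delta>)"] by (simp add: norm_mult)
    finally have 1: "- cmod E \<le> Re E * sin \<delta> - Im E * cos \<delta>" .
    have 2: "(A R + t) * aperture \<le> (A R + t) * sin \<delta>"
      using At by (intro mult_left_mono) (simp_all add: aperture_def)
    have "Re D * sin \<delta> - Im D * cos \<delta> = (A R + t) * sin \<delta> + (Re E * sin \<delta> - Im E * cos \<delta>)"
      by (simp add: D_def algebra_simps)
    moreover have "(A R + t) * aperture = aperture * A R + K" using t by (simp add: algebra_simps)
    ultimately have "0 \<le> Re D * sin \<delta> - Im D * cos \<delta>" using 1 2 Eb by linarith
    then show ?thesis using S by (simp add: cone_coord1_def)
  qed
  moreover have "0 \<le> cone_coord2 \<gamma> \<delta> D"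
  proof -
    have "Im E * cos \<gamma> - Re E * sin \<gamma> = Im (E * cis (- \<gamma>))" by (simp add: algebra_simps)
    also have "\<dots> \<ge> - cmod E"
      using abs_Im_le_cmod[of "E * cis (- \<gamma>)"] by (simp add: norm_mult)
    finally have 1: "- cmod E \<le> Im E * cos \<gamma> - Re E * sin \<gamma>" .
    have 2: "(A R + t) * aperture \<le> (A R + t) * (- sin \<gamma>)"
      using At by (intro mult_left_mono) (simp_all add: aperture_def)
    have "Im D * cos \<gamma> - Re D * sin \<gamma> = (A R + t) * (- sin \<gamma>) + (Im E * cos \<gamma> - Re E * sin \<gamma>)"
      by (simp add: D_def algebra_simps)
    moreover have "(A R + t) * aperture = aperture * A R + K" using t by (simp add: algebra_simps)
    ultimately have "0 \<le> Im D * cos \<gamma> - Re D * sin \<gamma>" using 1 2 Eb by linarith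
    then show ?thesis using S by (simp add: cone_coord2_def)
  qed
  ultimately have
    "vertex + of_real (B m1 R + cone_coord1 \<gamma> \<delta> D) * cis \<gamma> + of_real (B m2 R + cone_coord2 \<gamma> \<delta> D) * cis \<delta>
      \<in> sector \<gamma> \<delta> vertex"
    using B_nonneg[OF mono(1) R0] B_nonneg[OF mono(2) R0] R gd by (intro cone_subset_sector) auto
  moreover have "vertex + of_real (B m1 R + cone_coord1 \<gamma> \<delta> D) * cis \<gamma> + of_real (B m2 R + cone_coord2 \<gamma> \<delta> D) * cis \<delta>
      = vertex + of_real (B m1 R) * cis \<gamma> + of_real (B m2 R) * cis \<delta>
        + (of_real (cone_coord1 \<gamma> \<delta> D) * cis \<gamma> + of_real (cone_coord2 \<gamma> \<delta> D) * cis \<delta>)"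
    by (simp add: algebra_simps)
  moreover have "of_real (cone_coord1 \<gamma> \<delta> D) * cis \<gamma> + of_real (cone_coord2 \<gamma> \<delta> D) * cis \<delta> = D"
    using cone_coords[OF gd, of D] by simp
  moreover have "vertex + of_real (B m1 R) * cis \<gamma> + of_real (B m2 R) * cis \<delta> + D = l2_cinner (abs_l2 w) (abs_l2 y)"
    unfolding q by (simp add: D_def vert)
  ultimately show ?thesis by (simp only:)
qed

lemma form_coercive:
  assumes R: "0 \<le> R" "\<forall>x\<ge>R. y x = 0"
  shows "coercivity * (A R + B m1 R + B m2 R + n)
    \<le> Re (cis (- axis) * (l2_cinner (abs_l2 w) (abs_l2 y) + of_real (shift * n)))"
proof -
  obtain E where q: "l2_cinner (abs_l2 w) (abs_l2 y)
        = of_real (A R) + of_real (B m1 R) * cis \<gamma> + of_real (B m2 R) * cis \<delta> + E"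
    and E: "\<forall>\<epsilon>>0. cmod E \<le> \<epsilon> * A R + (C\<^sup>2 / \<epsilon> + cmod \<kappa>) * n"
    using form_decomposition[OF R] by (elim exE conjE)
  define K where "K = C\<^sup>2 / (axis_cos / 2) + cmod \<kappa>"
  have Eb: "cmod E \<le> axis_cos / 2 * A R + K * n"
    unfolding K_def by (rule E[rule_format]) (use axis_cos_pos in simp)
  have B: "0 \<le> B m1 R" "0 \<le> B m2 R" using R mono by (auto intro!: B_nonneg)
  have e: "\<gamma> - axis = - ((\<delta> - \<gamma>) / 2)" "\<delta> - axis = (\<delta> - \<gamma>) / 2"
    by (simp_all add: axis_def field_simps)
  have ang: "cos (\<gamma> - axis) = cos ((\<delta> - \<gamma>) / 2)" "cos (\<delta> - axis) = cos ((\<delta> - \<gamma>) / 2)"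
    unfolding e by (rule cos_minus, rule refl)
  have re: "Re (cis (- axis) * (of_real r * cis \<phi>)) = r * cos (\<phi> - axis)" for r \<phi>
    by (simp add: cos_diff algebra_simps)
  have "cis (- axis) * (l2_cinner (abs_l2 w) (abs_l2 y) + of_real (shift * n))
    = cis (- axis) * (of_real (A R + shift * n) * cis 0) + cis (- axis) * (of_real (B m1 R) * cis \<gamma>)
      + cis (- axis) * (of_real (B m2 R) * cis \<delta>) + cis (- axis) * E"
    unfolding q by (simp add: algebra_simps)
  then have main: "Re (cis (- axis) * (l2_cinner (abs_l2 w) (abs_l2 y) + of_real (shift * n)))
    = (A R + shift * n) * cos axis + B m1 R * cos ((\<delta> - \<gamma>) / 2) + B m2 R * cos ((\<delta> - \<gamma>) / 2)
      + Re (cis (- axis) * E)"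
    by (simp only: plus_complex.sel re ang) simp
  have "- cmod E \<le> Re (cis (- axis) * E)"
    using abs_Re_le_cmod[of "cis (- axis) * E"] by (simp add: norm_mult)
  moreover have "A R * axis_cos \<le> A R * cos axis" "B m1 R * axis_cos \<le> B m1 R * cos ((\<delta> - \<gamma>) / 2)"
    "B m2 R * axis_cos \<le> B m2 R * cos ((\<delta> - \<gamma>) / 2)"
    using B A_nonneg by (intro mult_left_mono; simp add: axis_cos_def)+
  moreover have "shift * n * cos axis = (K + 1) * n"
    using axis_cos_pos by (simp add: shift_def K_def)
  ultimately have low: "axis_cos / 2 * A R + axis_cos * B m1 R + axis_cos * B m2 R + n
      \<le> Re (cis (- axis) * (l2_cinner (abs_l2 w) (abs_l2 y) + of_real (shift * n)))"
    unfolding main using Eb by (simp add: algebra_simps)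
  have "coercivity * A R \<le> axis_cos / 2 * A R" "coercivity * B m1 R \<le> axis_cos * B m1 R"
    "coercivity * B m2 R \<le> axis_cos * B m2 R" "coercivity * n \<le> 1 * n"
    using B A_nonneg n_nonneg axis_cos_pos by (intro mult_right_mono; simp add: coercivity_def min_def)+
  then show ?thesis using low by (simp add: distrib_left)
qed

text \<open>
  From $|y(x)|^2 = \int_0^x (|y|^2)' \le \int_0^x (|v|^2 + |y|^2)$.
\<close>

lemma F_le_energy:
  assumes x: "0 \<le> x" "x \<le> R" and R: "\<forall>x\<ge>R. y x = 0"
  shows "F x \<le> A R + n"
proof -
  have iF: "(F has_integral n) {0..R}" using R by (rule F_has_integral)
  have iA: "((\<lambda>x. (cmod (v x))\<^sup>2) has_integral A R) {0..R}"
    unfolding A_def by (rule integrable_integral[OF sq_v_integrable])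
  have i: "((\<lambda>x. (cmod (v x))\<^sup>2 + F x) has_integral (A R + n)) {0..R}"
    by (rule has_integral_add[OF iA iF])
  then have int: "(\<lambda>x. (cmod (v x))\<^sup>2 + F x) integrable_on {0..R}" by (rule has_integral_integrable)
  then have int': "(\<lambda>x. (cmod (v x))\<^sup>2 + F x) integrable_on {0..x}"
    by (rule integrable_on_subinterval) (use x in auto)
  have "F x - F 0 = integral {0..x} F'"
    using yy_has_integral[OF order_refl x(1)] by (rule integral_unique[symmetric])
  also have "\<dots> \<le> integral {0..x} (\<lambda>x. (cmod (v x))\<^sup>2 + F x)"
  proof (rule integral_le)
    show "F' integrable_on {0..x}"
      using yy_has_integral[OF order_refl x(1)] by (rule has_integral_integrable)
    show "F' t \<le> (cmod (v t))\<^sup>2 + F t" for t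
    proof -
      have "F' t \<le> 2 * (cmod (v t) * cmod (y t))" using F'_bound[of t] by simp
      also have "\<dots> \<le> (cmod (v t))\<^sup>2 + F t"
        using sum_squares_bound[of "cmod (v t)" "cmod (y t)"] by (simp add: F_def mult.assoc)
      finally show ?thesis .
    qed
  qed (rule int')
  also have "\<dots> \<le> integral {0..R} (\<lambda>x. (cmod (v x))\<^sup>2 + F x)"
    by (rule integral_subset_le[OF _ int' int]) (use x F_nonneg in auto)
  also have "\<dots> = A R + n" using i by (rule integral_unique)
  finally show ?thesis by (simp add: F0)
qed

text \<open>
  On the $k$-th segment $|y|^2 \le 2|y(e)|^2 + 2a\int|v|^2$ for every point $e$ of the segment. For $k < N$ the
  left end is chosen; for $k \ge N$ the point provided by the mean value theorem, where the increment of
  $m_1+m_2$, which is at least $\mu$, times $|y(e)|^2$ is one summand of $B_1 + B_2$.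
\<close>

lemma grid_estimate:
  assumes a: "0 < a" and \<mu>: "0 < \<mu>"
    and incr: "\<And>k. N \<le> k \<Longrightarrow> \<mu> \<le> (m1 (real (Suc k) * a) + m2 (real (Suc k) * a)) - (m1 (real k * a) + m2 (real k * a))"
  shows "\<exists>R\<ge>0. (\<forall>x\<ge>R. y x = 0) \<and>
    n \<le> 2 * a * (\<Sum>k<N. F (real k * a)) + (2 * a\<^sup>2 + 2 * a / \<mu>) * (A R + B m1 R + B m2 R + n)"
proof -
  define m where "m x = m1 x + m2 x" for x
  have m: "mono_on {0..} m"
    unfolding m_def using mono by (auto simp: mono_on_def intro: add_mono)
  obtain X where X0: "0 \<le> X" and X: "\<forall>x\<ge>X. y x = 0" using support_nonneg by (elim exE conjE)
  obtain M0 :: nat where M0: "X / a < real M0" using reals_Archimedean2 by (rule exE)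
  define M where "M = max M0 N"
  have MN: "N \<le> M" by (simp add: M_def)
  have "X < real M0 * a" using M0 a by (simp add: field_simps)
  also have "\<dots> \<le> real M * a" using a by (intro mult_right_mono) (simp_all add: M_def)
  finally have XM: "X < real M * a" .
  define R where "R = real M * a"
  have R0: "0 \<le> R" using a by (simp add: R_def)
  have yR: "\<forall>x\<ge>R. y x = 0" using X XM by (simp add: R_def)
  have "\<exists>c. (\<forall>k. c k \<in> {real k * a..real (Suc k) * a}) \<and>
    (\<forall>N. ((\<lambda>x. m x * F' x) has_integral (m (real N * a) * F (real N * a) - m 0 * F 0
        - (\<Sum>k<N. (m (real (Suc k) * a) - m (real k * a)) * F (c k)))) {0..real N * a})"
    by (rule mono_grid_mean_value[OF m a yy_has_integral])
  then obtain c where c: "\<forall>k. c k \<in> {real k * a..real (Suc k) * a}"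
    and ci: "\<forall>N. ((\<lambda>x. m x * F' x) has_integral (m (real N * a) * F (real N * a) - m 0 * F 0
        - (\<Sum>k<N. (m (real (Suc k) * a) - m (real k * a)) * F (c k)))) {0..real N * a}"
    by (elim exE conjE)
  define D where "D k = (m (real (Suc k) * a) - m (real k * a)) * F (c k)" for k
  have step: "real k * a \<le> real (Suc k) * a" "0 \<le> real k * a" for k
    using a by (auto intro: mult_right_mono)
  have D0: "0 \<le> D k" for k
    unfolding D_def using step[of k] step[of "Suc k"] F_nonneg mono_onD[OF m, of "real k * a" "real (Suc k) * a"]
    by (intro mult_nonneg_nonneg) auto
  have "((\<lambda>x. m x * F' x) has_integral - (\<Sum>k<M. D k)) {0..R}"
    using ci[rule_format, of M] yR[rule_format, of R] unfolding D_def R_def by (simp add: F0 F_def[of "real M * a"])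
  moreover have "((\<lambda>x. m x * F' x) has_integral (- B m1 R + - B m2 R)) {0..R}"
    using has_integral_add[OF mF'_has_integral[OF mono(1) R0] mF'_has_integral[OF mono(2) R0]]
    by (simp add: m_def distrib_right)
  ultimately have "- (\<Sum>k<M. D k) = - B m1 R + - B m2 R" by (rule has_integral_unique)
  then have sumD: "(\<Sum>k<M. D k) = B m1 R + B m2 R" by simp
  define I where "I k = integral {real k * a..real (Suc k) * a} F" for k
  define J where "J k = integral {real k * a..real (Suc k) * a} (\<lambda>x. (cmod (v x))\<^sup>2)" for k
  have sumJ: "(\<Sum>k<M. J k) = A R"
    unfolding J_def A_def R_def by (rule integral_grid_sum[OF a sq_v_integrable, symmetric])
  have contF: "continuous_on {0..} F"
    unfolding F_def[abs_def] by (intro continuous_intros AC_loc_continuous_on AC)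
  have intF: "F integrable_on {p..q}" if "0 \<le> p" for p q
    by (rule integrable_continuous_real) (rule continuous_on_subset[OF contF], use that in auto)
  have sumI: "(\<Sum>k<M. I k) = n"
    using integral_grid_sum[OF a intF[OF order_refl], of M] integral_unique[OF F_has_integral[OF yR]]
    by (simp add: I_def R_def)
  have J0: "0 \<le> J k" for k
    unfolding J_def
    by (rule integral_nonneg) (use step[of k] in \<open>auto intro!: integrable_on_subinterval[OF sq_v_integrable[of "real (Suc k) * a"]]\<close>)
  have local: "I k \<le> 2 * a * F e + 2 * a\<^sup>2 * J k" if e: "e \<in> {real k * a..real (Suc k) * a}" for k e
  proof -
    have len: "real (Suc k) * a - real k * a = a" by (simp add: algebra_simps)
    have "I k \<le> integral {real k * a..real (Suc k) * a} (\<lambda>_. 2 * F e + 2 * (a * J k))"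
      unfolding I_def
    proof (rule integral_le)
      show "F integrable_on {real k * a..real (Suc k) * a}" by (rule intF[OF step(2)])
      show "(\<lambda>_. 2 * F e + 2 * (a * J k)) integrable_on {real k * a..real (Suc k) * a}"
        by (rule integrable_const_ivl)
      fix t assume t: "t \<in> {real k * a..real (Suc k) * a}"
      have "(cmod (y t - y e))\<^sup>2 \<le> a * J k"
        using v_difference_bound[OF step(2) t e] unfolding len J_def .
      moreover have "(cmod (y t))\<^sup>2 \<le> 2 * (cmod (y e))\<^sup>2 + 2 * (cmod (y t - y e))\<^sup>2"
      proof -
        have "cmod (y t) \<le> cmod (y e) + cmod (y t - y e)"
          using norm_triangle_ineq[of "y e" "y t - y e"] by simp
        then have "(cmod (y t))\<^sup>2 \<le> (cmod (y e) + cmod (y t - y e))\<^sup>2" by (rule power_mono) simp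
        also have "\<dots> \<le> 2 * (cmod (y e))\<^sup>2 + 2 * (cmod (y t - y e))\<^sup>2"
          using sum_squares_bound[of "cmod (y e)" "cmod (y t - y e)"] by (simp add: power2_sum)
        finally show ?thesis .
      qed
      ultimately show "F t \<le> 2 * F e + 2 * (a * J k)" by (simp add: F_def)
    qed
    also have "\<dots> = a * (2 * F e + 2 * (a * J k))"
      using step(1)[of k] len by simp
    finally show ?thesis by (simp add: power2_eq_square algebra_simps)
  qed
  define G where "G k = (if k < N then F (real k * a) else 0)" for k
  have each: "I k \<le> 2 * a * G k + 2 * a / \<mu> * D k + 2 * a\<^sup>2 * J k" for k
  proof (cases "k < N")
    case True
    have "0 \<le> 2 * a / \<mu> * D k" using a \<mu> D0 by simp
    then show ?thesis
      using local[of "real k * a" k] step[of k] True by (simp add: G_def)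
  next
    case False
    have "\<mu> * F (c k) \<le> D k"
      unfolding D_def using incr[of k] False F_nonneg by (intro mult_right_mono) (simp_all add: m_def)
    then have "2 * a / \<mu> * (\<mu> * F (c k)) \<le> 2 * a / \<mu> * D k" using a \<mu> by (intro mult_left_mono) simp_all
    then have "2 * a * F (c k) \<le> 2 * a / \<mu> * D k" using \<mu> by simp
    then show ?thesis using local[OF c[rule_format, of k]] False by (simp add: G_def)
  qed
  have sumG: "(\<Sum>k<M. G k) = (\<Sum>k<N. F (real k * a))"
  proof -
    have "(\<Sum>k<M. G k) = (\<Sum>k<N. G k)"
      by (rule sum.mono_neutral_right) (use MN in \<open>auto simp: G_def\<close>)
    then show ?thesis by (simp add: G_def)
  qed
  have "n \<le> (\<Sum>k<M. 2 * a * G k + 2 * a / \<mu> * D k + 2 * a\<^sup>2 * J k)"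
    unfolding sumI[symmetric] by (rule sum_mono) (rule each)
  also have "\<dots> = 2 * a * (\<Sum>k<M. G k) + 2 * a / \<mu> * (\<Sum>k<M. D k) + 2 * a\<^sup>2 * (\<Sum>k<M. J k)"
    by (simp add: sum.distrib sum_distrib_left)
  also have "\<dots> = 2 * a * (\<Sum>k<N. F (real k * a)) + 2 * a / \<mu> * (B m1 R + B m2 R) + 2 * a\<^sup>2 * A R"
    unfolding sumG sumD sumJ ..
  also have "\<dots> \<le> 2 * a * (\<Sum>k<N. F (real k * a)) + (2 * a\<^sup>2 + 2 * a / \<mu>) * (A R + B m1 R + B m2 R + n)"
  proof -
    have B: "0 \<le> B m1 R" "0 \<le> B m2 R" using R0 yR mono by (auto intro!: B_nonneg)
    have "2 * a / \<mu> * (B m1 R + B m2 R) \<le> 2 * a / \<mu> * (A R + B m1 R + B m2 R + n)"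
      "2 * a\<^sup>2 * A R \<le> 2 * a\<^sup>2 * (A R + B m1 R + B m2 R + n)"
      using a \<mu> B A_nonneg[of R] n_nonneg by (intro mult_left_mono; simp)+
    then show ?thesis by (simp add: distrib_right)
  qed
  finally show ?thesis using R0 yR by (intro exI[of _ R]) simp
qed

end

section \<open>Linearity of the minimal operator and elements of its domain\<close>

lemma AC_loc_const: "AC_loc (\<lambda>_. c)"
  by (rule AC_loc_lipschitz) (rule exI[of _ 0], simp)

lemma minimal_triple_scale:
  assumes t: "minimal_triple s y u w"
  shows "minimal_triple s (\<lambda>x. c * y x) (\<lambda>x. c * u x) (\<lambda>x. c * w x)"
proof -
  have y: "AC_loc y" and u: "AC_loc u"
    and dy: "AE x in half_line. \<exists>y'. (y has_vector_derivative y') (at x within {0..}) \<and> u x = y' - s x * y x"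
    and du: "AE x in half_line. \<exists>u'. (u has_vector_derivative u') (at x within {0..}) \<and>
        w x = - u' - s x * u x - (s x)\<^sup>2 * y x"
    and rest: "square_integrable y" "square_integrable w" "y 0 = 0" "u 0 = 0"
      "compact (closure {x \<in> {0..}. y x \<noteq> 0})"
    using t by (simp_all add: minimal_triple_def is_differential_expression_def is_quasi_derivative_def)
  have "AE x in half_line. \<exists>y'. ((\<lambda>x. c * y x) has_vector_derivative y') (at x within {0..}) \<and>
      c * u x = y' - s x * (c * y x)"
    using dy
  proof (rule eventually_mono, elim exE conjE)
    fix x y' assume d: "(y has_vector_derivative y') (at x within {0..})" and e: "u x = y' - s x * y x"
    show "\<exists>y'. ((\<lambda>x. c * y x) has_vector_derivative y') (at x within {0..}) \<and> c * u x = y' - s x * (c * y x)"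
      by (intro exI[of _ "c * y'"] conjI bounded_linear.has_vector_derivative[OF bounded_linear_mult_right d])
        (simp add: e algebra_simps)
  qed
  moreover have "AE x in half_line. \<exists>u'. ((\<lambda>x. c * u x) has_vector_derivative u') (at x within {0..}) \<and>
      c * w x = - u' - s x * (c * u x) - (s x)\<^sup>2 * (c * y x)"
    using du
  proof (rule eventually_mono, elim exE conjE)
    fix x u' assume d: "(u has_vector_derivative u') (at x within {0..})"
      and e: "w x = - u' - s x * u x - (s x)\<^sup>2 * y x"
    show "\<exists>u'. ((\<lambda>x. c * u x) has_vector_derivative u') (at x within {0..}) \<and>
        c * w x = - u' - s x * (c * u x) - (s x)\<^sup>2 * (c * y x)"
      by (intro exI[of _ "c * u'"] conjI bounded_linear.has_vector_derivative[OF bounded_linear_mult_right d])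
        (simp add: e algebra_simps)
  qed
  moreover have "compact (closure {x \<in> {0..}. c * y x \<noteq> 0})"
    unfolding compact_closure
    by (rule bounded_subset[OF rest(5)[unfolded compact_closure]]) auto
  ultimately show ?thesis
    unfolding minimal_triple_def is_differential_expression_def is_quasi_derivative_def
    using rest by (simp add: square_integrable_mult AC_loc_mult[OF AC_loc_const y] AC_loc_mult[OF AC_loc_const u])
qed

lemma minimal_triple_add:
  assumes t: "minimal_triple s y u w" and t1: "minimal_triple s y1 u1 w1"
  shows "minimal_triple s (\<lambda>x. y x + y1 x) (\<lambda>x. u x + u1 x) (\<lambda>x. w x + w1 x)"
proof -
  have y: "AC_loc y" and u: "AC_loc u"
    and dy: "AE x in half_line. \<exists>y'. (y has_vector_derivative y') (at x within {0..}) \<and> u x = y' - s x * y x"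
    and du: "AE x in half_line. \<exists>u'. (u has_vector_derivative u') (at x within {0..}) \<and>
        w x = - u' - s x * u x - (s x)\<^sup>2 * y x"
    and rest: "square_integrable y" "square_integrable w" "y 0 = 0" "u 0 = 0"
      "compact (closure {x \<in> {0..}. y x \<noteq> 0})"
    using t by (simp_all add: minimal_triple_def is_differential_expression_def is_quasi_derivative_def)
  have y1: "AC_loc y1" and u1: "AC_loc u1"
    and dy1: "AE x in half_line. \<exists>y'. (y1 has_vector_derivative y') (at x within {0..}) \<and> u1 x = y' - s x * y1 x"
    and du1: "AE x in half_line. \<exists>u'. (u1 has_vector_derivative u') (at x within {0..}) \<and>
        w1 x = - u' - s x * u1 x - (s x)\<^sup>2 * y1 x"
    and rest1: "square_integrable y1" "square_integrable w1" "y1 0 = 0" "u1 0 = 0"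
      "compact (closure {x \<in> {0..}. y1 x \<noteq> 0})"
    using t1 by (simp_all add: minimal_triple_def is_differential_expression_def is_quasi_derivative_def)
  have "AE x in half_line. \<exists>y'. ((\<lambda>x. y x + y1 x) has_vector_derivative y') (at x within {0..}) \<and>
      u x + u1 x = y' - s x * (y x + y1 x)"
    using eventually_conj[OF dy dy1]
  proof (rule eventually_mono, elim exE conjE)
    fix x y' y1' assume d: "(y has_vector_derivative y') (at x within {0..})"
        "(y1 has_vector_derivative y1') (at x within {0..})"
      and e: "u x = y' - s x * y x" "u1 x = y1' - s x * y1 x"
    show "\<exists>y'. ((\<lambda>x. y x + y1 x) has_vector_derivative y') (at x within {0..}) \<and> u x + u1 x = y' - s x * (y x + y1 x)"
      by (intro exI[of _ "y' + y1'"] conjI has_vector_derivative_add d) (simp add: e algebra_simps)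
  qed
  moreover have "AE x in half_line. \<exists>u'. ((\<lambda>x. u x + u1 x) has_vector_derivative u') (at x within {0..}) \<and>
      w x + w1 x = - u' - s x * (u x + u1 x) - (s x)\<^sup>2 * (y x + y1 x)"
    using eventually_conj[OF du du1]
  proof (rule eventually_mono, elim exE conjE)
    fix x u' u1' assume d: "(u has_vector_derivative u') (at x within {0..})"
        "(u1 has_vector_derivative u1') (at x within {0..})"
      and e: "w x = - u' - s x * u x - (s x)\<^sup>2 * y x" "w1 x = - u1' - s x * u1 x - (s x)\<^sup>2 * y1 x"
    show "\<exists>u'. ((\<lambda>x. u x + u1 x) has_vector_derivative u') (at x within {0..}) \<and>
        w x + w1 x = - u' - s x * (u x + u1 x) - (s x)\<^sup>2 * (y x + y1 x)"
      by (intro exI[of _ "u' + u1'"] conjI has_vector_derivative_add d) (simp add: e algebra_simps)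
  qed
  moreover have "compact (closure {x \<in> {0..}. y x + y1 x \<noteq> 0})"
    unfolding compact_closure
    by (rule bounded_subset[OF bounded_Un[THEN iffD2, OF conjI[OF rest(5)[unfolded compact_closure]
          rest1(5)[unfolded compact_closure]]]]) auto
  ultimately show ?thesis
    unfolding minimal_triple_def is_differential_expression_def is_quasi_derivative_def
    using rest rest1 by (simp add: square_integrable_add AC_loc_add[OF y y1] AC_loc_add[OF u u1])
qed

lemma minimal_operator_scale:
  assumes "(f, g) \<in> minimal_operator s"
  shows "(l2_scaleC c f, l2_scaleC c g) \<in> minimal_operator s"
proof -
  obtain y u w where 1: "f = abs_l2 y" "g = abs_l2 w" and t: "minimal_triple s y u w"
    using assms unfolding minimal_operator_iff by (elim exE conjE)
  have "l2_scaleC c f = abs_l2 (\<lambda>x. c * y x)" "l2_scaleC c g = abs_l2 (\<lambda>x. c * w x)"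
    using t 1 by (simp_all add: abs_l2_scaleC minimal_triple_def)
  then show ?thesis unfolding minimal_operator_iff using minimal_triple_scale[OF t, of c]
    by (intro exI conjI)
qed

lemma minimal_operator_add:
  assumes "(f, g) \<in> minimal_operator s" "(f1, g1) \<in> minimal_operator s"
  shows "(f + f1, g + g1) \<in> minimal_operator s"
proof -
  obtain y u w where 1: "f = abs_l2 y" "g = abs_l2 w" and t: "minimal_triple s y u w"
    using assms(1) unfolding minimal_operator_iff by (elim exE conjE)
  obtain y1 u1 w1 where 2: "f1 = abs_l2 y1" "g1 = abs_l2 w1" and t1: "minimal_triple s y1 u1 w1"
    using assms(2) unfolding minimal_operator_iff by (elim exE conjE)
  have "f + f1 = abs_l2 (\<lambda>x. y x + y1 x)" "g + g1 = abs_l2 (\<lambda>x. w x + w1 x)"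
    using t t1 1 2 by (simp_all add: abs_l2_add minimal_triple_def)
  then show ?thesis unfolding minimal_operator_iff using minimal_triple_add[OF t t1]
    by (intro exI conjI)
qed

lemma minimal_triple_zero: "minimal_triple s (\<lambda>_. 0) (\<lambda>_. 0) (\<lambda>_. 0)"
  unfolding minimal_triple_def is_differential_expression_def is_quasi_derivative_def
  by (simp add: square_integrable_zero AC_loc_const has_vector_derivative_const)

text \<open>
  Powers of the positive part are the building blocks of $C^2$ functions with compact support.
\<close>

lemma max_power_derivative:
  "((\<lambda>x::real. (max 0 x) ^ Suc (Suc k)) has_real_derivative real (Suc (Suc k)) * (max 0 x) ^ Suc k) (at x)"
proof -
  consider "x < 0" | "x = 0" | "0 < x" by linarith
  then show ?thesis
  proof cases
    case 1
    have "((\<lambda>x::real. 0) has_real_derivative 0) (at x)" by simp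
    then have "((\<lambda>x::real. (max 0 x) ^ Suc (Suc k)) has_real_derivative 0) (at x)"
      by (rule has_field_derivative_transform_within_open[where S = "{..<0}"]) (use 1 in auto)
    then show ?thesis using 1 by simp
  next
    case 3
    have "((\<lambda>x::real. x ^ Suc (Suc k)) has_real_derivative real (Suc (Suc k)) * x ^ Suc k) (at x)"
      by (rule DERIV_cong[OF DERIV_pow]) simp
    then have "((\<lambda>x::real. (max 0 x) ^ Suc (Suc k)) has_real_derivative real (Suc (Suc k)) * x ^ Suc k) (at x)"
      by (rule has_field_derivative_transform_within_open[where S = "{0<..}"]) (use 3 in auto)
    then show ?thesis using 3 by simp
  next
    case 2
    have "((\<lambda>h. ((max 0 (0 + h)) ^ Suc (Suc k) - (max 0 0) ^ Suc (Suc k)) / h) \<longlongrightarrow> (0::real)) (at 0)"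
    proof (rule Lim_null_comparison)
      show "\<forall>\<^sub>F h in at 0. norm (((max 0 (0 + h)) ^ Suc (Suc k) - (max 0 0) ^ Suc (Suc k)) / h) \<le> \<bar>h\<bar> ^ Suc k"
      proof (intro always_eventually allI)
        fix h :: real
        show "norm (((max 0 (0 + h)) ^ Suc (Suc k) - (max 0 0) ^ Suc (Suc k)) / h) \<le> \<bar>h\<bar> ^ Suc k"
        proof (cases "h \<le> 0")
          case True
          then have "norm (((max 0 (0 + h)) ^ Suc (Suc k) - (max 0 0) ^ Suc (Suc k)) / h) = 0" by simp
          moreover have "0 \<le> \<bar>h\<bar> ^ Suc k" by (rule zero_le_power[OF abs_ge_zero])
          ultimately show ?thesis by linarith
        next
          case False
          then have "max 0 h = h" "0 < h" by simp_all
          then show ?thesis by simp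
        qed
      qed
      show "((\<lambda>h::real. \<bar>h\<bar> ^ Suc k) \<longlongrightarrow> 0) (at 0)"
        by (auto intro!: tendsto_eq_intros)
    qed
    then show ?thesis unfolding 2 by (simp add: DERIV_def)
  qed
qed

text \<open>
  As $c$ grows the bump increases to the indicator of the open segment, which is how bumps detect the vanishing
  of a function almost everywhere; for a fixed $c$ it serves as a profile to be translated.
\<close>

lemma smooth_bump:
  fixes a c :: real
  assumes a: "0 < a"
  shows "\<exists>G G' G'' H. (\<forall>x. (G has_real_derivative G' x) (at x)) \<and> (\<forall>x. (G' has_real_derivative G'' x) (at x)) \<and>
    (\<forall>x. x \<le> 0 \<or> a \<le> x \<longrightarrow> G x = 0 \<and> G' x = 0 \<and> G'' x = 0) \<and>
    continuous_on UNIV G'' \<and> 0 \<le> H \<and> (\<forall>x. \<bar>G x\<bar> \<le> H \<and> \<bar>G' x\<bar> \<le> H \<and> \<bar>G'' x\<bar> \<le> H) \<and>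
    (\<forall>x. G x = 1 - exp (- c * ((max 0 x) ^ 3 * (max 0 (a - x)) ^ 3)))"
proof -
  define P where "P x = (max 0 x) ^ 3" for x :: real
  define P' where "P' x = 3 * (max 0 x)\<^sup>2" for x :: real
  define P'' where "P'' x = 6 * (max 0 x)" for x :: real
  have dP: "(P has_real_derivative P' x) (at x)" for x
    using max_power_derivative[of 1 x] by (simp add: P_def[abs_def] P'_def numeral_eq_Suc)
  have dP': "(P' has_real_derivative P'' x) (at x)" for x
  proof -
    have "((\<lambda>x. 3 * (max 0 x) ^ Suc (Suc 0)) has_real_derivative 3 * (real (Suc (Suc 0)) * (max 0 x) ^ Suc 0)) (at x)"
      by (rule DERIV_cmult[OF max_power_derivative])
    then show ?thesis by (simp add: P'_def[abs_def] P''_def numeral_eq_Suc)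
  qed
  have da: "((\<lambda>x. a - x) has_real_derivative - 1) (at x)" for x
    by (auto intro!: derivative_eq_intros)
  have dPr: "((\<lambda>x. P (a - x)) has_real_derivative - P' (a - x)) (at x)" for x
    by (rule DERIV_cong[OF DERIV_chain2[OF dP da]]) simp
  have dPr': "((\<lambda>x. P' (a - x)) has_real_derivative - P'' (a - x)) (at x)" for x
    by (rule DERIV_cong[OF DERIV_chain2[OF dP' da]]) simp
  define T where "T x = P x * P (a - x)" for x
  define T' where "T' x = P' x * P (a - x) - P x * P' (a - x)" for x
  define T'' where "T'' x = P'' x * P (a - x) - 2 * P' x * P' (a - x) + P x * P'' (a - x)" for x
  have dT: "(T has_real_derivative T' x) (at x)" for x
    unfolding T_def[abs_def] T'_def
    by (rule DERIV_cong[OF DERIV_mult[OF dP dPr]]) (simp add: algebra_simps)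
  have dT': "(T' has_real_derivative T'' x) (at x)" for x
    unfolding T'_def[abs_def] T''_def
    by (rule DERIV_cong[OF DERIV_diff[OF DERIV_mult[OF dP' dPr] DERIV_mult[OF dP dPr']]])
      (simp add: algebra_simps)
  define G where "G x = 1 - exp (- c * T x)" for x
  define G' where "G' x = c * T' x * exp (- c * T x)" for x
  define G'' where "G'' x = (c * T'' x - c\<^sup>2 * (T' x)\<^sup>2) * exp (- c * T x)" for x
  have dE: "((\<lambda>x. exp (- c * T x)) has_real_derivative exp (- c * T x) * (- c * T' x)) (at x)" for x
    by (rule DERIV_chain2[OF DERIV_exp DERIV_cmult[OF dT]])
  have dG: "(G has_real_derivative G' x) (at x)" for x
    unfolding G_def[abs_def] G'_def
    by (rule DERIV_cong[OF DERIV_diff[OF DERIV_const dE]]) simp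
  have dG': "(G' has_real_derivative G'' x) (at x)" for x
    unfolding G'_def[abs_def] G''_def
    by (rule DERIV_cong[OF DERIV_mult[OF DERIV_cmult[OF dT'] dE]])
      (simp add: algebra_simps power2_eq_square)
  have zero: "G x = 0 \<and> G' x = 0 \<and> G'' x = 0" if "x \<le> 0 \<or> a \<le> x" for x
    using that by (auto simp: G_def G'_def G''_def T_def T'_def T''_def P_def P'_def P''_def)
  have cG'': "continuous_on UNIV G''"
    unfolding G''_def[abs_def] T''_def[abs_def] T'_def[abs_def] T_def[abs_def] P_def P'_def P''_def
    by (intro continuous_intros)
  have cG: "continuous_on {0..a} G" "continuous_on {0..a} G'"
    by (intro continuous_at_imp_continuous_on ballI DERIV_isCont[OF dG])
      (intro continuous_at_imp_continuous_on ballI DERIV_isCont[OF dG'])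
  have bnd: "\<exists>K. \<forall>x. \<bar>h x\<bar> \<le> K" if "continuous_on {0..a} h" "\<forall>x. x \<le> 0 \<or> a \<le> x \<longrightarrow> h x = 0"
    for h :: "real \<Rightarrow> real"
  proof -
    have "bounded (h ` {0..a})"
      by (intro compact_imp_bounded compact_continuous_image compact_Icc that)
    then obtain K where K: "0 < K" "\<forall>y\<in>h ` {0..a}. norm y \<le> K"
      unfolding bounded_pos by (elim exE conjE)
    have "\<bar>h x\<bar> \<le> K" for x
    proof (cases "x \<in> {0..a}")
      case True
      then have "h x \<in> h ` {0..a}" by (rule imageI)
      then have "norm (h x) \<le> K" by (rule K(2)[rule_format])
      then show ?thesis by simp
    next
      case False
      then show ?thesis using that(2)[rule_format, of x] K(1) by auto
    qed
    then show ?thesis by (intro exI allI)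
  qed
  have z: "\<forall>x. x \<le> 0 \<or> a \<le> x \<longrightarrow> G x = 0" "\<forall>x. x \<le> 0 \<or> a \<le> x \<longrightarrow> G' x = 0"
    "\<forall>x. x \<le> 0 \<or> a \<le> x \<longrightarrow> G'' x = 0"
    using zero by auto
  obtain K1 where K1: "\<forall>x. \<bar>G x\<bar> \<le> K1" using bnd[OF cG(1) z(1)] by (elim exE)
  obtain K2 where K2: "\<forall>x. \<bar>G' x\<bar> \<le> K2" using bnd[OF cG(2) z(2)] by (elim exE)
  obtain K3 where K3: "\<forall>x. \<bar>G'' x\<bar> \<le> K3"
    using bnd[OF continuous_on_subset[OF cG'' subset_UNIV] z(3)] by (elim exE)
  define H where "H = \<bar>K1\<bar> + \<bar>K2\<bar> + \<bar>K3\<bar>"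
  have H: "\<bar>G x\<bar> \<le> H \<and> \<bar>G' x\<bar> \<le> H \<and> \<bar>G'' x\<bar> \<le> H" for x
    using K1[rule_format, of x] K2[rule_format, of x] K3[rule_format, of x] unfolding H_def by linarith
  have H0: "0 \<le> H" by (simp add: H_def)
  have formula: "G x = 1 - exp (- c * ((max 0 x) ^ 3 * (max 0 (a - x)) ^ 3))" for x
    by (simp add: G_def T_def P_def)
  show ?thesis
  proof (rule exI[of _ G], rule exI[of _ G'], rule exI[of _ G''], rule exI[of _ H], intro conjI)
    show "\<forall>x. (G has_real_derivative G' x) (at x)" by (intro allI dG)
    show "\<forall>x. (G' has_real_derivative G'' x) (at x)" by (intro allI dG')
    show "\<forall>x. x \<le> 0 \<or> a \<le> x \<longrightarrow> G x = 0 \<and> G' x = 0 \<and> G'' x = 0" by (intro allI impI zero)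
    show "continuous_on UNIV G''" by (rule cG'')
    show "0 \<le> H" by (rule H0)
    show "\<forall>x. \<bar>G x\<bar> \<le> H \<and> \<bar>G' x\<bar> \<le> H \<and> \<bar>G'' x\<bar> \<le> H" by (rule allI, rule H)
    show "\<forall>x. G x = 1 - exp (- c * ((max 0 x) ^ 3 * (max 0 (a - x)) ^ 3))" by (intro allI formula)
  qed
qed

lemma bounded_support_square_integrable:
  assumes h: "h \<in> borel_measurable half_line" and p: "0 \<le> p" "p \<le> q"
    and K: "\<And>x. x \<in> {p..q} \<Longrightarrow> cmod (h x) \<le> K" and z: "\<And>x. x \<notin> {p..q} \<Longrightarrow> h x = 0"
  shows "square_integrable h" "(norm (abs_l2 h))\<^sup>2 \<le> K\<^sup>2 * (q - p)"
proof -
  note [measurable] = h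
  have K0: "0 \<le> K" using K[of p] p by (intro order_trans[OF norm_ge_zero]) auto
  have pw: "(cmod (h x))\<^sup>2 \<le> K\<^sup>2 * indicator {p..q} x" for x
  proof (cases "x \<in> {p..q}")
    case True
    then show ?thesis using power_mono[OF K[OF True] norm_ge_zero, of 2] by simp
  qed (simp add: z)
  have fm: "{p..q} \<in> fmeasurable half_line"
    using lmeasurable_interval(1)[of p q] p
    by (intro fmeasurableI) (auto simp: emeasure_restrict_space sets_restrict_space_iff fmeasurable_def)
  have ind: "integrable half_line (\<lambda>x. K\<^sup>2 * indicator {p..q} x :: real)"
    using fm by (intro integrable_mult_right) (auto simp: fmeasurable_def intro: integrable_real_indicator)
  have int: "integrable half_line (\<lambda>x. (cmod (h x))\<^sup>2)"
    by (rule Bochner_Integration.integrable_bound[OF ind]) (use pw in \<open>auto intro!: AE_I2\<close>)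
  then show sq: "square_integrable h" using h by (simp add: square_integrable_def)
  have "(LINT x|half_line. (cmod (h x))\<^sup>2) \<le> (LINT x|half_line. K\<^sup>2 * indicator {p..q} x)"
    by (rule integral_mono[OF int ind pw])
  also have "\<dots> = K\<^sup>2 * measure half_line {p..q}" using p by simp
  also have "measure half_line {p..q} = q - p"
    using p by (subst measure_restrict_space) auto
  finally show "(norm (abs_l2 h))\<^sup>2 \<le> K\<^sup>2 * (q - p)" by (simp add: norm_abs_l2[OF sq])
qed

lemma norm_exp_le_exp: "cmod z \<le> M \<Longrightarrow> cmod (exp z) \<le> exp M"
  by (rule order_trans[OF norm_exp]) simp

lemma exp_lipschitz:
  assumes "cmod z \<le> M" "cmod z' \<le> M"
  shows "cmod (exp z - exp z') \<le> exp M * cmod (z - z')"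
proof (rule field_differentiable_bound[of "cball 0 M" exp exp])
  show "(exp has_field_derivative exp \<zeta>) (at \<zeta> within cball 0 M)" for \<zeta> :: complex
    by (rule has_field_derivative_at_within) (rule DERIV_exp)
  show "cmod (exp \<zeta>) \<le> exp M" if "\<zeta> \<in> cball 0 M" for \<zeta>
    using that by (intro norm_exp_le_exp) simp
qed (use assms in simp_all)

lemma AC_loc_of_C1:
  fixes g g' :: "real \<Rightarrow> real"
  assumes d: "\<And>x. (g has_real_derivative g' x) (at x)" and b: "\<And>x. \<bar>g' x\<bar> \<le> H"
  shows "AC_loc (\<lambda>x. of_real (g x))"
proof (rule AC_loc_lipschitz, intro exI[of _ H] allI impI)
  fix x y :: real assume "x \<le> y"
  have "norm (g y - g x) \<le> H * norm (y - x)"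
    by (rule field_differentiable_bound[of UNIV g g'])
      (use d b in \<open>auto intro: has_field_derivative_at_within\<close>)
  then show "cmod (of_real (g y) - of_real (g x)) \<le> H * (y - x)"
    using \<open>x \<le> y\<close> by (simp flip: of_real_diff)
qed

text \<open>
  With $S' = s - \sigma$ for a constant $\sigma$ and $y = e^Sg$, the quasi-derivative
  $y' - sy = e^S(g' - \sigma g)$ is again Lipschitz, and $l(y) = -e^S(g'' + 2(s-\sigma)g' + (s-\sigma)^2g)$ is
  bounded when $s$ is. The bounds depend on $s$ only through the bound $K$ of $|s - \sigma|$ on the segment, and
  $S$ does not depend on $g$.
\<close>

lemma exponential_bump:
  assumes s: "s \<in> borel_measurable half_line" and p: "0 \<le> p" "p \<le> q" and K0: "0 \<le> K"
    and K: "\<And>x. x \<in> {p..q} \<Longrightarrow> cmod (s x - sc) \<le> K"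
  shows "\<exists>S. continuous_on {0..} S \<and> (\<forall>x\<in>{p..q}. cmod (S x) \<le> K * (q - p)) \<and>
    (\<forall>g g' g'' H. (\<forall>x. (g has_real_derivative g' x) (at x)) \<longrightarrow> (\<forall>x. (g' has_real_derivative g'' x) (at x)) \<longrightarrow>
       (\<forall>x. x \<le> p \<or> q \<le> x \<longrightarrow> g x = 0 \<and> g' x = 0 \<and> g'' x = 0) \<longrightarrow> continuous_on UNIV g'' \<longrightarrow> 0 \<le> H \<longrightarrow>
       (\<forall>x. \<bar>g x\<bar> \<le> H \<and> \<bar>g' x\<bar> \<le> H \<and> \<bar>g'' x\<bar> \<le> H) \<longrightarrow>
       (\<exists>u w. minimal_triple s (\<lambda>x. exp (S x) * of_real (g x)) u w \<and>
          (norm (abs_l2 (\<lambda>x. exp (S x) * of_real (g x))))\<^sup>2 \<le> (exp (K * (q - p)) * H)\<^sup>2 * (q - p) \<and>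
          (norm (abs_l2 w))\<^sup>2 \<le> (exp (K * (q - p)) * (H + 2 * K * H + K\<^sup>2 * H))\<^sup>2 * (q - p)))"
proof -
  define \<sigma> where "\<sigma> x = (if x \<in> {p<..q} then s x - sc else 0)" for x
  have \<sigma>b: "cmod (\<sigma> x) \<le> K" for x using K[of x] K0 by (auto simp: \<sigma>_def)
  have \<sigma>m: "\<sigma> \<in> borel_measurable lebesgue"
  proof -
    have "s \<in> borel_measurable (lebesgue_on {p<..q})"
      by (rule measurable_restrict_mono[OF s]) (use p in auto)
    then have "(\<lambda>x. s x - sc) \<in> borel_measurable (lebesgue_on {p<..q})" by (intro borel_measurable_diff) auto
    then have "(\<lambda>x. if x \<in> {p<..q} then s x - sc else 0) \<in> borel_measurable lebesgue"
      by (rule borel_measurable_if_I) simp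
    then show ?thesis by (simp add: \<sigma>_def[abs_def])
  qed
  have \<sigma>i: "\<sigma> integrable_on {c..d}" for c d
    by (rule bounded_measurable_integrable[OF _ \<sigma>b]) (rule measurable_restrict_space1[OF \<sigma>m])
  \<comment> \<open>starting at $-1$ makes $S$ differentiable almost everywhere on a neighbourhood of the half-line\<close>
  define S where "S x = integral {- 1..x} \<sigma>" for x
  have Sdiff: "S y - S x = integral {x..y} \<sigma>" if "- 1 \<le> x" "x \<le> y" for x y
    using Henstock_Kurzweil_Integration.integral_combine[OF that \<sigma>i] by (simp add: S_def algebra_simps)
  have ib: "cmod (integral {x..y} \<sigma>) \<le> K * (y - x)" if "x \<le> y" for x y
    by (rule order_trans[OF has_integral_bound_real[OF K0 finite.emptyI integrable_integral[OF \<sigma>i]]])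
      (use \<sigma>b that in simp_all)
  have Slip: "cmod (S y - S x) \<le> K * (y - x)" if "0 \<le> x" "x \<le> y" for x y
    using Sdiff[of x y] ib[of x y] that by simp
  have Sp: "S p = 0"
  proof -
    have "integral {- 1..p} \<sigma> = integral {- 1..p} (\<lambda>_. 0)"
      by (rule integral_cong) (simp add: \<sigma>_def)
    then show ?thesis by (simp add: S_def)
  qed
  have Sb: "cmod (S x) \<le> K * (q - p)" if "x \<in> {p..q}" for x
  proof -
    have "cmod (S x) \<le> K * (x - p)" using Slip[of p x] Sp p that by simp
    also have "\<dots> \<le> K * (q - p)" using that K0 by (intro mult_left_mono) auto
    finally show ?thesis .
  qed
  obtain N where N: "negligible N"
      "\<forall>a x. x \<notin> N \<longrightarrow> a < x \<longrightarrow> ((\<lambda>x. integral {a..x} \<sigma>) has_vector_derivative \<sigma> x) (at x)"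
    using lebesgue_differentiation[OF \<sigma>i] by (elim exE conjE)
  have dS: "(S has_vector_derivative \<sigma> x) (at x within {0..})" if "x \<notin> N" "0 \<le> x" for x
    unfolding S_def[abs_def] by (rule has_vector_derivative_at_within) (use N(2)[rule_format, of x "-1"] that in simp)
  have Sbig: "cmod (S x) \<le> K * (p + R)" if "0 \<le> x" "x \<le> R" for x R
  proof (cases "x \<le> p")
    case True
    have "cmod (S x) \<le> K * (p - x)" using Slip[OF that(1) True] Sp by simp
    also have "\<dots> \<le> K * (p + R)" using K0 that by (intro mult_left_mono) auto
    finally show ?thesis .
  next
    case False
    have "cmod (S x) \<le> K * (x - p)" using Slip[of p x] Sp p False by simp
    also have "\<dots> \<le> K * (p + R)" using K0 that p by (intro mult_left_mono) auto
    finally show ?thesis .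
  qed
  have ACE: "AC_loc (\<lambda>x. exp (S x))"
  proof (rule AC_loc_lipschitz)
    fix R :: real assume "0 \<le> R"
    show "\<exists>L. \<forall>x y. 0 \<le> x \<longrightarrow> x \<le> y \<longrightarrow> y \<le> R \<longrightarrow> cmod (exp (S y) - exp (S x)) \<le> L * (y - x)"
    proof (intro exI[of _ "exp (K * (p + R)) * K"] allI impI)
      fix x y :: real assume xy: "0 \<le> x" "x \<le> y" "y \<le> R"
      have "cmod (exp (S y) - exp (S x)) \<le> exp (K * (p + R)) * cmod (S y - S x)"
        using xy by (intro exp_lipschitz Sbig) auto
      also have "\<dots> \<le> exp (K * (p + R)) * (K * (y - x))"
        using xy by (intro mult_left_mono Slip) auto
      finally show "cmod (exp (S y) - exp (S x)) \<le> exp (K * (p + R)) * K * (y - x)" by (simp add: mult.assoc)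
    qed
  qed
  have contS: "continuous_on {0..} S"
  proof (rule continuous_on_subset)
    show "continuous_on {- 1..} S" unfolding continuous_on_iff
    proof (intro ballI allI impI)
      fix x e :: real assume x: "x \<in> {- 1..}" and e: "0 < e"
      show "\<exists>d>0. \<forall>x'\<in>{- 1..}. dist x' x < d \<longrightarrow> dist (S x') (S x) < e"
      proof (intro exI[of _ "e / (K + 1)"] conjI ballI impI)
        show "0 < e / (K + 1)" using e K0 by simp
        fix x' assume x': "x' \<in> {- 1..}" "dist x' x < e / (K + 1)"
        have "dist (S x') (S x) \<le> K * dist x' x"
        proof (cases "x \<le> x'")
          case True
          then show ?thesis using Sdiff[of x x'] ib[of x x'] x by (simp add: dist_norm)
        next
          case False
          then show ?thesis using Sdiff[of x' x] ib[of x' x] x'(1)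
            by (simp add: dist_norm norm_minus_commute[of "S x'"])
        qed
        also have "\<dots> \<le> (K + 1) * dist x' x" by (simp add: distrib_right)
        also have "\<dots> < (K + 1) * (e / (K + 1))" using x'(2) K0 by (intro mult_strict_left_mono) auto
        also have "\<dots> = e" using K0 by simp
        finally show "dist (S x') (S x) < e" .
      qed
    qed
  qed auto
  have meas: "h \<in> borel_measurable half_line" if "continuous_on {0..} h" for h :: "real \<Rightarrow> complex"
    using that by (rule continuous_imp_measurable_on_sets_lebesgue) simp
  have bump: "\<exists>u w. minimal_triple s (\<lambda>x. exp (S x) * of_real (g x)) u w \<and>
          (norm (abs_l2 (\<lambda>x. exp (S x) * of_real (g x))))\<^sup>2 \<le> (exp (K * (q - p)) * H)\<^sup>2 * (q - p) \<and>
          (norm (abs_l2 w))\<^sup>2 \<le> (exp (K * (q - p)) * (H + 2 * K * H + K\<^sup>2 * H))\<^sup>2 * (q - p)"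
    if g: "\<forall>x. (g has_real_derivative g' x) (at x)" and g': "\<forall>x. (g' has_real_derivative g'' x) (at x)"
      and zero: "\<forall>x. x \<le> p \<or> q \<le> x \<longrightarrow> g x = 0 \<and> g' x = 0 \<and> g'' x = 0" and cont: "continuous_on UNIV g''"
      and H0: "0 \<le> H" and H: "\<forall>x. \<bar>g x\<bar> \<le> H \<and> \<bar>g' x\<bar> \<le> H \<and> \<bar>g'' x\<bar> \<le> H"
    for g g' g'' :: "real \<Rightarrow> real" and H
  proof -
    define y where "y x = exp (S x) * of_real (g x)" for x
    define u where "u x = exp (S x) * (of_real (g' x) - sc * of_real (g x))" for x
    define w where "w x = - (exp (S x) * (of_real (g'' x) + 2 * (s x - sc) * of_real (g' x) + (s x - sc)\<^sup>2 * of_real (g x)))" for x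
    have Hb: "\<bar>g' x\<bar> \<le> H" "\<bar>g'' x\<bar> \<le> H" for x using H by simp_all
    have ACg: "AC_loc (\<lambda>x. of_real (g x))" by (rule AC_loc_of_C1[OF g[rule_format] Hb(1)])
    have ACg': "AC_loc (\<lambda>x. of_real (g' x))" by (rule AC_loc_of_C1[OF g'[rule_format] Hb(2)])
    have ACy: "AC_loc y" unfolding y_def[abs_def] by (intro AC_loc_mult ACE ACg)
    have ACu: "AC_loc u"
    proof -
      have "AC_loc (\<lambda>x. exp (S x) * (of_real (g' x) + (- sc) * of_real (g x)))"
        by (intro AC_loc_mult ACE AC_loc_add ACg ACg' AC_loc_const)
      then show ?thesis by (simp add: u_def[abs_def])
    qed
    have gv: "((\<lambda>x. complex_of_real (g x)) has_vector_derivative of_real (g' x)) (at x within {0..})"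
      "((\<lambda>x. complex_of_real (g' x)) has_vector_derivative of_real (g'' x)) (at x within {0..})" for x
      by (rule has_vector_derivative_of_real[OF has_field_derivative_at_within[OF g[rule_format]]],
          rule has_vector_derivative_of_real[OF has_field_derivative_at_within[OF g'[rule_format]]])
    have \<sigma>g: "\<sigma> x * of_real (g x) = (s x - sc) * of_real (g x)" "\<sigma> x * of_real (g' x) = (s x - sc) * of_real (g' x)" for x
    proof -
      have "\<sigma> x = s x - sc \<or> g x = 0 \<and> g' x = 0"
      proof (cases "x \<in> {p<..q}")
        case False
        then have "x \<le> p \<or> q \<le> x" by auto
        then have "g x = 0 \<and> g' x = 0 \<and> g'' x = 0" by (rule zero[rule_format])
        then show ?thesis by simp
      qed (simp add: \<sigma>_def)
      then show "\<sigma> x * of_real (g x) = (s x - sc) * of_real (g x)"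
        "\<sigma> x * of_real (g' x) = (s x - sc) * of_real (g' x)"
        by (elim disjE conjE; simp)+
    qed
    have dE: "((\<lambda>x. exp (S x)) has_vector_derivative (\<sigma> x * exp (S x))) (at x within {0..})" if "x \<notin> N" "0 \<le> x" for x
    proof -
      have "((exp \<circ> S) has_vector_derivative \<sigma> x * exp (S x)) (at x within {0..})"
        by (rule field_vector_diff_chain_within[OF dS[OF that] has_field_derivative_at_within[OF DERIV_exp]])
      then show ?thesis by (simp only: o_def)
    qed
    have AEI: "AE x in half_line. P x" if "\<And>x. x \<notin> N \<Longrightarrow> 0 \<le> x \<Longrightarrow> P x" for P
      unfolding AE_half_line_iff_negligible
      by (rule negligible_subset[OF N(1)]) (use that in blast)
    have "is_quasi_derivative s y u"
      unfolding is_quasi_derivative_def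
    proof (intro conjI ACy ACu AEI)
      fix x assume x: "x \<notin> N" "0 \<le> x"
      show "\<exists>y'. (y has_vector_derivative y') (at x within {0..}) \<and> u x = y' - s x * y x"
      proof (intro exI conjI)
        show "(y has_vector_derivative (exp (S x) * of_real (g' x) + (\<sigma> x * exp (S x)) * of_real (g x))) (at x within {0..})"
          unfolding y_def[abs_def] by (intro has_vector_derivative_mult dE x gv)
        have "(\<sigma> x * exp (S x)) * of_real (g x) = exp (S x) * ((s x - sc) * of_real (g x))"
          unfolding \<sigma>g(1)[symmetric] by (simp add: mult_ac)
        then show "u x = exp (S x) * of_real (g' x) + (\<sigma> x * exp (S x)) * of_real (g x) - s x * y x"
          unfolding u_def y_def by (simp only:) (simp add: algebra_simps)
      qed
    qed
    moreover have "AE x in half_line. \<exists>u'. (u has_vector_derivative u') (at x within {0..}) \<and>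
        w x = - u' - s x * u x - (s x)\<^sup>2 * y x"
    proof (rule AEI)
      fix x assume x: "x \<notin> N" "0 \<le> x"
      show "\<exists>u'. (u has_vector_derivative u') (at x within {0..}) \<and> w x = - u' - s x * u x - (s x)\<^sup>2 * y x"
      proof (intro exI conjI)
        show "(u has_vector_derivative (exp (S x) * (of_real (g'' x) - sc * of_real (g' x))
            + (\<sigma> x * exp (S x)) * (of_real (g' x) - sc * of_real (g x)))) (at x within {0..})"
          unfolding u_def[abs_def]
          by (intro has_vector_derivative_mult dE x has_vector_derivative_diff gv
              bounded_linear.has_vector_derivative[OF bounded_linear_mult_right])
        have "(\<sigma> x * exp (S x)) * (of_real (g' x) - sc * of_real (g x))
            = exp (S x) * (\<sigma> x * of_real (g' x) - sc * (\<sigma> x * of_real (g x)))"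
          by (simp add: algebra_simps)
        then show "w x = - (exp (S x) * (of_real (g'' x) - sc * of_real (g' x))
            + (\<sigma> x * exp (S x)) * (of_real (g' x) - sc * of_real (g x))) - s x * u x - (s x)\<^sup>2 * y x"
          unfolding w_def u_def y_def \<sigma>g by (simp only:) (simp add: power2_eq_square algebra_simps)
      qed
    qed
    ultimately have de: "is_differential_expression s y u w"
      unfolding is_differential_expression_def by simp
    have out: "y x = 0" "w x = 0" if "x \<notin> {p..q}" for x
    proof -
      have "x \<le> p \<or> q \<le> x" using that by auto
      then have "g x = 0 \<and> g' x = 0 \<and> g'' x = 0" by (rule zero[rule_format])
      then show "y x = 0" "w x = 0" by (simp_all add: y_def w_def)
    qed
    have ym: "y \<in> borel_measurable half_line" by (rule meas[OF AC_loc_continuous_on[OF ACy]])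
    have cg: "continuous_on UNIV g" "continuous_on UNIV g'"
      by (intro continuous_at_imp_continuous_on ballI DERIV_isCont[OF g[rule_format]])
        (intro continuous_at_imp_continuous_on ballI DERIV_isCont[OF g'[rule_format]])
    have c3: "continuous_on {0..} (\<lambda>x. complex_of_real (g x))" "continuous_on {0..} (\<lambda>x. complex_of_real (g' x))"
      "continuous_on {0..} (\<lambda>x. complex_of_real (g'' x))"
      by (rule continuous_on_of_real, rule continuous_on_subset[OF cg(1) subset_UNIV],
          rule continuous_on_of_real, rule continuous_on_subset[OF cg(2) subset_UNIV],
          rule continuous_on_of_real, rule continuous_on_subset[OF cont subset_UNIV])
    note [measurable] = s meas[OF c3(1)] meas[OF c3(2)] meas[OF c3(3)] meas[OF AC_loc_continuous_on[OF ACE]]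
    have wm: "w \<in> borel_measurable half_line" unfolding w_def[abs_def] by measurable
    have expb: "cmod (exp (S x)) \<le> exp (K * (q - p))" if "x \<in> {p..q}" for x
      using Sb[OF that] by (rule norm_exp_le_exp)
    have yb: "cmod (y x) \<le> exp (K * (q - p)) * H" if "x \<in> {p..q}" for x
      unfolding y_def norm_mult using expb[OF that] H H0 by (intro mult_mono) auto
    have wb: "cmod (w x) \<le> exp (K * (q - p)) * (H + 2 * K * H + K\<^sup>2 * H)" if "x \<in> {p..q}" for x
    proof -
      define \<tau> where "\<tau> = cmod (s x - sc)"
      have \<tau>: "0 \<le> \<tau>" "\<tau> \<le> K" using K[OF that] by (simp_all add: \<tau>_def)
      have "cmod (of_real (g'' x) + 2 * (s x - sc) * of_real (g' x) + (s x - sc)\<^sup>2 * of_real (g x))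
          \<le> \<bar>g'' x\<bar> + 2 * \<tau> * \<bar>g' x\<bar> + \<tau>\<^sup>2 * \<bar>g x\<bar>"
      proof -
        define z where "z = s x - sc"
        show ?thesis
          unfolding \<tau>_def z_def[symmetric]
          by (intro norm_triangle_le add_mono) (simp_all add: norm_mult norm_power)
      qed
      also have "\<dots> \<le> H + 2 * K * H + K\<^sup>2 * H"
        using H H0 \<tau> K0 by (intro add_mono mult_mono power_mono) auto
      finally show ?thesis
        unfolding w_def norm_minus_cancel norm_mult using expb[OF that] by (intro mult_mono) auto
    qed
    have sq: "square_integrable y" by (rule bounded_support_square_integrable(1)[OF ym p yb out(1)])
    have sqw: "square_integrable w" by (rule bounded_support_square_integrable(1)[OF wm p wb out(2)])
    have yn: "(norm (abs_l2 y))\<^sup>2 \<le> (exp (K * (q - p)) * H)\<^sup>2 * (q - p)"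
      by (rule bounded_support_square_integrable(2)[OF ym p yb out(1)])
    have wn: "(norm (abs_l2 w))\<^sup>2 \<le> (exp (K * (q - p)) * (H + 2 * K * H + K\<^sup>2 * H))\<^sup>2 * (q - p)"
      by (rule bounded_support_square_integrable(2)[OF wm p wb out(2)])
    have "compact (closure {x \<in> {0..}. y x \<noteq> 0})"
      unfolding compact_closure
    proof (rule bounded_subset[of "{p..q}"])
      show "{x \<in> {0..}. y x \<noteq> 0} \<subseteq> {p..q}" using out(1) by blast
    qed simp
    moreover have "y 0 = 0" "u 0 = 0" using zero[rule_format, OF disjI1[OF p(1)]] by (simp_all add: y_def u_def)
    ultimately have "minimal_triple s y u w" using sq sqw de by (simp add: minimal_triple_def)
    then have "minimal_triple s (\<lambda>x. exp (S x) * of_real (g x)) u w" unfolding y_def[abs_def] .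
    then show ?thesis using wn yn[unfolded y_def[abs_def]] by (intro exI conjI)
  qed
  show ?thesis
  proof (rule exI[of _ S], intro conjI allI impI)
    show "continuous_on {0..} S" by (rule contS)
    show "\<forall>x\<in>{p..q}. cmod (S x) \<le> K * (q - p)" by (intro ballI Sb)
    fix g g' g'' :: "real \<Rightarrow> real" and H
    assume a: "\<forall>x. (g has_real_derivative g' x) (at x)" "\<forall>x. (g' has_real_derivative g'' x) (at x)"
      "\<forall>x. x \<le> p \<or> q \<le> x \<longrightarrow> g x = 0 \<and> g' x = 0 \<and> g'' x = 0" "continuous_on UNIV g''"
      "0 \<le> H" "\<forall>x. \<bar>g x\<bar> \<le> H \<and> \<bar>g' x\<bar> \<le> H \<and> \<bar>g'' x\<bar> \<le> H"
    from bump[OF a] show "\<exists>u w. minimal_triple s (\<lambda>x. exp (S x) * of_real (g x)) u w \<and>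
          (norm (abs_l2 (\<lambda>x. exp (S x) * of_real (g x))))\<^sup>2 \<le> (exp (K * (q - p)) * H)\<^sup>2 * (q - p) \<and>
          (norm (abs_l2 w))\<^sup>2 \<le> (exp (K * (q - p)) * (H + 2 * K * H + K\<^sup>2 * H))\<^sup>2 * (q - p)" .
  qed
qed

lemma l2_cinner_scaleC_right: "l2_cinner f (l2_scaleC c g) = cnj c * l2_cinner f g"
  by (subst l2_cinner_commute) (simp add: l2_cinner_scaleC_left flip: l2_cinner_commute)

text \<open>
  Testing $f$ against $e^Sg$ with $g$ increasing to the indicator of $(0,x)$ shows that the integral of
  $f e^{\bar S}$ over $(0,x)$ vanishes for every $x$; differentiate.
\<close>

lemma minimal_operator_domain_dense:
  assumes s: "s \<in> borel_measurable half_line"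
    and bnd: "\<And>R. 0 \<le> R \<Longrightarrow> \<exists>K. \<forall>x\<in>{0..R}. cmod (s x) \<le> K"
    and orth: "\<And>y g. (y, g) \<in> minimal_operator s \<Longrightarrow> inner f y = 0"
  shows "f = 0"
proof -
  obtain \<phi> where \<phi>: "square_integrable \<phi>" and f: "f = abs_l2 \<phi>" by (rule abs_l2_cases)
  have [measurable]: "\<phi> \<in> borel_measurable half_line" using \<phi> by (simp add: square_integrable_def)
  have cnj_meas[measurable (raw)]: "(\<lambda>x. cnj (g x)) \<in> borel_measurable half_line"
    if "g \<in> borel_measurable half_line" for g
    by (rule measurable_compose[OF that borel_measurable_continuous_onI]) (intro continuous_intros)
  have corth: "l2_cinner f y = 0" if y: "(y, g) \<in> minimal_operator s" for y g
  proof (rule complex_eqI)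
    show "Re (l2_cinner f y) = Re 0" using orth[OF y] by (simp add: inner_l2_def)
    show "Im (l2_cinner f y) = Im 0"
      using orth[OF minimal_operator_scale[OF y, of \<i>]] by (simp add: inner_l2_def l2_cinner_scaleC_right)
  qed
  have local: "AE x in half_line. x < Q \<longrightarrow> \<phi> x = 0" if Q: "0 < Q" for Q
  proof -
    obtain K where K: "\<forall>x\<in>{0..Q}. cmod (s x) \<le> K" using bnd[OF less_imp_le[OF Q]] by (elim exE)
    have K0: "0 \<le> K" using K[rule_format, of 0] Q by (intro order_trans[OF norm_ge_zero]) auto
    define M where "M = exp (K * Q)"
    have Ks: "cmod (s x - 0) \<le> K" if "x \<in> {0..Q}" for x using K that by simp
    have "\<exists>S. continuous_on {0..} S \<and> (\<forall>x\<in>{0..Q}. cmod (S x) \<le> K * (Q - 0)) \<and> (\<forall>g g' g'' H. (\<forall>x. (g has_real_derivative g' x) (at x)) \<longrightarrow> (\<forall>x. (g' has_real_derivative g'' x) (at x)) \<longrightarrow>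
       (\<forall>x. x \<le> 0 \<or> Q \<le> x \<longrightarrow> g x = 0 \<and> g' x = 0 \<and> g'' x = 0) \<longrightarrow> continuous_on UNIV g'' \<longrightarrow> 0 \<le> H \<longrightarrow>
       (\<forall>x. \<bar>g x\<bar> \<le> H \<and> \<bar>g' x\<bar> \<le> H \<and> \<bar>g'' x\<bar> \<le> H) \<longrightarrow>
       (\<exists>u w. minimal_triple s (\<lambda>x. exp (S x) * of_real (g x)) u w \<and>
          (norm (abs_l2 (\<lambda>x. exp (S x) * of_real (g x))))\<^sup>2 \<le> (exp (K * (Q - 0)) * H)\<^sup>2 * (Q - 0) \<and>
          (norm (abs_l2 w))\<^sup>2 \<le> (exp (K * (Q - 0)) * (H + 2 * K * H + K\<^sup>2 * H))\<^sup>2 * (Q - 0)))"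
      by (rule exponential_bump[OF s order_refl less_imp_le[OF Q] K0 Ks])
    then obtain S where S: "continuous_on {0..} S" "\<forall>x\<in>{0..Q}. cmod (S x) \<le> K * (Q - 0)"
      and bump: "\<forall>g g' g'' H. (\<forall>x. (g has_real_derivative g' x) (at x)) \<longrightarrow> (\<forall>x. (g' has_real_derivative g'' x) (at x)) \<longrightarrow>
       (\<forall>x. x \<le> 0 \<or> Q \<le> x \<longrightarrow> g x = 0 \<and> g' x = 0 \<and> g'' x = 0) \<longrightarrow> continuous_on UNIV g'' \<longrightarrow> 0 \<le> H \<longrightarrow>
       (\<forall>x. \<bar>g x\<bar> \<le> H \<and> \<bar>g' x\<bar> \<le> H \<and> \<bar>g'' x\<bar> \<le> H) \<longrightarrow>
       (\<exists>u w. minimal_triple s (\<lambda>x. exp (S x) * of_real (g x)) u w \<and>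
          (norm (abs_l2 (\<lambda>x. exp (S x) * of_real (g x))))\<^sup>2 \<le> (exp (K * (Q - 0)) * H)\<^sup>2 * (Q - 0) \<and>
          (norm (abs_l2 w))\<^sup>2 \<le> (exp (K * (Q - 0)) * (H + 2 * K * H + K\<^sup>2 * H))\<^sup>2 * (Q - 0))"
      by (elim exE conjE)
    have [measurable]: "(\<lambda>x. exp (S x)) \<in> borel_measurable half_line"
      by (rule continuous_imp_measurable_on_sets_lebesgue) (use S in \<open>auto intro!: continuous_intros\<close>)
    define h where "h t = \<phi> t * cnj (exp (S t))" for t
    have hm[measurable]: "h \<in> borel_measurable half_line" unfolding h_def[abs_def] by measurable
    have expM: "cmod (exp (S t)) \<le> M" if "t \<in> {0..Q}" for t
      unfolding M_def by (rule norm_exp_le_exp) (use S(2) that in simp)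
    define W where "W t = M * ((cmod (\<phi> t))\<^sup>2 + indicator {0..Q} t)" for t
    have fm: "{0..Q} \<in> fmeasurable half_line"
      using lmeasurable_interval(1)[of 0 Q]
      by (intro fmeasurableI) (auto simp: emeasure_restrict_space sets_restrict_space_iff fmeasurable_def)
    have W: "integrable half_line W"
      unfolding W_def[abs_def] using \<phi> fm
      by (intro integrable_mult_right Bochner_Integration.integrable_add)
        (auto simp: square_integrable_def fmeasurable_def intro: integrable_real_indicator)
    have M0: "0 < M" by (simp add: M_def)
    have dom: "cmod (h t * of_real r) \<le> W t" if "t \<in> {0..Q}" "\<bar>r\<bar> \<le> 1" for t r
    proof -
      have "cmod (h t * of_real r) \<le> (cmod (\<phi> t) * M) * 1"
        unfolding h_def norm_mult complex_mod_cnj norm_of_real using expM[OF that(1)] that(2) M0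
        by (intro mult_mono mult_nonneg_nonneg) auto
      also have "\<dots> \<le> M * ((cmod (\<phi> t))\<^sup>2 + 1)"
      proof -
        have "0 \<le> (cmod (\<phi> t) - 1 / 2)\<^sup>2" by simp
        then have "cmod (\<phi> t) \<le> (cmod (\<phi> t))\<^sup>2 + 1" by (simp add: power2_eq_square algebra_simps)
        then have "M * cmod (\<phi> t) \<le> M * ((cmod (\<phi> t))\<^sup>2 + 1)" by (rule mult_left_mono) (simp add: M_def)
        then show ?thesis by (simp add: mult.commute)
      qed
      finally show ?thesis using that by (simp add: W_def)
    qed
    have W0: "0 \<le> W t" for t using M0 by (simp add: W_def)
    define h1 where "h1 x t = (if t \<in> {0<..<x} then h t else 0)" for x t
    have h1m[measurable]: "h1 x \<in> borel_measurable half_line" for x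
      unfolding h1_def[abs_def]
      by (rule measurable_If_set) (auto simp: sets_restrict_space_iff intro: exI[of _ "{0<..<x}"])
    have h1i: "integrable half_line (h1 x)" if x: "x \<le> Q" for x
      by (rule Bochner_Integration.integrable_bound[OF W h1m])
        (use dom[of _ 1] W0 x in \<open>auto simp: h1_def intro!: AE_I2\<close>)
    have zero: "(LINT t|half_line. h1 x t) = 0" if x: "0 < x" "x \<le> Q" for x
    proof -
      define g where "g k t = 1 - exp (- real k * ((max 0 t) ^ 3 * (max 0 (x - t)) ^ 3))" for k t
      have g0: "g k t = 0" if "t \<notin> {0<..<x}" for k t using that by (auto simp: g_def max_def)
      have g1: "\<bar>g k t\<bar> \<le> 1" for k t by (simp add: g_def)
      have int0: "(LINT t|half_line. h t * of_real (g k t)) = 0" for k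
      proof -
        obtain G G' G'' H where G: "\<forall>x. (G has_real_derivative G' x) (at x)" "\<forall>x. (G' has_real_derivative G'' x) (at x)"
          "\<forall>t. t \<le> 0 \<or> x \<le> t \<longrightarrow> G t = 0 \<and> G' t = 0 \<and> G'' t = 0"
          "continuous_on UNIV G''" "0 \<le> H" "\<forall>x. \<bar>G x\<bar> \<le> H \<and> \<bar>G' x\<bar> \<le> H \<and> \<bar>G'' x\<bar> \<le> H"
          "\<forall>t. G t = 1 - exp (- real k * ((max 0 t) ^ 3 * (max 0 (x - t)) ^ 3))"
          using smooth_bump[OF x(1), of "real k"] by (elim exE conjE)
        have G3: "\<forall>t. t \<le> 0 \<or> Q \<le> t \<longrightarrow> G t = 0 \<and> G' t = 0 \<and> G'' t = 0"
        proof (intro allI impI)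
          fix t assume "t \<le> 0 \<or> Q \<le> t"
          then have "t \<le> 0 \<or> x \<le> t" using x by auto
          then show "G t = 0 \<and> G' t = 0 \<and> G'' t = 0" by (rule G(3)[rule_format])
        qed
        from bump[THEN spec, THEN spec, THEN spec, THEN spec, THEN mp, OF G(1), THEN mp, OF G(2), THEN mp, OF G3,
          THEN mp, OF G(4), THEN mp, OF G(5), THEN mp, OF G(6)]
        obtain u w where t: "minimal_triple s (\<lambda>x. exp (S x) * of_real (G x)) u w" by (elim exE conjE)
        have Gg: "G = g k" using G(7) by (auto simp: g_def)
        have "(abs_l2 (\<lambda>x. exp (S x) * of_real (g k x)), abs_l2 w) \<in> minimal_operator s"
          unfolding minimal_operator_iff
          by (rule exI[of _ "\<lambda>x. exp (S x) * of_real (g k x)"], rule exI[of _ u], rule exI[of _ w])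
            (intro conjI refl t[unfolded Gg])
        from corth[OF this] t[unfolded Gg] have "(LINT t|half_line. \<phi> t * cnj (exp (S t) * of_real (g k t))) = 0"
          unfolding f by (simp add: l2_cinner_abs \<phi> minimal_triple_def)
        then show ?thesis by (simp add: h_def mult.assoc)
      qed
      have [measurable]: "(\<lambda>t. of_real (g k t) :: complex) \<in> borel_measurable half_line" for k
        by (rule continuous_imp_measurable_on_sets_lebesgue)
          (auto simp: g_def intro!: continuous_intros)
      have "(\<lambda>k. LINT t|half_line. h t * of_real (g k t)) \<longlonglongrightarrow> (LINT t|half_line. h1 x t)"
      proof (rule integral_dominated_convergence[OF h1m _ W])
        show "(\<lambda>t. h t * of_real (g k t)) \<in> borel_measurable half_line" for k by measurable
        show "AE t in half_line. (\<lambda>k. h t * of_real (g k t)) \<longlonglongrightarrow> h1 x t"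
        proof (rule AE_I2)
          fix t
          show "(\<lambda>k. h t * of_real (g k t)) \<longlonglongrightarrow> h1 x t"
          proof (cases "t \<in> {0<..<x}")
            case True
            define c where "c = (max 0 t) ^ 3 * (max 0 (x - t)) ^ 3"
            have "0 < c" using True by (simp add: c_def)
            then have "(\<lambda>k. exp (- c) ^ k) \<longlonglongrightarrow> 0" by (intro LIMSEQ_power_zero) simp
            moreover have "exp (- c) ^ k = exp (- real k * c)" for k
              by (simp flip: exp_of_nat_mult)
            ultimately have "(\<lambda>k. exp (- real k * c)) \<longlonglongrightarrow> 0" by simp
            then have "(\<lambda>k. h t * of_real (1 - exp (- real k * c))) \<longlonglongrightarrow> h t * of_real (1 - 0)"
              by (intro tendsto_intros)
            then show ?thesis using True by (simp add: g_def h1_def c_def)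
          next
            case False
            have h10: "h1 x t = 0" unfolding h1_def using False by (rule if_not_P)
            show ?thesis unfolding g0[OF False] h10 by simp
          qed
        qed
        show "AE t in half_line. norm (h t * of_real (g k t)) \<le> W t" for k
        proof (rule AE_I2)
          fix t
          show "norm (h t * of_real (g k t)) \<le> W t"
          proof (cases "t \<in> {0<..<x}")
            case True
            then show ?thesis using x by (intro dom g1) auto
          next
            case False
            then show ?thesis unfolding g0[OF False] using W0 by simp
          qed
        qed
      qed
      then show ?thesis unfolding int0 by (simp add: LIMSEQ_const_iff)
    qed
    define ht where "ht = h1 Q"
    have I0: "(ht has_integral 0) {0..x}" if x: "0 < x" "x \<le> Q" for x
    proof (rule has_integral_spike_finite[of "{x}"])
      show "(h1 x has_integral 0) {0..x}"
        using half_line_integral_on_support[OF h1i[OF x(2)], of x] zero[OF x] by (simp add: h1_def)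
      show "ht t = h1 x t" if "t \<in> {0..x} - {x}" for t
        using that x by (auto simp: ht_def h1_def)
    qed simp
    have "ht integrable_on {0..Q}" using I0[OF Q order_refl] by (rule has_integral_integrable)
    then have "(\<lambda>t. if t \<in> {0..Q} then ht t else 0) integrable_on UNIV"
      by (simp only: integrable_restrict_UNIV)
    moreover have "(\<lambda>t. if t \<in> {0..Q} then ht t else 0) = ht" by (auto simp: ht_def h1_def)
    ultimately have "ht integrable_on UNIV" by simp
    then have hti: "ht integrable_on {c..d}" for c d by (rule integrable_on_subinterval) simp
    obtain N where N: "negligible N"
      "\<forall>a x. x \<notin> N \<longrightarrow> a < x \<longrightarrow> ((\<lambda>x. integral {a..x} ht) has_vector_derivative ht x) (at x)"
    using lebesgue_differentiation[OF hti] by (elim exE conjE)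
    have null: "\<phi> x = 0" if x: "x \<notin> N" "0 < x" "x < Q" for x
    proof -
      have "((\<lambda>x. integral {0..x} ht) has_vector_derivative 0) (at x)"
      proof (rule has_vector_derivative_transform_within_open[where S = "{0<..<Q}"])
        show "((\<lambda>x. 0) has_vector_derivative 0) (at x)" by (rule has_vector_derivative_const)
        show "0 = integral {0..t} ht" if "t \<in> {0<..<Q}" for t
          using I0[of t] that by (simp add: integral_unique)
      qed (use x in auto)
      from vector_derivative_unique_at[OF N(2)[rule_format, OF x(1,2)] this] have "ht x = 0" .
      then show ?thesis using x by (simp add: ht_def h1_def h_def)
    qed
    show ?thesis
      unfolding AE_half_line_iff_negligible
    proof (rule negligible_subset[of "insert 0 N"])
      show "negligible (insert 0 N)" using N(1) by (simp add: negligible_insert)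
      show "{x. 0 \<le> x \<and> \<not> (x < Q \<longrightarrow> \<phi> x = 0)} \<subseteq> insert 0 N" using null by force
    qed
  qed
  have "AE x in half_line. \<forall>j::nat. x < real (Suc j) \<longrightarrow> \<phi> x = 0"
    unfolding AE_all_countable by (intro allI local) simp
  then have "AE x in half_line. \<phi> x = 0"
  proof (rule eventually_mono)
    fix x assume a: "\<forall>j::nat. x < real (Suc j) \<longrightarrow> \<phi> x = 0"
    obtain j :: nat where "x < real j" using reals_Archimedean2 by (rule exE)
    then have "x < real (Suc j)" by simp
    with a show "\<phi> x = 0" by (elim allE[of _ j] impE)
  qed
  then show "f = 0"
    unfolding f zero_l2_def using \<phi> by (simp add: abs_l2_eq_iff square_integrable_zero)
qed

section \<open>Bounded increments exclude compact resolvents\<close>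

lemma resolvent_apply:
  assumes R: "is_resolvent L \<mu> R" and fg: "(f, g) \<in> L"
  shows "R (g - l2_scaleC \<mu> f) = f"
proof -
  have "(f, g - l2_scaleC \<mu> f) \<in> shift_operator L \<mu>"
    unfolding shift_operator_def using fg by (intro CollectI exI conjI) (rule refl)
  then have "(g - l2_scaleC \<mu> f, f) \<in> (shift_operator L \<mu>)\<inverse>" by (rule converseI)
  then have "(g - l2_scaleC \<mu> f, f) \<in> {(f, R f) | f. True}" using R by (simp only: is_resolvent_def)
  then show ?thesis by simp
qed

lemma norm_l2_scaleC: "norm (l2_scaleC c f) = cmod c * norm f"
proof -
  have "l2_cinner (l2_scaleC c f) (l2_scaleC c f) = (c * cnj c) * l2_cinner f f"
    by (simp add: l2_cinner_scaleC_left l2_cinner_scaleC_right mult.assoc)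
  also have "c * cnj c = of_real ((cmod c)\<^sup>2)" by (rule complex_norm_square[symmetric])
  finally have "Re (l2_cinner (l2_scaleC c f) (l2_scaleC c f)) = (cmod c)\<^sup>2 * Re (l2_cinner f f)" by simp
  then show ?thesis by (simp add: norm_l2_def real_sqrt_mult)
qed

lemma not_compact_of_separated_sequence:
  fixes y :: "nat \<Rightarrow> 'a::real_inner"
  assumes K: "compact K" "\<And>n. y n \<in> K" and rho: "0 < \<rho>" "\<And>n. \<rho> \<le> (norm (y n))\<^sup>2"
    and orth: "\<And>m n. m < n \<Longrightarrow> inner (y m) (y n) = 0"
  shows False
proof -
  obtain l r where r: "strict_mono r" "(y \<circ> r) \<longlonglongrightarrow> l"
    using K unfolding compact_def by (elim allE[of _ y] impE exE conjE bexE) simp_all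
  have "Cauchy (y \<circ> r)" by (rule LIMSEQ_imp_Cauchy[OF r(2)])
  then have "\<exists>N. \<forall>m\<ge>N. \<forall>n\<ge>N. norm ((y \<circ> r) m - (y \<circ> r) n) < sqrt \<rho>"
    by (rule CauchyD) (simp add: rho(1))
  then obtain N where N: "\<forall>m\<ge>N. \<forall>n\<ge>N. norm ((y \<circ> r) m - (y \<circ> r) n) < sqrt \<rho>"
    by (elim exE)
  define p where "p = y (r N)"
  define q where "q = y (r (Suc N))"
  have "norm (p - q) < sqrt \<rho>" using N unfolding p_def q_def by simp
  then have "(norm (p - q))\<^sup>2 < (sqrt \<rho>)\<^sup>2" by (rule power_strict_mono) simp_all
  moreover have "(norm (p - q))\<^sup>2 = (norm p)\<^sup>2 + (norm q)\<^sup>2"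
  proof -
    have "inner p q = 0" unfolding p_def q_def
      by (rule orth) (rule strict_monoD[OF r(1)], simp)
    then show ?thesis
      unfolding power2_norm_eq_inner by (simp add: inner_diff_left inner_diff_right inner_commute)
  qed
  moreover have "\<rho> \<le> (norm p)\<^sup>2" "0 \<le> (norm q)\<^sup>2" unfolding p_def by (simp_all add: rho)
  ultimately show False using rho(1) by simp
qed

text \<open>
  The elements are chosen one after another, each to the right of the supports of the previous ones.
\<close>

lemma no_compact_resolvent:
  assumes elements: "\<And>X. 0 \<le> X \<Longrightarrow> \<exists>y u w x. X \<le> x \<and> minimal_triple s y u w \<and> (\<forall>t. t \<notin> {x..x + a} \<longrightarrow> y t = 0) \<and>
      \<rho> \<le> (norm (abs_l2 y))\<^sup>2 \<and> (norm (abs_l2 y))\<^sup>2 \<le> W \<and> (norm (abs_l2 w))\<^sup>2 \<le> W"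
    and a: "0 < a" and rho: "0 < \<rho>"
    and ext: "has_extensions_with_compact_resolvents (minimal_operator s)"
  shows False
proof -
  obtain L where L: "minimal_operator s \<subseteq> L" "has_compact_resolvents L"
    using ext unfolding has_extensions_with_compact_resolvents_def by (elim exE conjE)
  then obtain \<mu> R where R: "is_resolvent L \<mu> R" and cR: "compact_operator R"
    unfolding has_compact_resolvents_def resolvent_set_def by auto
  have "\<forall>X. \<exists>e. 0 \<le> X \<longrightarrow> X \<le> snd (snd e) \<and> (\<exists>u. minimal_triple s (fst e) u (fst (snd e))) \<and>
      (\<forall>t. t \<notin> {snd (snd e)..snd (snd e) + a} \<longrightarrow> fst e t = 0) \<and>
      \<rho> \<le> (norm (abs_l2 (fst e)))\<^sup>2 \<and> (norm (abs_l2 (fst e)))\<^sup>2 \<le> W \<and> (norm (abs_l2 (fst (snd e))))\<^sup>2 \<le> W"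
  proof
    fix X :: real
    show "\<exists>e. 0 \<le> X \<longrightarrow> X \<le> snd (snd e) \<and> (\<exists>u. minimal_triple s (fst e) u (fst (snd e))) \<and>
      (\<forall>t. t \<notin> {snd (snd e)..snd (snd e) + a} \<longrightarrow> fst e t = 0) \<and>
      \<rho> \<le> (norm (abs_l2 (fst e)))\<^sup>2 \<and> (norm (abs_l2 (fst e)))\<^sup>2 \<le> W \<and> (norm (abs_l2 (fst (snd e))))\<^sup>2 \<le> W"
    proof (cases "0 \<le> X")
      case True
      obtain y u w x where e: "X \<le> x" "minimal_triple s y u w" "\<forall>t. t \<notin> {x..x + a} \<longrightarrow> y t = 0"
        "\<rho> \<le> (norm (abs_l2 y))\<^sup>2" "(norm (abs_l2 y))\<^sup>2 \<le> W" "(norm (abs_l2 w))\<^sup>2 \<le> W"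
        using elements[OF True] by (elim exE conjE)
      show ?thesis
        by (rule exI[of _ "(y, w, x)"], unfold fst_conv snd_conv, intro impI conjI exI[of _ u] e)
    next
      case False
      then show ?thesis by simp
    qed
  qed
  from choice[OF this] obtain E where E: "\<forall>X. 0 \<le> X \<longrightarrow> X \<le> snd (snd (E X)) \<and>
      (\<exists>u. minimal_triple s (fst (E X)) u (fst (snd (E X)))) \<and>
      (\<forall>t. t \<notin> {snd (snd (E X))..snd (snd (E X)) + a} \<longrightarrow> fst (E X) t = 0) \<and>
      \<rho> \<le> (norm (abs_l2 (fst (E X))))\<^sup>2 \<and> (norm (abs_l2 (fst (E X))))\<^sup>2 \<le> W \<and> (norm (abs_l2 (fst (snd (E X)))))\<^sup>2 \<le> W"
    by (elim exE)
  \<comment> \<open>\<open>E X\<close> packs the chosen \<open>y\<close>, \<open>w\<close> and left end point; the gap of length 1 separates the supports\<close>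
  define X where "X = rec_nat 0 (\<lambda>_ z. snd (snd (E z)) + a + 1)"
  have X_Suc: "X (Suc k) = snd (snd (E (X k))) + a + 1" and X_0: "X 0 = 0" for k
    by (simp_all add: X_def)
  have X0: "0 \<le> X k" for k
  proof (induction k)
    case (Suc k)
    have "X k \<le> snd (snd (E (X k)))" using E[rule_format, OF Suc.IH] by (rule conjunct1)
    then show ?case using Suc.IH a by (simp add: X_Suc)
  qed (simp add: X_0)
  define y where "y k = fst (E (X k))" for k
  define w where "w k = fst (snd (E (X k)))" for k
  define x where "x k = snd (snd (E (X k)))" for k
  have props: "X k \<le> x k \<and> (\<exists>u. minimal_triple s (y k) u (w k)) \<and> (\<forall>t. t \<notin> {x k..x k + a} \<longrightarrow> y k t = 0) \<and>
    \<rho> \<le> (norm (abs_l2 (y k)))\<^sup>2 \<and> (norm (abs_l2 (y k)))\<^sup>2 \<le> W \<and> (norm (abs_l2 (w k)))\<^sup>2 \<le> W" for k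
    unfolding y_def w_def x_def by (rule E[rule_format, OF X0])
  have el: "X k \<le> x k" "\<exists>u. minimal_triple s (y k) u (w k)" "\<forall>t. t \<notin> {x k..x k + a} \<longrightarrow> y k t = 0"
    "\<rho> \<le> (norm (abs_l2 (y k)))\<^sup>2" "(norm (abs_l2 (y k)))\<^sup>2 \<le> W" "(norm (abs_l2 (w k)))\<^sup>2 \<le> W" for k
    by (intro props[THEN conjunct1] props[THEN conjunct2, THEN conjunct1]
        props[THEN conjunct2, THEN conjunct2, THEN conjunct1]
        props[THEN conjunct2, THEN conjunct2, THEN conjunct2, THEN conjunct1]
        props[THEN conjunct2, THEN conjunct2, THEN conjunct2, THEN conjunct2, THEN conjunct1]
        props[THEN conjunct2, THEN conjunct2, THEN conjunct2, THEN conjunct2, THEN conjunct2])+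
  have X_mono: "X k \<le> X m" if "k \<le> m" for k m
  proof (rule lift_Suc_mono_le[OF _ that])
    show "X j \<le> X (Suc j)" for j
      using el(1)[of j] a unfolding X_Suc x_def[symmetric] by linarith
  qed
  have sq: "square_integrable (y k)" for k using el(2)[of k] unfolding minimal_triple_def by (elim exE conjE)
  have orth: "inner (abs_l2 (y m)) (abs_l2 (y k)) = 0" if "m < k" for m k
  proof -
    have "x m + a + 1 = X (Suc m)" by (simp add: X_Suc x_def)
    also have "\<dots> \<le> X k" using that by (intro X_mono) simp
    also have "\<dots> \<le> x k" by (rule el)
    finally have lt: "x m + a < x k" by simp
    have z: "y m t * cnj (y k t) = 0" for t
    proof (cases "t \<in> {x m..x m + a}")
      case True
      then have "t \<notin> {x k..x k + a}" using lt by simp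
      then have "y k t = 0" by (rule el(3)[rule_format])
      then show ?thesis by simp
    next
      case False
      then have "y m t = 0" by (rule el(3)[rule_format])
      then show ?thesis by simp
    qed
    show ?thesis unfolding inner_l2_def l2_cinner_abs[OF sq sq] z by simp
  qed
  define f where "f k = abs_l2 (w k) - l2_scaleC \<mu> (abs_l2 (y k))" for k
  have Rf: "R (f k) = abs_l2 (y k)" for k
  proof -
    have "(abs_l2 (y k), abs_l2 (w k)) \<in> minimal_operator s"
        using el(2)[of k]
    proof (rule exE)
      fix u assume "minimal_triple s (y k) u (w k)"
      then show ?thesis unfolding minimal_operator_iff
        by (intro exI[of _ "y k"] exI[of _ u] exI[of _ "w k"] conjI refl)
    qed
    then show ?thesis unfolding f_def by (intro resolvent_apply[OF R]) (rule subsetD[OF L(1)])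
  qed
  have nb: "norm z \<le> sqrt W" if "(norm z)\<^sup>2 \<le> W" for z :: l2
    using that by (rule real_le_rsqrt)
  have "bounded (range f)"
    unfolding bounded_iff
  proof (intro exI[of _ "sqrt W + cmod \<mu> * sqrt W"] ballI)
    fix z assume "z \<in> range f"
    then obtain k where z: "z = f k" by (rule rangeE)
    have "norm (f k) \<le> norm (abs_l2 (w k)) + cmod \<mu> * norm (abs_l2 (y k))"
      unfolding f_def by (rule order_trans[OF norm_triangle_ineq4]) (simp add: norm_l2_scaleC)
    also have "\<dots> \<le> sqrt W + cmod \<mu> * sqrt W"
      by (intro add_mono mult_left_mono nb el) simp
    finally show "norm z \<le> sqrt W + cmod \<mu> * sqrt W" unfolding z .
  qed
  then have comp: "compact (closure (R ` range f))"
    by (rule cR[unfolded compact_operator_def, THEN conjunct2, THEN spec, THEN mp])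
  have "abs_l2 (y k) \<in> closure (R ` range f)" for k
    unfolding Rf[symmetric] by (rule subsetD[OF closure_subset]) simp
  from not_compact_of_separated_sequence[OF comp this rho el(4) orth] show False .
qed

context sectorial_potential
begin

lemma increments_of_potential:
  assumes x: "0 \<le> x" and t: "x \<le> t" "t \<le> x + a"
  shows "cmod (s t - s x) \<le> (m1 (x + a) + m2 (x + a)) - (m1 x + m2 x) + (2 * C + a * cmod \<kappa>)"
proof -
  have m: "m x \<le> m t \<and> m t \<le> m (x + a)" if "mono_on {0..} m" for m :: "real \<Rightarrow> real"
    using mono_onD[OF that, of x t] mono_onD[OF that, of t "x + a"] x t by simp
  have t0: "0 \<le> t" using x t by simp
  have "s t - s x = of_real (m1 t - m1 x) * cis \<gamma> + of_real (m2 t - m2 x) * cis \<delta> + (b t - b x) + of_real (t - x) * \<kappa>"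
    unfolding s_eq[OF x] s_eq[OF t0] by (simp add: algebra_simps)
  also have "cmod \<dots> \<le> \<bar>m1 t - m1 x\<bar> + \<bar>m2 t - m2 x\<bar> + (cmod (b t) + cmod (b x)) + \<bar>t - x\<bar> * cmod \<kappa>"
    by (intro norm_triangle_le add_mono order_refl)
      (simp_all add: norm_mult norm_triangle_ineq4 del: of_real_diff)
  also have "\<dots> \<le> (m1 (x + a) - m1 x) + (m2 (x + a) - m2 x) + (C + C) + a * cmod \<kappa>"
    using m[OF mono(1)] m[OF mono(2)] t b_bound[OF x] b_bound[OF t0]
    by (intro add_mono mult_right_mono) auto
  finally show ?thesis by simp
qed

lemma monotone_increments:
  assumes x: "0 \<le> x" and a: "0 \<le> a"
  shows "axis_cos * ((m1 (x + a) + m2 (x + a)) - (m1 x + m2 x)) \<le> cmod (s (x + a) - s x) + (2 * C + a * cmod \<kappa>)"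
proof -
  have xa: "0 \<le> x + a" using x a by simp
  define d1 where "d1 = m1 (x + a) - m1 x"
  define d2 where "d2 = m2 (x + a) - m2 x"
  have d: "0 \<le> d1" "0 \<le> d2"
    unfolding d1_def d2_def using mono_onD[OF mono(1), of x "x + a"] mono_onD[OF mono(2), of x "x + a"] x a by simp_all
  define h where "h = (\<delta> - \<gamma>) / 2"
  have e: "\<gamma> - axis = - h" "\<delta> - axis = h" by (simp_all add: h_def axis_def field_simps)
  have re: "Re (cis (- axis) * (of_real r * cis \<phi>)) = r * cos (\<phi> - axis)" for r \<phi>
    by (simp add: cos_diff algebra_simps)
  have eq: "of_real d1 * cis \<gamma> + of_real d2 * cis \<delta> = (s (x + a) - s x) - ((b (x + a) - b x) + of_real a * \<kappa>)"
    unfolding s_eq[OF x] s_eq[OF xa] d1_def d2_def by (simp add: algebra_simps)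
  have "axis_cos * (d1 + d2) \<le> cos h * (d1 + d2)"
    using d by (intro mult_right_mono) (simp_all add: axis_cos_def h_def)
  also have "\<dots> = Re (cis (- axis) * (of_real d1 * cis \<gamma> + of_real d2 * cis \<delta>))"
    by (simp only: distrib_left plus_complex.sel re e cos_minus) (simp add: mult.commute)
  also have "\<dots> \<le> cmod (cis (- axis) * (of_real d1 * cis \<gamma> + of_real d2 * cis \<delta>))" by (rule complex_Re_le_cmod)
  also have "\<dots> = cmod (of_real d1 * cis \<gamma> + of_real d2 * cis \<delta>)" by (simp add: norm_mult)
  also have "\<dots> \<le> cmod (s (x + a) - s x) + ((cmod (b (x + a)) + cmod (b x)) + a * cmod \<kappa>)"
    unfolding eq
    by (rule order_trans[OF norm_triangle_ineq4], intro add_left_mono, rule order_trans[OF norm_triangle_ineq],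
        rule add_mono[OF norm_triangle_ineq4]) (use a in \<open>simp add: norm_mult\<close>)
  also have "\<dots> \<le> cmod (s (x + a) - s x) + ((C + C) + a * cmod \<kappa>)"
    by (intro add_left_mono add_right_mono add_mono b_bound x xa)
  finally show ?thesis by (simp add: d1_def d2_def algebra_simps)
qed

text \<open>
  Where $|s(x+a)-s(x)|$ stays bounded, the increments of $m_1$ and $m_2$ over $[x,x+a]$ are bounded, since they have
  acute directions and cannot cancel; so $s - s(x)$ is bounded on the whole segment by a constant that does not
  depend on $x$, and a translated bump can be used.
\<close>

lemma compact_extension_imp_increments_diverge:
  assumes ext: "has_extensions_with_compact_resolvents (minimal_operator s)" and a: "0 < a"
  shows "filterlim (\<lambda>x. cmod (s (x + a) - s x)) at_top at_top"
proof (rule ccontr)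
  assume "\<not> filterlim (\<lambda>x. cmod (s (x + a) - s x)) at_top at_top"
  then obtain M where M: "\<not> eventually (\<lambda>x. M \<le> cmod (s (x + a) - s x)) at_top"
    unfolding filterlim_at_top not_all by (elim exE)
  have low: "\<exists>x\<ge>X. cmod (s (x + a) - s x) < M" for X
    using M unfolding eventually_at_top_linorder by (auto simp: not_le)
  define D where "D = (\<bar>M\<bar> + (2 * C + a * cmod \<kappa>)) / axis_cos + (2 * C + a * cmod \<kappa>)"
  have C0: "0 \<le> C" using b_bound[of 0] by (rule order_trans[OF norm_ge_zero]) simp
  have D0: "0 \<le> D" using C0 a axis_cos_pos unfolding D_def
    by (intro add_nonneg_nonneg divide_nonneg_nonneg) auto
  obtain G G' G'' H where G: "\<forall>x. (G has_real_derivative G' x) (at x)" "\<forall>x. (G' has_real_derivative G'' x) (at x)"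
    "\<forall>t. t \<le> 0 \<or> a \<le> t \<longrightarrow> G t = 0 \<and> G' t = 0 \<and> G'' t = 0"
    "continuous_on UNIV G''" "0 \<le> H" "\<forall>x. \<bar>G x\<bar> \<le> H \<and> \<bar>G' x\<bar> \<le> H \<and> \<bar>G'' x\<bar> \<le> H"
    "\<forall>t. G t = 1 - exp (- 1 * ((max 0 t) ^ 3 * (max 0 (a - t)) ^ 3))"
    using smooth_bump[OF a, of 1] by (elim exE conjE)
  define c where "c = (a / 3) ^ 3 * (a / 3) ^ 3"
  define \<eta> where "\<eta> = exp (- (D * a)) * (1 - exp (- c))"
  have c0: "0 < c" using a by (simp add: c_def)
  have eta: "0 < \<eta>" using c0 by (simp add: \<eta>_def)
  define W where "W = max ((exp (D * a) * H)\<^sup>2 * a) ((exp (D * a) * (H + 2 * D * H + D\<^sup>2 * H))\<^sup>2 * a)"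
  show False
  proof (rule no_compact_resolvent[OF _ a _ ext])
    show "0 < \<eta>\<^sup>2 * (a / 3)" using eta a by simp
    fix X :: real assume X: "0 \<le> X"
    obtain x where x: "X \<le> x" "cmod (s (x + a) - s x) < M" using low[of X] by (elim exE conjE)
    have x0: "0 \<le> x" using X x by simp
    have "axis_cos * ((m1 (x + a) + m2 (x + a)) - (m1 x + m2 x)) \<le> \<bar>M\<bar> + (2 * C + a * cmod \<kappa>)"
      using monotone_increments[OF x0 less_imp_le[OF a]] x(2) by linarith
    then have "(m1 (x + a) + m2 (x + a)) - (m1 x + m2 x) \<le> (\<bar>M\<bar> + (2 * C + a * cmod \<kappa>)) / axis_cos"
      using axis_cos_pos by (simp add: pos_le_divide_eq mult.commute)
    then have Ds: "cmod (s t - s x) \<le> D" if "t \<in> {x..x + a}" for t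
      using increments_of_potential[OF x0, of t a] that unfolding D_def by simp
    have xa: "x \<le> x + a" using a by simp
    have "\<exists>S. continuous_on {0..} S \<and> (\<forall>t\<in>{x..x + a}. cmod (S t) \<le> D * (x + a - x)) \<and>
      (\<forall>g g' g'' H. (\<forall>t. (g has_real_derivative g' t) (at t)) \<longrightarrow> (\<forall>t. (g' has_real_derivative g'' t) (at t)) \<longrightarrow>
       (\<forall>t. t \<le> x \<or> x + a \<le> t \<longrightarrow> g t = 0 \<and> g' t = 0 \<and> g'' t = 0) \<longrightarrow> continuous_on UNIV g'' \<longrightarrow> 0 \<le> H \<longrightarrow>
       (\<forall>t. \<bar>g t\<bar> \<le> H \<and> \<bar>g' t\<bar> \<le> H \<and> \<bar>g'' t\<bar> \<le> H) \<longrightarrow>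
       (\<exists>u w. minimal_triple s (\<lambda>t. exp (S t) * of_real (g t)) u w \<and>
          (norm (abs_l2 (\<lambda>t. exp (S t) * of_real (g t))))\<^sup>2 \<le> (exp (D * (x + a - x)) * H)\<^sup>2 * (x + a - x) \<and>
          (norm (abs_l2 w))\<^sup>2 \<le> (exp (D * (x + a - x)) * (H + 2 * D * H + D\<^sup>2 * H))\<^sup>2 * (x + a - x)))"
      by (rule exponential_bump[OF s_meas x0 xa D0 Ds])
    then obtain S where S: "\<forall>t\<in>{x..x + a}. cmod (S t) \<le> D * (x + a - x)" and
      bump: "\<forall>g g' g'' H. (\<forall>t. (g has_real_derivative g' t) (at t)) \<longrightarrow> (\<forall>t. (g' has_real_derivative g'' t) (at t)) \<longrightarrow>
       (\<forall>t. t \<le> x \<or> x + a \<le> t \<longrightarrow> g t = 0 \<and> g' t = 0 \<and> g'' t = 0) \<longrightarrow> continuous_on UNIV g'' \<longrightarrow> 0 \<le> H \<longrightarrow>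
       (\<forall>t. \<bar>g t\<bar> \<le> H \<and> \<bar>g' t\<bar> \<le> H \<and> \<bar>g'' t\<bar> \<le> H) \<longrightarrow>
       (\<exists>u w. minimal_triple s (\<lambda>t. exp (S t) * of_real (g t)) u w \<and>
          (norm (abs_l2 (\<lambda>t. exp (S t) * of_real (g t))))\<^sup>2 \<le> (exp (D * (x + a - x)) * H)\<^sup>2 * (x + a - x) \<and>
          (norm (abs_l2 w))\<^sup>2 \<le> (exp (D * (x + a - x)) * (H + 2 * D * H + D\<^sup>2 * H))\<^sup>2 * (x + a - x))"
      by (elim exE conjE)
    have shift_deriv: "((\<lambda>t. g (t - x)) has_real_derivative g' (t - x)) (at t)"
      if "\<forall>t. (g has_real_derivative g' t) (at t)" for g g' :: "real \<Rightarrow> real" and t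
    proof -
      have "((\<lambda>t. t - x) has_real_derivative 1) (at t)" by (auto intro!: derivative_eq_intros)
      from DERIV_chain2[OF that[rule_format] this] show ?thesis by simp
    qed
    have 1: "\<forall>t. ((\<lambda>t. G (t - x)) has_real_derivative G' (t - x)) (at t)"
      "\<forall>t. ((\<lambda>t. G' (t - x)) has_real_derivative G'' (t - x)) (at t)"
      by (rule allI, rule shift_deriv, rule G(1), rule allI, rule shift_deriv, rule G(2))
    have 2: "\<forall>t. t \<le> x \<or> x + a \<le> t \<longrightarrow> G (t - x) = 0 \<and> G' (t - x) = 0 \<and> G'' (t - x) = 0"
    proof (intro allI impI)
      fix t assume "t \<le> x \<or> x + a \<le> t"
      then have "t - x \<le> 0 \<or> a \<le> t - x" by auto
      then show "G (t - x) = 0 \<and> G' (t - x) = 0 \<and> G'' (t - x) = 0" by (rule G(3)[rule_format])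
    qed
    have 3: "continuous_on UNIV (\<lambda>t. G'' (t - x))"
      by (rule continuous_on_compose2[OF G(4)]) (auto intro!: continuous_intros)
    have 4: "\<forall>t. \<bar>G (t - x)\<bar> \<le> H \<and> \<bar>G' (t - x)\<bar> \<le> H \<and> \<bar>G'' (t - x)\<bar> \<le> H" using G(6) by blast
    define y where "y t = exp (S t) * of_real (G (t - x))" for t
    have "\<exists>u w. minimal_triple s y u w \<and>
          (norm (abs_l2 y))\<^sup>2 \<le> (exp (D * (x + a - x)) * H)\<^sup>2 * (x + a - x) \<and>
          (norm (abs_l2 w))\<^sup>2 \<le> (exp (D * (x + a - x)) * (H + 2 * D * H + D\<^sup>2 * H))\<^sup>2 * (x + a - x)"
      unfolding y_def[abs_def]
      using bump[THEN spec, THEN spec, THEN spec, THEN spec, THEN mp, OF 1(1), THEN mp, OF 1(2), THEN mp, OF 2,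
          THEN mp, OF 3, THEN mp, OF G(5), THEN mp, OF 4] .
    then obtain u w where t: "minimal_triple s y u w"
      and yn: "(norm (abs_l2 y))\<^sup>2 \<le> (exp (D * a) * H)\<^sup>2 * a"
      and wn: "(norm (abs_l2 w))\<^sup>2 \<le> (exp (D * a) * (H + 2 * D * H + D\<^sup>2 * H))\<^sup>2 * a"
      unfolding add_diff_cancel_left' by (elim exE conjE)
    have out: "\<forall>t. t \<notin> {x..x + a} \<longrightarrow> y t = 0"
    proof (intro allI impI)
      fix t assume "t \<notin> {x..x + a}"
      then have "t \<le> x \<or> x + a \<le> t" by auto
      then have "G (t - x) = 0 \<and> G' (t - x) = 0 \<and> G'' (t - x) = 0" by (rule 2[rule_format])
      then show "y t = 0" by (simp add: y_def)
    qed
    have sq: "square_integrable y" using t by (simp add: minimal_triple_def)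
    have "\<eta>\<^sup>2 * (a / 3) \<le> (norm (abs_l2 y))\<^sup>2"
    proof -
      have pw: "\<eta>\<^sup>2 * indicator {x + a / 3..x + 2 * a / 3} t \<le> (cmod (y t))\<^sup>2" for t
      proof (cases "t \<in> {x + a / 3..x + 2 * a / 3}")
        case True
        have third: "a / 3 \<le> max 0 (t - x)" "a / 3 \<le> max 0 (a - (t - x))" using True by auto
        have "c \<le> (max 0 (t - x)) ^ 3 * (max 0 (a - (t - x))) ^ 3"
          unfolding c_def by (intro mult_mono power_mono third zero_le_power) (use a in simp_all)
        then have "1 - exp (- c) \<le> G (t - x)" unfolding G(7)[rule_format, of "t - x"] by simp
        moreover have "exp (- (D * a)) \<le> cmod (exp (S t))"
        proof -
          have "t \<in> {x..x + a}" using True a by auto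
          then have "cmod (S t) \<le> D * a" using S by simp
          then have "- (D * a) \<le> Re (S t)" using abs_Re_le_cmod[of "S t"] by linarith
          then show ?thesis by simp
        qed
        ultimately have "\<eta> \<le> cmod (exp (S t)) * \<bar>G (t - x)\<bar>"
          unfolding \<eta>_def using c0 by (intro mult_mono) auto
        then have "\<eta> \<le> cmod (y t)" by (simp add: y_def norm_mult)
        then have "\<eta>\<^sup>2 \<le> (cmod (y t))\<^sup>2" using eta by (intro power_mono) auto
        then show ?thesis using True by simp
      qed simp
      have "\<eta>\<^sup>2 * (a / 3) = (LINT t|half_line. \<eta>\<^sup>2 * indicator {x + a / 3..x + 2 * a / 3} t)"
      proof -
        have "measure half_line {x + a / 3..x + 2 * a / 3} = a / 3"
          using x0 a by (subst measure_restrict_space) (auto simp: field_simps)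
        then show ?thesis using x0 a by simp
      qed
      also have "\<dots> \<le> (LINT t|half_line. (cmod (y t))\<^sup>2)"
      proof (rule integral_mono[OF _ _ pw])
        have "{x + a / 3..x + 2 * a / 3} \<in> fmeasurable half_line"
          using lmeasurable_interval(1)[of "x + a / 3" "x + 2 * a / 3"] x0 a
          by (intro fmeasurableI) (auto simp: emeasure_restrict_space sets_restrict_space_iff fmeasurable_def)
        then show "integrable half_line (\<lambda>t. \<eta>\<^sup>2 * indicator {x + a / 3..x + 2 * a / 3} t :: real)"
          by (intro integrable_mult_right) (auto simp: fmeasurable_def intro: integrable_real_indicator)
        show "integrable half_line (\<lambda>t. (cmod (y t))\<^sup>2)" using sq by (simp add: square_integrable_def)
      qed
      also have "\<dots> = (norm (abs_l2 y))\<^sup>2" by (rule norm_abs_l2[OF sq, symmetric])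
      finally show ?thesis .
    qed
    moreover have "(norm (abs_l2 y))\<^sup>2 \<le> W" "(norm (abs_l2 w))\<^sup>2 \<le> W"
      unfolding W_def by (rule max.coboundedI1[OF yn], rule max.coboundedI2[OF wn])
    ultimately have "X \<le> x \<and> minimal_triple s y u w \<and> (\<forall>t. t \<notin> {x..x + a} \<longrightarrow> y t = 0) \<and>
      \<eta>\<^sup>2 * (a / 3) \<le> (norm (abs_l2 y))\<^sup>2 \<and> (norm (abs_l2 y))\<^sup>2 \<le> W \<and> (norm (abs_l2 w))\<^sup>2 \<le> W"
      using x(1) t out by (intro conjI)
    then show "\<exists>y u w x. X \<le> x \<and> minimal_triple s y u w \<and> (\<forall>t. t \<notin> {x..x + a} \<longrightarrow> y t = 0) \<and>
      \<eta>\<^sup>2 * (a / 3) \<le> (norm (abs_l2 y))\<^sup>2 \<and> (norm (abs_l2 y))\<^sup>2 \<le> W \<and> (norm (abs_l2 w))\<^sup>2 \<le> W"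
      by (intro exI)
  qed
qed

end

section \<open>Unbounded increments yield a compact resolvent\<close>

lemma l2_scaleC_add_right: "l2_scaleC c (f + g) = l2_scaleC c f + l2_scaleC c g"
  by transfer (auto simp: ring_distribs intro!: square_integrable_add square_integrable_mult)

lemma l2_scaleC_add_left: "l2_scaleC (c + d) f = l2_scaleC c f + l2_scaleC d f"
  by transfer (auto simp: ring_distribs intro!: square_integrable_add square_integrable_mult)

lemma l2_scaleC_scaleC: "l2_scaleC c (l2_scaleC d f) = l2_scaleC (c * d) f"
  by transfer (auto simp: mult.assoc intro!: square_integrable_mult)

lemma l2_scaleC_one: "l2_scaleC 1 f = f"
  by transfer auto

lemma l2_scaleC_real: "l2_scaleC (of_real r) f = r *\<^sub>R f"
  by (simp add: scaleR_l2_def)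

lemma bounded_linear_l2_scaleC: "bounded_linear (l2_scaleC c)"
proof (rule bounded_linear_intro)
  show "l2_scaleC c (r *\<^sub>R f) = r *\<^sub>R l2_scaleC c f" for r f
    by (simp add: scaleR_l2_def l2_scaleC_scaleC mult.commute)
  show "norm (l2_scaleC c f) \<le> norm f * cmod c" for f by (simp add: norm_l2_scaleC mult.commute)
qed (rule l2_scaleC_add_right)

lemma complex_linear_of_commute_i:
  assumes R: "linear R" and J: "\<And>h. R (l2_scaleC \<i> h) = l2_scaleC \<i> (R h)"
  shows "R (l2_scaleC c h) = l2_scaleC c (R h)"
proof -
  have dec: "l2_scaleC c h = Re c *\<^sub>R h + Im c *\<^sub>R l2_scaleC \<i> h" for h
  proof -
    have "c = of_real (Re c) + of_real (Im c) * \<i>" by (simp add: complex_eq_iff)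
    then have "l2_scaleC c h = l2_scaleC (of_real (Re c) + of_real (Im c) * \<i>) h" by simp
    also have "\<dots> = Re c *\<^sub>R h + Im c *\<^sub>R l2_scaleC \<i> h"
      by (simp only: l2_scaleC_add_left l2_scaleC_scaleC[symmetric] l2_scaleC_real)
    finally show ?thesis .
  qed
  show ?thesis unfolding dec linear_add[OF R] linear_scale[OF R] J ..
qed

lemma compact_closure_of_convergent_subsequences:
  fixes R :: "'a::metric_space \<Rightarrow> 'b::real_normed_vector"
  assumes "\<And>f. bounded (range f) \<Longrightarrow> \<exists>r. strict_mono r \<and> convergent (R \<circ> f \<circ> (r::nat \<Rightarrow> nat))"
    and B: "bounded B"
  shows "compact (closure (R ` B))"
  unfolding compact_def
proof (intro allI impI)
  fix z :: "nat \<Rightarrow> 'b" assume z: "\<forall>n. z n \<in> closure (R ` B)"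
  have "\<forall>n. \<exists>f. f \<in> B \<and> dist (R f) (z n) < 1 / real (Suc n)"
  proof
    fix n
    have "0 < 1 / real (Suc n)" by simp
    then obtain p where "p \<in> R ` B" "dist p (z n) < 1 / real (Suc n)"
      using z[rule_format, of n] unfolding closure_approachable by (elim allE[of _ "1 / real (Suc n)"] impE bexE)
    then show "\<exists>f. f \<in> B \<and> dist (R f) (z n) < 1 / real (Suc n)" by auto
  qed
  from choice[OF this] obtain f where f: "\<forall>n. f n \<in> B \<and> dist (R (f n)) (z n) < 1 / real (Suc n)"
    by (elim exE)
  have "bounded (range f)" by (rule bounded_subset[OF B]) (use f in auto)
  from assms(1)[OF this] obtain r where r: "strict_mono (r::nat \<Rightarrow> nat)" "convergent (R \<circ> f \<circ> r)"
    by (elim exE conjE)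
  then obtain l where l: "(\<lambda>n. R (f (r n))) \<longlonglongrightarrow> l" by (auto simp: convergent_def o_def)
  have "(\<lambda>n. R (f n) - z n) \<longlonglongrightarrow> 0"
  proof (rule Lim_null_comparison)
    show "\<forall>\<^sub>F n in sequentially. norm (R (f n) - z n) \<le> 1 / real (Suc n)"
      using f by (intro always_eventually allI) (simp add: dist_norm less_imp_le)
    show "(\<lambda>n. 1 / real (Suc n)) \<longlonglongrightarrow> 0" by (rule LIMSEQ_Suc[OF lim_1_over_n])
  qed
  from LIMSEQ_subseq_LIMSEQ[OF this r(1)] have "(\<lambda>n. R (f (r n)) - z (r n)) \<longlonglongrightarrow> 0" by (simp add: o_def)
  from tendsto_diff[OF l this] have lim: "(z \<circ> r) \<longlonglongrightarrow> l" by (simp add: o_def)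
  have "l \<in> closure (R ` B)"
    by (rule closed_sequentially[OF closed_closure _ lim]) (simp add: z)
  then show "\<exists>l\<in>closure (R ` B). \<exists>r. strict_mono r \<and> (z \<circ> r) \<longlonglongrightarrow> l"
    using r(1) lim by (intro bexI[of _ l] exI[of _ r] conjI)
qed

text \<open>
  The extension is $e^{-1}R^{-1} - \tau$, whose resolvent at $-\tau$ is $f \mapsto R(ef)$. The resolvent identity
  expresses every other resolvent as the composition of $R$ with a bounded operator.
\<close>

lemma extension_from_compact_inverse:
  assumes R: "bounded_linear R" "inj R" and J: "\<And>h. R (l2_scaleC \<i> h) = l2_scaleC \<i> (R h)"
    and comp: "\<And>f. bounded (range f) \<Longrightarrow> \<exists>r. strict_mono r \<and> convergent (R \<circ> f \<circ> (r::nat \<Rightarrow> nat))"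
    and e: "e \<noteq> 0" and ext: "\<And>y w. (y, w) \<in> L0 \<Longrightarrow> R (l2_scaleC e (w + l2_scaleC \<tau> y)) = y"
  shows "has_extensions_with_compact_resolvents L0"
proof -
  interpret R: bounded_linear R by fact
  have lin: "R (l2_scaleC c h) = l2_scaleC c (R h)" for c h
    by (rule complex_linear_of_commute_i[OF R.linear J])
  define L where "L = {(R g, l2_scaleC (1 / e) g - l2_scaleC \<tau> (R g)) | g. True}"
  have inL: "(R g, l2_scaleC (1 / e) g - l2_scaleC \<tau> (R g)) \<in> L" for g
    unfolding L_def by (intro CollectI exI conjI TrueI) (rule refl)
  have LE: "\<exists>g. f = R g \<and> k = l2_scaleC (1 / e) g - l2_scaleC \<tau> (R g)" if "(f, k) \<in> L" for f k
    using that unfolding L_def by simp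
  interpret S: bounded_linear "l2_scaleC c" for c by (rule bounded_linear_l2_scaleC)
  have "linear_operator L"
    unfolding linear_operator_def
  proof (intro conjI allI impI)
    show "single_valued L"
      unfolding single_valued_def
    proof (intro allI impI)
      fix f k k' assume "(f, k) \<in> L" "(f, k') \<in> L"
      obtain g where g: "f = R g" "k = l2_scaleC (1 / e) g - l2_scaleC \<tau> (R g)"
        using LE[OF \<open>(f, k) \<in> L\<close>] by (elim exE conjE)
      obtain g' where g': "f = R g'" "k' = l2_scaleC (1 / e) g' - l2_scaleC \<tau> (R g')"
        using LE[OF \<open>(f, k') \<in> L\<close>] by (elim exE conjE)
      have "R g = R g'" unfolding g(1)[symmetric] by (rule g'(1))
      then have "g = g'" by (rule injD[OF R(2)])
      then show "k = k'" unfolding g(2) g'(2) by simp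
    qed
    show "(0, 0) \<in> L" using inL[of 0] by (simp add: R.zero S.zero)
  next
    fix f k f' k' assume fk: "(f, k) \<in> L \<and> (f', k') \<in> L"
    obtain g where g: "f = R g" "k = l2_scaleC (1 / e) g - l2_scaleC \<tau> (R g)"
      using LE[OF fk[THEN conjunct1]] by (elim exE conjE)
    obtain g' where g': "f' = R g'" "k' = l2_scaleC (1 / e) g' - l2_scaleC \<tau> (R g')"
      using LE[OF fk[THEN conjunct2]] by (elim exE conjE)
    show "(f + f', k + k') \<in> L"
      using inL[of "g + g'"] unfolding g g' by (simp add: R.add S.add algebra_simps)
  next
    fix c f k assume fk: "(f, k) \<in> L"
    obtain g where g: "f = R g" "k = l2_scaleC (1 / e) g - l2_scaleC \<tau> (R g)"
      using LE[OF fk] by (elim exE conjE)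
    show "(l2_scaleC c f, l2_scaleC c k) \<in> L"
      using inL[of "l2_scaleC c g"] unfolding g by (simp add: lin S.diff l2_scaleC_scaleC mult.commute)
  qed
  moreover have "L0 \<subseteq> L"
  proof (rule subrelI)
    fix y w assume yw: "(y, w) \<in> L0"
    define g where "g = l2_scaleC e (w + l2_scaleC \<tau> y)"
    have Rg: "R g = y" unfolding g_def by (rule ext[OF yw])
    have "l2_scaleC (1 / e) g = w + l2_scaleC \<tau> y"
      unfolding g_def using e by (simp add: l2_scaleC_scaleC l2_scaleC_one)
    then show "(y, w) \<in> L" using inL[of g] by (simp add: Rg)
  qed
  moreover have "has_compact_resolvents L"
    unfolding has_compact_resolvents_def
  proof (intro conjI allI impI)
    define R0 where "R0 f = R (l2_scaleC e f)" for f
    have bl: "bounded_linear R0"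
      unfolding R0_def by (rule bounded_linear_compose[OF R(1) bounded_linear_l2_scaleC])
    have "(shift_operator L (- \<tau>))\<inverse> = {(f, R0 f) | f. True}"
    proof (rule set_eqI, rule iffI)
      fix z assume "z \<in> (shift_operator L (- \<tau>))\<inverse>"
      then obtain f k where fk: "(f, k) \<in> L" and z: "z = (k - l2_scaleC (- \<tau>) f, f)"
        unfolding shift_operator_def by auto
      obtain g where g: "f = R g" "k = l2_scaleC (1 / e) g - l2_scaleC \<tau> (R g)"
        using LE[OF fk] by (elim exE conjE)
      have neg: "l2_scaleC (- \<tau>) f = - l2_scaleC \<tau> f"
        using l2_scaleC_add_left[of "- \<tau>" \<tau> f] l2_scaleC_real[of 0 f] by (simp add: eq_neg_iff_add_eq_0)
      have "k - l2_scaleC (- \<tau>) f = l2_scaleC (1 / e) g" unfolding neg by (simp add: g)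
      moreover have "R0 (l2_scaleC (1 / e) g) = f"
        unfolding R0_def using e by (simp add: l2_scaleC_scaleC l2_scaleC_one g)
      ultimately show "z \<in> {(f, R0 f) | f. True}" by (simp add: z)
    next
      fix z assume "z \<in> {(f, R0 f) | f. True}"
      then obtain f where z: "z = (f, R0 f)" by auto
      define g where "g = l2_scaleC e f"
      have f: "f = l2_scaleC (1 / e) g" unfolding g_def using e by (simp add: l2_scaleC_scaleC l2_scaleC_one)
      have neg: "l2_scaleC (- \<tau>) (R g) = - l2_scaleC \<tau> (R g)"
        using l2_scaleC_add_left[of "- \<tau>" \<tau> "R g"] l2_scaleC_real[of 0 "R g"] by (simp add: eq_neg_iff_add_eq_0)
      have "(R g, (l2_scaleC (1 / e) g - l2_scaleC \<tau> (R g)) - l2_scaleC (- \<tau>) (R g)) \<in> shift_operator L (- \<tau>)"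
        unfolding shift_operator_def using inL[of g]
        by (intro CollectI exI[of _ "R g"] exI[of _ "l2_scaleC (1 / e) g - l2_scaleC \<tau> (R g)"] conjI refl)
      then have "(R g, f) \<in> shift_operator L (- \<tau>)" unfolding neg by (simp add: f[symmetric])
      moreover have "R g = R0 f" by (simp add: R0_def g_def)
      ultimately show "z \<in> (shift_operator L (- \<tau>))\<inverse>" unfolding z by (simp add: converse_iff)
    qed
    then have "is_resolvent L (- \<tau>) R0" using bl by (simp add: is_resolvent_def)
    then show "resolvent_set L \<noteq> {}" unfolding resolvent_set_def by blast
    fix \<mu> R' assume R': "is_resolvent L \<mu> R'"
    have bl': "bounded_linear R'" using R' by (simp add: is_resolvent_def)
    interpret R': bounded_linear R' by fact
    have eq: "R' f = R (l2_scaleC e (f + l2_scaleC (\<mu> + \<tau>) (R' f)))" for f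
    proof -
      have "(f, R' f) \<in> (shift_operator L \<mu>)\<inverse>" using R' unfolding is_resolvent_def by blast
      then obtain k where k: "(R' f, k) \<in> L" "f = k - l2_scaleC \<mu> (R' f)"
        unfolding shift_operator_def by auto
      obtain g where g: "R' f = R g" "k = l2_scaleC (1 / e) g - l2_scaleC \<tau> (R g)"
        using LE[OF k(1)] by (elim exE conjE)
      have "f + l2_scaleC (\<mu> + \<tau>) (R' f) = k + l2_scaleC \<tau> (R' f)"
        by (subst (1) k(2)) (simp add: l2_scaleC_add_left)
      also have "\<dots> = l2_scaleC (1 / e) g" using g by simp
      finally have "l2_scaleC e (f + l2_scaleC (\<mu> + \<tau>) (R' f)) = g"
        using e by (simp add: l2_scaleC_scaleC l2_scaleC_one)
      then show ?thesis using g(1) by simp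
    qed
    have "compact (closure (R' ` B))" if B: "bounded B" for B
    proof -
      define B' where "B' = (\<lambda>f. l2_scaleC e (f + l2_scaleC (\<mu> + \<tau>) (R' f))) ` B"
      have "bounded_linear (\<lambda>f. l2_scaleC e (f + l2_scaleC (\<mu> + \<tau>) (R' f)))"
        by (intro bounded_linear_compose[OF bounded_linear_l2_scaleC] bounded_linear_add bounded_linear_ident
            bounded_linear_compose[OF bounded_linear_l2_scaleC bl'])
      from bounded_linear_image[OF B this] have "bounded B'" unfolding B'_def .
      from compact_closure_of_convergent_subsequences[OF comp this]
      have "compact (closure (R ` B'))" .
      moreover have "R ` B' = R' ` B" unfolding B'_def image_image by (rule image_cong[OF refl]) (rule eq[symmetric])
      ultimately show ?thesis by simp
    qed
    then show "compact_operator R'" unfolding compact_operator_def using R'.linear by simp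
  qed
  ultimately show ?thesis
    unfolding has_extensions_with_compact_resolvents_def by (intro exI[of _ L] conjI)
qed

context sectorial_potential
begin

definition regularized_operator :: "(l2 \<times> l2) set" where
  "regularized_operator = {(f, l2_scaleC (cis (- axis)) (g + l2_scaleC (of_real shift) f)) | f g. (f, g) \<in> minimal_operator s}"

lemma regularized_operatorE:
  assumes "(f, h) \<in> regularized_operator"
  shows "\<exists>y u w. f = abs_l2 y \<and> minimal_triple s y u w \<and>
    h = l2_scaleC (cis (- axis)) (abs_l2 w + l2_scaleC (of_real shift) (abs_l2 y))"
proof -
  obtain g where g: "(f, g) \<in> minimal_operator s" "h = l2_scaleC (cis (- axis)) (g + l2_scaleC (of_real shift) f)"
    using assms unfolding regularized_operator_def by auto
  obtain y u w where "f = abs_l2 y" "g = abs_l2 w" "minimal_triple s y u w"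
    using g(1) unfolding minimal_operator_iff by (elim exE conjE)
  then show ?thesis using g(2) by (intro exI[of _ y] exI[of _ u] exI[of _ w]) simp
qed

lemma regularized_operatorI:
  "(f, g) \<in> minimal_operator s \<Longrightarrow>
    (f, l2_scaleC (cis (- axis)) (g + l2_scaleC (of_real shift) f)) \<in> regularized_operator"
  unfolding regularized_operator_def by (intro CollectI exI conjI) (rule refl)

lemma regularized_operator_scale:
  assumes "(f, h) \<in> regularized_operator"
  shows "(l2_scaleC c f, l2_scaleC c h) \<in> regularized_operator"
proof -
  obtain g where g: "(f, g) \<in> minimal_operator s" "h = l2_scaleC (cis (- axis)) (g + l2_scaleC (of_real shift) f)"
    using assms unfolding regularized_operator_def by auto
  show ?thesis
    using regularized_operatorI[OF minimal_operator_scale[OF g(1), of c]]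
    by (simp add: g(2) l2_scaleC_add_right l2_scaleC_scaleC mult_ac)
qed

lemma subspace_regularized_operator: "subspace regularized_operator"
proof (rule subspaceI)
  have "(abs_l2 (\<lambda>_. 0), abs_l2 (\<lambda>_. 0)) \<in> minimal_operator s"
    unfolding minimal_operator_iff using minimal_triple_zero by (intro exI conjI) (rule refl)+
  then have z: "(0, 0) \<in> minimal_operator s" by (simp add: zero_l2_def)
  have s0: "l2_scaleC c 0 = 0" for c by (rule linear_0[OF bounded_linear.linear[OF bounded_linear_l2_scaleC]])
  show "0 \<in> regularized_operator" using regularized_operatorI[OF z] by (simp add: s0 zero_prod_def)
next
  fix p q assume p: "p \<in> regularized_operator" and q: "q \<in> regularized_operator"
  obtain f g where f: "(f, g) \<in> minimal_operator s" "p = (f, l2_scaleC (cis (- axis)) (g + l2_scaleC (of_real shift) f))"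
    using p unfolding regularized_operator_def by auto
  obtain f1 g1 where f1: "(f1, g1) \<in> minimal_operator s" "q = (f1, l2_scaleC (cis (- axis)) (g1 + l2_scaleC (of_real shift) f1))"
    using q unfolding regularized_operator_def by auto
  show "p + q \<in> regularized_operator"
    using regularized_operatorI[OF minimal_operator_add[OF f(1) f1(1)]]
    by (simp add: f(2) f1(2) l2_scaleC_add_right algebra_simps)
next
  fix c p assume p: "p \<in> regularized_operator"
  obtain f h where "p = (f, h)" by (cases p)
  then show "c *\<^sub>R p \<in> regularized_operator"
    using regularized_operator_scale[of f h "of_real c"] p by (simp add: l2_scaleC_real)
qed

lemma regularized_energy:
  assumes t: "minimal_triple s y u w"
    and h: "h = l2_scaleC (cis (- axis)) (abs_l2 w + l2_scaleC (of_real shift) (abs_l2 y))"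
    and R: "0 \<le> R" "\<forall>x\<ge>R. y x = 0"
  shows "coercivity * (minimal_element.A s y u R + minimal_element.B s y u m1 R
      + minimal_element.B s y u m2 R + (norm (abs_l2 y))\<^sup>2) \<le> inner h (abs_l2 y)"
    "0 \<le> minimal_element.A s y u R" "0 \<le> minimal_element.B s y u m1 R" "0 \<le> minimal_element.B s y u m2 R"
proof -
  interpret e: minimal_element s \<gamma> \<delta> m1 m2 b \<kappa> C y u w
    by unfold_locales (rule t)
  have yR: "y R = 0" using R by simp
  have self: "l2_cinner (abs_l2 y) (abs_l2 y) = of_real e.n"
    by (simp add: l2_cinner_abs e.sqi e.n_def norm_abs_l2 l2_cinner_self_aux)
  have "inner h (abs_l2 y) = Re (cis (- axis) * (l2_cinner (abs_l2 w) (abs_l2 y) + of_real (shift * e.n)))"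
    unfolding inner_l2_def h by (simp only: l2_cinner_scaleC_left l2_cinner_add_left self of_real_mult)
  then show "coercivity * (e.A R + e.B m1 R + e.B m2 R + (norm (abs_l2 y))\<^sup>2) \<le> inner h (abs_l2 y)"
    using e.form_coercive[OF R] by (simp add: e.n_def)
  show "0 \<le> e.A R" by (rule e.A_nonneg)
  show "0 \<le> e.B m1 R" by (rule e.B_nonneg[OF mono(1) R(1) yR])
  show "0 \<le> e.B m2 R" by (rule e.B_nonneg[OF mono(2) R(1) yR])
qed

lemma regularized_coercive:
  assumes "(f, h) \<in> regularized_operator"
  shows "coercivity * (norm f)\<^sup>2 \<le> inner h f"
proof -
  obtain y u w where f: "f = abs_l2 y" and t: "minimal_triple s y u w"
    and h: "h = l2_scaleC (cis (- axis)) (abs_l2 w + l2_scaleC (of_real shift) (abs_l2 y))"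
    using regularized_operatorE[OF assms] by (elim exE conjE)
  interpret e: minimal_element s \<gamma> \<delta> m1 m2 b \<kappa> C y u w
    by unfold_locales (rule t)
  obtain R where R: "0 \<le> R" "\<forall>x\<ge>R. y x = 0" using e.support_nonneg by (elim exE conjE)
  note en = regularized_energy[OF t h R]
  have "coercivity * (norm f)\<^sup>2 \<le> coercivity * (e.A R + e.B m1 R + e.B m2 R + (norm (abs_l2 y))\<^sup>2)"
    unfolding f by (rule mult_left_mono) (use en coercivity_pos in simp_all)
  then show ?thesis using en(1) f by simp
qed

lemma regularized_energy_le:
  assumes t: "minimal_triple s y u w"
    and h: "h = l2_scaleC (cis (- axis)) (abs_l2 w + l2_scaleC (of_real shift) (abs_l2 y))"
    and R: "0 \<le> R" "\<forall>x\<ge>R. y x = 0"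
  shows "minimal_element.A s y u R + minimal_element.B s y u m1 R + minimal_element.B s y u m2 R + (norm (abs_l2 y))\<^sup>2
    \<le> (norm h / coercivity)\<^sup>2"
proof -
  define N where "N = norm (abs_l2 y)"
  define T where "T = minimal_element.A s y u R + minimal_element.B s y u m1 R + minimal_element.B s y u m2 R + N\<^sup>2"
  note en = regularized_energy[OF t h R]
  have c: "0 < coercivity" by (rule coercivity_pos)
  have N0: "0 \<le> N" by (simp add: N_def)
  have 1: "coercivity * T \<le> norm h * N"
    using order_trans[OF en(1) norm_cauchy_schwarz] by (simp add: T_def N_def)
  have "N\<^sup>2 \<le> T" using en by (simp add: T_def)
  then have "coercivity * N\<^sup>2 \<le> norm h * N" using 1 c by (meson mult_left_mono less_imp_le order_trans)
  then have "N * (coercivity * N) \<le> N * norm h" by (simp add: power2_eq_square mult_ac)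
  from mult_left_le_imp_le[OF this] have "coercivity * N \<le> norm h" using N0 by (cases "N = 0") auto
  then have N: "N \<le> norm h / coercivity" using c by (simp add: pos_le_divide_eq mult.commute)
  have "norm h * N \<le> norm h * (norm h / coercivity)" using N by (rule mult_left_mono) simp
  with 1 have "coercivity * T \<le> norm h * (norm h / coercivity)" by simp
  then have "T \<le> norm h * (norm h / coercivity) / coercivity"
    using c by (simp only: pos_le_divide_eq[OF c] mult.commute)
  also have "\<dots> = (norm h / coercivity)\<^sup>2" by (simp add: power2_eq_square)
  finally show ?thesis by (simp add: T_def N_def)
qed

end

context sectorial_potential
begin

lemma increments_eventually_large:
  assumes lim: "filterlim (\<lambda>x. cmod (s (x + a) - s x)) at_top at_top" and a: "0 < a"
  shows "\<exists>N. \<forall>k\<ge>N. \<mu> \<le> (m1 (real (Suc k) * a) + m2 (real (Suc k) * a)) - (m1 (real k * a) + m2 (real k * a))"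
proof -
  have "eventually (\<lambda>x. \<mu> + (2 * C + a * cmod \<kappa>) \<le> cmod (s (x + a) - s x)) at_top"
    using lim unfolding filterlim_at_top by (rule spec)
  then obtain X where X: "\<forall>x\<ge>X. \<mu> + (2 * C + a * cmod \<kappa>) \<le> cmod (s (x + a) - s x)"
    unfolding eventually_at_top_linorder by (elim exE)
  obtain N :: nat where N: "X / a < real N" using reals_Archimedean2 by (rule exE)
  show ?thesis
  proof (intro exI[of _ N] allI impI)
    fix k assume k: "N \<le> k"
    have "X < real N * a" using N a by (simp add: field_simps)
    also have "\<dots> \<le> real k * a" using k a by (intro mult_right_mono) simp_all
    finally have 1: "\<mu> + (2 * C + a * cmod \<kappa>) \<le> cmod (s (real k * a + a) - s (real k * a))"
      using X by simp
    have 2: "cmod (s (real k * a + a) - s (real k * a))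
        \<le> (m1 (real k * a + a) + m2 (real k * a + a)) - (m1 (real k * a) + m2 (real k * a)) + (2 * C + a * cmod \<kappa>)"
      by (rule increments_of_potential) (use a in simp_all)
    have 3: "real (Suc k) * a = real k * a + a" by (simp add: algebra_simps)
    show "\<mu> \<le> (m1 (real (Suc k) * a) + m2 (real (Suc k) * a)) - (m1 (real k * a) + m2 (real k * a))"
      unfolding 3 using 1 2 by linarith
  qed
qed

text \<open>
  Both $2a^2$ and $2a/\mu$ are made small, first by the choice of $a$ and then by the choice of $\mu$, and the
  energy is bounded by the square of the norm of the image. A rational $a$ keeps all grid points in a fixed
  countable set.
\<close>

lemma regularized_grid_estimate:
  assumes lim: "\<forall>a>0. filterlim (\<lambda>x. cmod (s (x + a) - s x)) at_top at_top" and eps: "0 < \<epsilon>"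
  shows "\<exists>a N. 0 < a \<and> a \<in> \<rat> \<and> (\<forall>y u w h. minimal_triple s y u w \<longrightarrow>
      h = l2_scaleC (cis (- axis)) (abs_l2 w + l2_scaleC (of_real shift) (abs_l2 y)) \<longrightarrow>
      (norm (abs_l2 y))\<^sup>2 \<le> 2 * a * (\<Sum>k<N. (cmod (y (real k * a)))\<^sup>2) + \<epsilon> * (norm h)\<^sup>2)"
proof -
  have c: "0 < coercivity" by (rule coercivity_pos)
  define \<delta>' where "\<delta>' = \<epsilon> * coercivity\<^sup>2 / 4"
  have d: "0 < \<delta>'" using eps c by (simp add: \<delta>'_def)
  obtain a where a: "a \<in> \<rat>" "0 < a" "a < min 1 \<delta>'" using Rats_dense_in_real[of 0 "min 1 \<delta>'"] d by auto
  define \<mu> where "\<mu> = 2 * a / (2 * \<delta>')"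
  have mu: "0 < \<mu>" using a d by (simp add: \<mu>_def)
  obtain N where N: "\<forall>k\<ge>N. \<mu> \<le> (m1 (real (Suc k) * a) + m2 (real (Suc k) * a)) - (m1 (real k * a) + m2 (real k * a))"
    using increments_eventually_large[OF lim[rule_format, OF a(2)] a(2), where \<mu> = \<mu>] by (elim exE)
  show ?thesis
  proof (rule exI[of _ a], rule exI[of _ N], intro conjI allI impI a)
    fix y u w h assume t: "minimal_triple s y u w"
      and h: "h = l2_scaleC (cis (- axis)) (abs_l2 w + l2_scaleC (of_real shift) (abs_l2 y))"
    interpret e: minimal_element s \<gamma> \<delta> m1 m2 b \<kappa> C y u w
      by unfold_locales (rule t)
    obtain R where R: "0 \<le> R" "\<forall>x\<ge>R. y x = 0"
      and n: "e.n \<le> 2 * a * (\<Sum>k<N. e.F (real k * a)) + (2 * a\<^sup>2 + 2 * a / \<mu>) * (e.A R + e.B m1 R + e.B m2 R + e.n)"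
      using e.grid_estimate[OF a(2) mu N[rule_format]] by auto
    define T where "T = e.A R + e.B m1 R + e.B m2 R + e.n"
    have T: "T \<le> (norm h / coercivity)\<^sup>2"
      using regularized_energy_le[OF t h R] by (simp add: T_def e.n_def)
    have T0: "0 \<le> T" using regularized_energy(2-4)[OF t h R] by (simp add: T_def e.n_def)
    have "2 * a\<^sup>2 + 2 * a / \<mu> \<le> 4 * \<delta>'"
    proof -
      have "a * a \<le> 1 * \<delta>'" using a by (intro mult_mono) auto
      moreover have "2 * a / \<mu> = 2 * \<delta>'" using a d by (simp add: \<mu>_def)
      ultimately show ?thesis by (simp add: power2_eq_square)
    qed
    then have "(2 * a\<^sup>2 + 2 * a / \<mu>) * T \<le> (4 * \<delta>') * (norm h / coercivity)\<^sup>2"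
      using T T0 d by (intro mult_mono) auto
    also have "\<dots> = \<epsilon> * (norm h)\<^sup>2" using c by (simp add: \<delta>'_def power_divide)
    finally show "(norm (abs_l2 y))\<^sup>2 \<le> 2 * a * (\<Sum>k<N. (cmod (y (real k * a)))\<^sup>2) + \<epsilon> * (norm h)\<^sup>2"
      using n by (simp add: T_def e.n_def e.F_def)
  qed
qed

lemma regularized_pointwise:
  assumes t: "minimal_triple s y u w"
    and h: "h = l2_scaleC (cis (- axis)) (abs_l2 w + l2_scaleC (of_real shift) (abs_l2 y))" and x: "0 \<le> x"
  shows "cmod (y x) \<le> norm h / coercivity"
proof -
  interpret e: minimal_element s \<gamma> \<delta> m1 m2 b \<kappa> C y u w
    by unfold_locales (rule t)
  obtain R0 where R0: "0 \<le> R0" "\<forall>x\<ge>R0. y x = 0" using e.support_nonneg by (elim exE conjE)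
  define R where "R = max R0 x"
  have R: "0 \<le> R" "\<forall>x\<ge>R. y x = 0" "x \<le> R" using R0 by (simp_all add: R_def)
  have "(cmod (y x))\<^sup>2 \<le> e.A R + e.n" using e.F_le_energy[OF x R(3,2)] by (simp add: e.F_def)
  also have "\<dots> \<le> (norm h / coercivity)\<^sup>2"
    using regularized_energy_le[OF t h R(1,2)] regularized_energy(3,4)[OF t h R(1,2)] by (simp add: e.n_def)
  finally show ?thesis by (rule power2_le_imp_le) (use coercivity_pos in simp)
qed

text \<open>
  A subsequence converges at every nonnegative rational point, and the estimate above, applied to differences,
  makes it Cauchy.
\<close>

lemma regularized_compact:
  assumes lim: "\<forall>a>0. filterlim (\<lambda>x. cmod (s (x + a) - s x)) at_top at_top"
    and Z: "range Z \<subseteq> regularized_operator" and bnd: "bounded (range (snd \<circ> Z))"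
  shows "\<exists>r. strict_mono r \<and> convergent (fst \<circ> Z \<circ> (r::nat \<Rightarrow> nat))"
proof -
  have "\<forall>n. \<exists>q. fst (Z n) = abs_l2 (fst q) \<and> minimal_triple s (fst q) (fst (snd q)) (snd (snd q)) \<and>
      snd (Z n) = l2_scaleC (cis (- axis)) (abs_l2 (snd (snd q)) + l2_scaleC (of_real shift) (abs_l2 (fst q)))"
  proof
    fix n
    have "(fst (Z n), snd (Z n)) \<in> regularized_operator" using Z by auto
    from regularized_operatorE[OF this] obtain y u w where "fst (Z n) = abs_l2 y" "minimal_triple s y u w"
      "snd (Z n) = l2_scaleC (cis (- axis)) (abs_l2 w + l2_scaleC (of_real shift) (abs_l2 y))" by (elim exE conjE)
    then show "\<exists>q. fst (Z n) = abs_l2 (fst q) \<and> minimal_triple s (fst q) (fst (snd q)) (snd (snd q)) \<and>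
      snd (Z n) = l2_scaleC (cis (- axis)) (abs_l2 (snd (snd q)) + l2_scaleC (of_real shift) (abs_l2 (fst q)))"
      by (intro exI[of _ "(y, u, w)"]) simp
  qed
  from choice[OF this] obtain q where q: "\<forall>n. fst (Z n) = abs_l2 (fst (q n)) \<and>
      minimal_triple s (fst (q n)) (fst (snd (q n))) (snd (snd (q n))) \<and>
      snd (Z n) = l2_scaleC (cis (- axis)) (abs_l2 (snd (snd (q n))) + l2_scaleC (of_real shift) (abs_l2 (fst (q n))))"
    by (elim exE)
  define y where "y n = fst (q n)" for n
  define u where "u n = fst (snd (q n))" for n
  define w where "w n = snd (snd (q n))" for n
  have y: "fst (Z n) = abs_l2 (y n)" and t: "minimal_triple s (y n) (u n) (w n)"
    and h: "snd (Z n) = l2_scaleC (cis (- axis)) (abs_l2 (w n) + l2_scaleC (of_real shift) (abs_l2 (y n)))" for n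
    using q[rule_format, of n] unfolding y_def u_def w_def by simp_all
  obtain K where K0: "0 < K" and K: "\<forall>z\<in>range (snd \<circ> Z). norm z \<le> K"
    using bnd unfolding bounded_pos by (elim exE conjE)
  have Kn: "norm (snd (Z n)) \<le> K" for n using K by simp
  have c: "0 < coercivity" by (rule coercivity_pos)
  have ptw: "norm (y n x) \<le> K / coercivity" if "x \<in> \<rat> \<inter> {0..}" for n x
    using order_trans[OF regularized_pointwise[OF t h, of x n] divide_right_mono[OF Kn less_imp_le[OF c]]] that by simp
  have "\<exists>r. strict_mono (r :: nat \<Rightarrow> nat) \<and> (\<forall>x\<in>\<rat> \<inter> {0..}. \<exists>l. (\<lambda>n. y (r n) x) \<longlonglongrightarrow> l)"
  proof (rule function_convergent_subsequence[of "\<rat> \<inter> {0..}" y "K / coercivity"])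
    show "countable (\<rat> \<inter> {0 :: real..})" by (rule countable_Int1[OF countable_rat])
    show "norm (y n x) \<le> K / coercivity" if "x \<in> \<rat> \<inter> {0..}" for n x using that by (rule ptw)
    fix k :: "nat \<Rightarrow> nat"
    assume k: "strict_mono k" "\<And>x. x \<in> \<rat> \<inter> {0..} \<Longrightarrow> \<exists>l. (\<lambda>n. y (k n) x) \<longlonglongrightarrow> l"
    show ?thesis by (intro exI[of _ k] conjI k(1) ballI) (rule k(2))
  qed
  then obtain r where r: "strict_mono (r :: nat \<Rightarrow> nat)" "\<forall>x\<in>\<rat> \<inter> {0..}. \<exists>l. (\<lambda>n. y (r n) x) \<longlonglongrightarrow> l"
    by (elim exE conjE)
  have "Cauchy (fst \<circ> Z \<circ> r)"
  proof (rule metric_CauchyI)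
    fix e :: real assume e: "0 < e"
    define \<epsilon> where "\<epsilon> = e\<^sup>2 / (2 * (2 * K)\<^sup>2)"
    have eps: "0 < \<epsilon>" using e K0 by (simp add: \<epsilon>_def)
    obtain a N where a: "0 < a" "a \<in> \<rat>" and est: "\<forall>y u w h. minimal_triple s y u w \<longrightarrow>
      h = l2_scaleC (cis (- axis)) (abs_l2 w + l2_scaleC (of_real shift) (abs_l2 y)) \<longrightarrow>
      (norm (abs_l2 y))\<^sup>2 \<le> 2 * a * (\<Sum>k<N. (cmod (y (real k * a)))\<^sup>2) + \<epsilon> * (norm h)\<^sup>2"
      using regularized_grid_estimate[OF lim eps] by (elim exE conjE)
    define \<eta> where "\<eta> = e\<^sup>2 / (4 * a * (real N + 1))"
    have eta: "0 < \<eta>" using e a by (simp add: \<eta>_def add_nonneg_pos)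
    have "\<forall>k. \<exists>M. \<forall>i\<ge>M. \<forall>j\<ge>M. cmod (y (r i) (real k * a) - y (r j) (real k * a)) < sqrt \<eta>"
    proof
      fix k
      have "real k * a \<in> \<rat> \<inter> {0..}" using a by simp
      from r(2)[rule_format, OF this] obtain l where "(\<lambda>n. y (r n) (real k * a)) \<longlonglongrightarrow> l" by (elim exE)
      then have "Cauchy (\<lambda>n. y (r n) (real k * a))" by (rule LIMSEQ_imp_Cauchy)
      then show "\<exists>M. \<forall>i\<ge>M. \<forall>j\<ge>M. cmod (y (r i) (real k * a) - y (r j) (real k * a)) < sqrt \<eta>"
        by (rule CauchyD) (simp add: eta)
    qed
    from choice[OF this] obtain M where M: "\<forall>k. \<forall>i\<ge>M k. \<forall>j\<ge>M k. cmod (y (r i) (real k * a) - y (r j) (real k * a)) < sqrt \<eta>"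
      by (elim exE)
    define M' where "M' = Max (insert 0 (M ` {..<N}))"
    have M': "M k \<le> M'" if "k < N" for k unfolding M'_def using that by (intro Max_ge) auto
    have close: "dist (abs_l2 (y (r i))) (abs_l2 (y (r j))) < e" if ij: "M' \<le> i" "M' \<le> j" for i j
    proof -
      define p where "p = r i"
      define q where "q = r j"
      define z where "z x = y p x + (- 1) * y q x" for x
      define zw where "zw x = w p x + (- 1) * w q x" for x
      have tz: "minimal_triple s z (\<lambda>x. u p x + (- 1) * u q x) zw"
        unfolding z_def[abs_def] zw_def[abs_def] by (rule minimal_triple_add[OF t minimal_triple_scale[OF t]])
      have sq: "square_integrable (y n)" "square_integrable (w n)" for n
        using t[of n] by (simp_all add: minimal_triple_def)
      have az: "abs_l2 z = abs_l2 (y p) - abs_l2 (y q)" "abs_l2 zw = abs_l2 (w p) - abs_l2 (w q)"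
        unfolding z_def[abs_def] zw_def[abs_def] by (simp_all add: abs_l2_diff sq)
      define hz where "hz = l2_scaleC (cis (- axis)) (abs_l2 zw + l2_scaleC (of_real shift) (abs_l2 z))"
      interpret S: bounded_linear "l2_scaleC c" for c by (rule bounded_linear_l2_scaleC)
      have "hz = snd (Z p) - snd (Z q)"
        unfolding hz_def az h by (simp add: S.diff S.add algebra_simps)
      then have "norm hz \<le> 2 * K"
        using norm_triangle_ineq4[of "snd (Z p)" "snd (Z q)"] Kn[of p] Kn[of q] by simp
      then have hz2: "(norm hz)\<^sup>2 \<le> (2 * K)\<^sup>2" by (rule power_mono) simp
      have "(norm (abs_l2 z))\<^sup>2 \<le> 2 * a * (\<Sum>k<N. (cmod (z (real k * a)))\<^sup>2) + \<epsilon> * (norm hz)\<^sup>2"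
        by (rule est[rule_format, OF tz hz_def])
      also have "\<dots> \<le> 2 * a * (\<Sum>k<N. \<eta>) + \<epsilon> * (2 * K)\<^sup>2"
      proof (intro add_mono mult_left_mono sum_mono hz2)
        fix k assume k: "k \<in> {..<N}"
        have "M k \<le> i" "M k \<le> j" using M'[of k] k ij by simp_all
        then have "cmod (z (real k * a)) \<le> sqrt \<eta>"
          using M[rule_format, of k i j] by (simp add: z_def p_def q_def)
        then have "(cmod (z (real k * a)))\<^sup>2 \<le> (sqrt \<eta>)\<^sup>2" by (rule power_mono) simp
        then show "(cmod (z (real k * a)))\<^sup>2 \<le> \<eta>" using eta by simp
      qed (use a eps in simp_all)
      also have "\<dots> = (real N / (real N + 1)) * (e\<^sup>2 / 2) + e\<^sup>2 / 2"
      proof -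
        have gen: "2 * a * (n * (x / (4 * a * W))) = n / W * (x / 2)" if "0 < W" for n x W :: real
          using a(1) that by (simp add: field_simps)
        have "2 * a * (\<Sum>k<N. \<eta>) = real N / (real N + 1) * (e\<^sup>2 / 2)"
          using gen[of "real N + 1" "real N" "e\<^sup>2"] by (simp add: \<eta>_def)
        moreover have "\<epsilon> * (2 * K)\<^sup>2 = e\<^sup>2 / 2" using K0 by (simp add: \<epsilon>_def)
        ultimately show ?thesis by simp
      qed
      also have "\<dots> < 1 * (e\<^sup>2 / 2) + e\<^sup>2 / 2"
        using e by (intro add_strict_right_mono mult_strict_right_mono) simp_all
      also have "\<dots> = e\<^sup>2" by simp
      finally have "norm (abs_l2 z) < e" using e by (intro power2_less_imp_less[of _ e]) simp_all
      then show ?thesis by (simp add: dist_norm az p_def q_def)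
    qed
    show "\<exists>M. \<forall>m\<ge>M. \<forall>n\<ge>M. dist ((fst \<circ> Z \<circ> r) m) ((fst \<circ> Z \<circ> r) n) < e"
      using close by (intro exI[of _ M'] allI impI) (simp add: y)
  qed
  then have "convergent (fst \<circ> Z \<circ> r)" by (simp add: Cauchy_convergent)
  then show ?thesis using r(1) by (intro exI[of _ r] conjI)
qed

lemma increments_diverge_imp_compact_extension:
  assumes lim: "\<forall>a>0. filterlim (\<lambda>x. cmod (s (x + a) - s x)) at_top at_top"
  shows "has_extensions_with_compact_resolvents (minimal_operator s)"
proof -
  have skew: "inner (l2_scaleC \<i> f) g = - inner f (l2_scaleC \<i> g)" for f g
    by (simp add: inner_l2_def l2_cinner_scaleC_left l2_cinner_scaleC_right)
  have dense: "f = 0" if orth: "\<And>y g. (y, g) \<in> regularized_operator \<Longrightarrow> inner f y = 0" for f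
  proof (rule minimal_operator_domain_dense[OF s_meas])
    show "\<exists>K. \<forall>x\<in>{0..R}. cmod (s x) \<le> K" if "0 \<le> R" for R using that by (rule s_locally_bounded)
    show "inner f y = 0" if "(y, g) \<in> minimal_operator s" for y g
      using regularized_operatorI[OF that] by (rule orth)
  qed
  show ?thesis
  proof (rule accretive_compact_injective_inverse_extension[of regularized_operator "l2_scaleC \<i>" coercivity])
    show "subspace regularized_operator" by (rule subspace_regularized_operator)
    show "bounded_linear (l2_scaleC \<i>)" by (rule bounded_linear_l2_scaleC)
    show "inner (l2_scaleC \<i> f) g = - inner f (l2_scaleC \<i> g)" for f g by (rule skew)
    show "(l2_scaleC \<i> y, l2_scaleC \<i> g) \<in> regularized_operator" if "(y, g) \<in> regularized_operator" for y g
      using that by (rule regularized_operator_scale)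
    show "0 < coercivity" by (rule coercivity_pos)
    show "coercivity * (norm y)\<^sup>2 \<le> inner g y" if "(y, g) \<in> regularized_operator" for y g
      using that by (rule regularized_coercive)
    show "f = 0" if "\<And>y g. (y, g) \<in> regularized_operator \<Longrightarrow> inner f y = 0" for f
      using that by (rule dense)
    show "\<exists>r. strict_mono r \<and> convergent (fst \<circ> Z \<circ> (r :: nat \<Rightarrow> nat))"
      if "range Z \<subseteq> regularized_operator" "bounded (range (snd \<circ> Z))" for Z
      using lim that by (rule regularized_compact)
    fix R assume R: "bounded_linear R" "inj R" "\<And>h. R (l2_scaleC \<i> h) = l2_scaleC \<i> (R h)"
      and RG: "\<And>y g. (y, g) \<in> regularized_operator \<Longrightarrow> R g = y"
      and comp: "\<And>f. bounded (range f) \<Longrightarrow> \<exists>r. strict_mono r \<and> convergent (R \<circ> f \<circ> (r::nat \<Rightarrow> nat))"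
    show ?thesis
    proof (rule extension_from_compact_inverse[OF R comp])
      show "cis (- axis) \<noteq> 0" by simp
      show "R (l2_scaleC (cis (- axis)) (w + l2_scaleC (of_real shift) y)) = y" if "(y, w) \<in> minimal_operator s" for y w
        by (rule RG[OF regularized_operatorI[OF that]])
    qed
  qed
qed

lemma strictly_sectorial_minimal_operator: "strictly_sectorial (minimal_operator s)"
  unfolding strictly_sectorial_def
proof (rule exI[of _ vertex], rule exI[of _ \<gamma>], rule exI[of _ \<delta>], intro conjI)
  show "0 \<le> \<delta> - \<gamma>" "\<delta> - \<gamma> < pi" using angles by simp_all
  show "\<forall>(f, g)\<in>minimal_operator s. norm f = 1 \<longrightarrow> l2_cinner g f \<in> sector \<gamma> \<delta> vertex"
  proof (intro ballI, clarify)
    fix f g assume fg: "(f, g) \<in> minimal_operator s" and n: "norm f = 1"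
    obtain y u w where y: "f = abs_l2 y" "g = abs_l2 w" and t: "minimal_triple s y u w"
      using fg unfolding minimal_operator_iff by (elim exE conjE)
    interpret e: minimal_element s \<gamma> \<delta> m1 m2 b \<kappa> C y u w
      by unfold_locales (rule t)
    have "e.n = 1" using n by (simp add: e.n_def y)
    then show "l2_cinner g f \<in> sector \<gamma> \<delta> vertex" unfolding y by (rule e.cinner_in_sector)
  qed
qed

end

theorem theorem4:
  fixes s :: "real \<Rightarrow> complex" and d \<alpha> \<beta> :: real and z\<^sub>0 :: complex
  assumes "L2_loc s"
    and "d > 0"
    and "0 \<le> \<beta> - \<alpha>" "\<beta> - \<alpha> < pi" "\<bar>\<alpha>\<bar> < pi" "\<bar>\<beta>\<bar> < pi"
    and "\<forall>x\<ge>0. \<forall>t\<ge>0. 0 \<le> x - t \<and> x - t \<le> d \<longrightarrow> s x - s t \<in> sector \<alpha> \<beta> z\<^sub>0"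
  shows "strictly_sectorial (minimal_operator s) \<and>
    (has_extensions_with_compact_resolvents (minimal_operator s) \<longleftrightarrow>
      (\<forall>a>0. filterlim (\<lambda>x. cmod (s (x + a) - s x)) at_top at_top))"
proof -
  obtain \<gamma> \<delta> m1 m2 b \<kappa> C where dec: "\<gamma> < 0" "0 < \<delta>" "\<delta> - \<gamma> < pi" "mono_on {0..} m1" "mono_on {0..} m2"
    "\<forall>x\<ge>0. cmod (b x) \<le> C"
    "\<forall>x\<ge>0. s x = of_real (m1 x) * cis \<gamma> + of_real (m2 x) * cis \<delta> + b x + of_real x * \<kappa>"
    using sectorial_increments_decomposition[OF assms(2-7)] by (elim exE conjE)
  interpret sectorial_potential s \<gamma> \<delta> m1 m2 b \<kappa> C
  proof unfold_locales
    show "s \<in> borel_measurable half_line" using assms(1) by (simp add: L2_loc_def)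
  qed (use dec in simp_all)
  show ?thesis
  proof (intro conjI iffI allI impI)
    show "strictly_sectorial (minimal_operator s)" by (rule strictly_sectorial_minimal_operator)
    show "filterlim (\<lambda>x. cmod (s (x + a) - s x)) at_top at_top"
      if "has_extensions_with_compact_resolvents (minimal_operator s)" "0 < a" for a
      using that by (rule compact_extension_imp_increments_diverge)
    show "has_extensions_with_compact_resolvents (minimal_operator s)"
      if "\<forall>a>0. filterlim (\<lambda>x. cmod (s (x + a) - s x)) at_top at_top"
      using that by (rule increments_diverge_imp_compact_extension)
  qed
qed

end
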